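(* Let $T$ be a complete NIP theory, $A$ a set of parameters, $a,b$ two tuples and $\kappa_1,\kappa_2$ cardinals. If $\mathrm{str}(a/A)<\kappa_1$ and $\mathrm{str}(b/Aa)<\kappa_2$, then $\mathrm{str}(a,b/A)<\kappa_1+\kappa_2-1$.
   Context: $\mathcal U$ is a monster model; $I+J$ is concatenation and $I+c+J$ inserts a single tuple $c$. Sequences $(I_i)_i$ are mutually indiscernible over $C$ if each $I_i$ is indiscernible over $C\cup\bigcup_{j\ne i}I_j$. For a partial type $\pi$ over $C$ and a cardinal $\kappa$, $\mathrm{str}(\pi,C)<\kappa$ means there do NOT exist $d\models\pi$, sequences $(I_i:i<\kappa)$, $(J_i:i<\kappa)$ without endpoints with $(I_i+J_i:i<\kappa)$ mutually indiscernible over $Cd$, and tuples $(c_i:i<\kappa)$ with $(I_i+c_i+J_i:i<\kappa)$ mutually indiscernible over $C$ but each $I_i+c_i+J_i$ not indiscernible over $Cd$. $\mathrm{str}(a/A)$ denotes $\mathrm{str}(\mathrm{tp}(a/A),A)$. *)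

theory Defs
  imports Main
begin

unbundle cardinal_syntax

section \<open>First-order logic\<close>

datatype 'f trm = Var nat | Fn 'f "'f trm list"

datatype ('f, 'r) fm =
    Eq "'f trm" "'f trm"
  | Rl 'r "'f trm list"
  | Neg "('f, 'r) fm"
  | Conj "('f, 'r) fm" "('f, 'r) fm"
  | Ex nat "('f, 'r) fm"

text \<open>A symbol is a name together with its arity; constants are 0-ary function symbols.\<close>

record ('f, 'r) lang =
  funs :: "('f \<times> nat) set"
  rels :: "('r \<times> nat) set"

record ('f, 'r, 'm) struct =
  univ :: "'m set"
  fn :: "'f \<Rightarrow> 'm list \<Rightarrow> 'm"
  rl :: "'r \<Rightarrow> 'm list \<Rightarrow> bool"

fun wf_trm :: "('f, 'r) lang \<Rightarrow> 'f trm \<Rightarrow> bool" where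
  "wf_trm L (Var x) \<longleftrightarrow> True"
| "wf_trm L (Fn f ts) \<longleftrightarrow> (f, length ts) \<in> funs L \<and> (\<forall>t\<in>set ts. wf_trm L t)"

fun wf_fm :: "('f, 'r) lang \<Rightarrow> ('f, 'r) fm \<Rightarrow> bool" where
  "wf_fm L (Eq s t) \<longleftrightarrow> wf_trm L s \<and> wf_trm L t"
| "wf_fm L (Rl R ts) \<longleftrightarrow> (R, length ts) \<in> rels L \<and> (\<forall>t\<in>set ts. wf_trm L t)"
| "wf_fm L (Neg \<phi>) \<longleftrightarrow> wf_fm L \<phi>"
| "wf_fm L (Conj \<phi> \<psi>) \<longleftrightarrow> wf_fm L \<phi> \<and> wf_fm L \<psi>"
| "wf_fm L (Ex x \<phi>) \<longleftrightarrow> wf_fm L \<phi>"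

fun fv_trm :: "'f trm \<Rightarrow> nat set" where
  "fv_trm (Var x) = {x}"
| "fv_trm (Fn f ts) = (\<Union>t\<in>set ts. fv_trm t)"

fun fv :: "('f, 'r) fm \<Rightarrow> nat set" where
  "fv (Eq s t) = fv_trm s \<union> fv_trm t"
| "fv (Rl R ts) = (\<Union>t\<in>set ts. fv_trm t)"
| "fv (Neg \<phi>) = fv \<phi>"
| "fv (Conj \<phi> \<psi>) = fv \<phi> \<union> fv \<psi>"
| "fv (Ex x \<phi>) = fv \<phi> - {x}"

fun eval :: "('f, 'r, 'm) struct \<Rightarrow> (nat \<Rightarrow> 'm) \<Rightarrow> 'f trm \<Rightarrow> 'm" where
  "eval M e (Var x) = e x"
| "eval M e (Fn f ts) = fn M f (map (eval M e) ts)"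

fun sat :: "('f, 'r, 'm) struct \<Rightarrow> (nat \<Rightarrow> 'm) \<Rightarrow> ('f, 'r) fm \<Rightarrow> bool" where
  "sat M e (Eq s t) \<longleftrightarrow> eval M e s = eval M e t"
| "sat M e (Rl R ts) \<longleftrightarrow> rl M R (map (eval M e) ts)"
| "sat M e (Neg \<phi>) \<longleftrightarrow> \<not> sat M e \<phi>"
| "sat M e (Conj \<phi> \<psi>) \<longleftrightarrow> sat M e \<phi> \<and> sat M e \<psi>"
| "sat M e (Ex x \<phi>) \<longleftrightarrow> (\<exists>m\<in>univ M. sat M (e(x := m)) \<phi>)"

definition is_struct :: "('f, 'r) lang \<Rightarrow> ('f, 'r, 'm) struct \<Rightarrow> bool" where
  "is_struct L M \<longleftrightarrow> univ M \<noteq> {} \<and>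
     (\<forall>(f, n)\<in>funs L. \<forall>xs. length xs = n \<and> set xs \<subseteq> univ M \<longrightarrow> fn M f xs \<in> univ M)"

definition sentences :: "('f, 'r) lang \<Rightarrow> ('f, 'r) fm set" where
  "sentences L = {\<phi>. wf_fm L \<phi> \<and> fv \<phi> = {}}"

definition is_model :: "('f, 'r) lang \<Rightarrow> ('f, 'r) fm set \<Rightarrow> ('f, 'r, 'm) struct \<Rightarrow> bool" where
  "is_model L T M \<longleftrightarrow> is_struct L M \<and> (\<forall>\<phi>\<in>T. \<forall>e. sat M e \<phi>)"

text \<open>
  Logical consequence. The models range over the structures whose universe is a subset of the
  type of formulas. That type has cardinality at least $|L| + \aleph_0$, so by the downward
  Loewenheim--Skolem theorem this is the same as consequence in all structures.
\<close>

definition entails :: "('f, 'r) lang \<Rightarrow> ('f, 'r) fm set \<Rightarrow> ('f, 'r) fm \<Rightarrow> bool" where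
  "entails L T \<phi> \<longleftrightarrow>
     (\<forall>M :: ('f, 'r, ('f, 'r) fm) struct. is_model L T M \<longrightarrow> is_model L {\<phi>} M)"

text \<open>Exactly one of the two consequences holds, so a complete theory is consistent.\<close>

definition complete_theory :: "('f, 'r) lang \<Rightarrow> ('f, 'r) fm set \<Rightarrow> bool" where
  "complete_theory L T \<longleftrightarrow> T \<subseteq> sentences L \<and>
     (\<forall>\<phi>\<in>sentences L. entails L T \<phi> \<longleftrightarrow> \<not> entails L T (Neg \<phi>))"

section \<open>Tuples and types\<close>

text \<open>
  A tuple is a family \<open>a :: 'x \<Rightarrow> 'm\<close> considered on an index set \<open>X\<close>, which may be infinite.
  A formula over \<open>C\<close> in the variables \<open>X\<close> is a pair \<open>(\<phi>, \<sigma>)\<close> in which \<open>\<sigma>\<close> replaces each free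
  variable of \<open>\<phi>\<close> by one of the variables (\<open>Inl x\<close>) or by a parameter (\<open>Inr c\<close>).
\<close>

type_synonym ('f, 'r, 'x, 'm) pfm = "('f, 'r) fm \<times> (nat \<Rightarrow> 'x + 'm)"

definition fms_over :: "('f, 'r) lang \<Rightarrow> 'x set \<Rightarrow> 'm set \<Rightarrow> ('f, 'r, 'x, 'm) pfm set" where
  "fms_over L X C = {(\<phi>, \<sigma>). wf_fm L \<phi> \<and> \<sigma> ` fv \<phi> \<subseteq> X <+> C}"

definition psat :: "('f, 'r, 'm) struct \<Rightarrow> ('x \<Rightarrow> 'm) \<Rightarrow> ('f, 'r, 'x, 'm) pfm \<Rightarrow> bool" where
  "psat M a = (\<lambda>(\<phi>, \<sigma>). sat M (case_sum a id \<circ> \<sigma>) \<phi>)"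

definition realizes ::
    "('f, 'r, 'm) struct \<Rightarrow> 'x set \<Rightarrow> ('x \<Rightarrow> 'm) \<Rightarrow> ('f, 'r, 'x, 'm) pfm set \<Rightarrow> bool" where
  "realizes M X d \<pi> \<longleftrightarrow> d ` X \<subseteq> univ M \<and> (\<forall>\<theta>\<in>\<pi>. psat M d \<theta>)"

definition partial_type ::
    "('f, 'r) lang \<Rightarrow> ('f, 'r, 'm) struct \<Rightarrow> 'x set \<Rightarrow> 'm set \<Rightarrow> ('f, 'r, 'x, 'm) pfm set \<Rightarrow> bool" where
  "partial_type L M X C \<pi> \<longleftrightarrow> \<pi> \<subseteq> fms_over L X C \<and>
     (\<forall>\<pi>0. finite \<pi>0 \<and> \<pi>0 \<subseteq> \<pi> \<longrightarrow> (\<exists>d. realizes M X d \<pi>0))"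

definition tp ::
    "('f, 'r) lang \<Rightarrow> ('f, 'r, 'm) struct \<Rightarrow> 'x set \<Rightarrow> ('x \<Rightarrow> 'm) \<Rightarrow> 'm set \<Rightarrow> ('f, 'r, 'x, 'm) pfm set"
  where "tp L M X a A = {\<theta> \<in> fms_over L X A. psat M a \<theta>}"

section \<open>Monster models\<close>

definition saturated :: "('f, 'r) lang \<Rightarrow> ('f, 'r, 'm) struct \<Rightarrow> 'k rel \<Rightarrow> bool" where
  "saturated L M \<mu> \<longleftrightarrow>
     (\<forall>A (\<pi> :: ('f, 'r, unit, 'm) pfm set).
        A \<subseteq> univ M \<and> |A| <o \<mu> \<and> partial_type L M UNIV A \<pi> \<longrightarrow> (\<exists>d. realizes M UNIV d \<pi>))"

definition automorphism :: "('f, 'r) lang \<Rightarrow> ('f, 'r, 'm) struct \<Rightarrow> ('m \<Rightarrow> 'm) \<Rightarrow> bool" where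
  "automorphism L M g \<longleftrightarrow> bij_betw g (univ M) (univ M) \<and>
     (\<forall>(f, n)\<in>funs L. \<forall>xs. length xs = n \<and> set xs \<subseteq> univ M \<longrightarrow> g (fn M f xs) = fn M f (map g xs)) \<and>
     (\<forall>(R, n)\<in>rels L. \<forall>xs. length xs = n \<and> set xs \<subseteq> univ M \<longrightarrow> (rl M R xs \<longleftrightarrow> rl M R (map g xs)))"

definition partial_elementary ::
    "('f, 'r) lang \<Rightarrow> ('f, 'r, 'm) struct \<Rightarrow> 'm set \<Rightarrow> ('m \<Rightarrow> 'm) \<Rightarrow> bool" where
  "partial_elementary L M D h \<longleftrightarrow> D \<subseteq> univ M \<and> h ` D \<subseteq> univ M \<and>
     (\<forall>\<phi> e. wf_fm L \<phi> \<and> e ` fv \<phi> \<subseteq> D \<longrightarrow> (sat M e \<phi> \<longleftrightarrow> sat M (h \<circ> e) \<phi>))"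

definition strongly_homogeneous :: "('f, 'r) lang \<Rightarrow> ('f, 'r, 'm) struct \<Rightarrow> 'k rel \<Rightarrow> bool" where
  "strongly_homogeneous L M \<mu> \<longleftrightarrow>
     (\<forall>D h. |D| <o \<mu> \<and> partial_elementary L M D h \<longrightarrow>
        (\<exists>g. automorphism L M g \<and> (\<forall>x\<in>D. g x = h x)))"

text \<open>\<open>\<mu>\<close> is the cardinal below which sets are called small; it exceeds $|L| + \aleph_0$.\<close>

definition monster_model ::
    "('f, 'r) lang \<Rightarrow> ('f, 'r) fm set \<Rightarrow> ('f, 'r, 'm) struct \<Rightarrow> 'k rel \<Rightarrow> bool" where
  "monster_model L T U \<mu> \<longleftrightarrow> is_model L T U \<and>
     Card_order \<mu> \<and> natLeq <o \<mu> \<and> |funs L| <o \<mu> \<and> |rels L| <o \<mu> \<and>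
     saturated L U \<mu> \<and> strongly_homogeneous L U \<mu>"

text \<open>
  A partitioned formula $\varphi(x;y)$ is given by \<open>\<phi>\<close> and the set \<open>P\<close> of those variables that
  belong to $x$. It has the independence property if some $(a_i)_{i<\omega}$ and
  $(b_S)_{S\subseteq\omega}$ satisfy $\varphi(a_i;b_S)$ iff $i\in S$.
\<close>

definition has_IP :: "('f, 'r, 'm) struct \<Rightarrow> nat set \<Rightarrow> ('f, 'r) fm \<Rightarrow> bool" where
  "has_IP M P \<phi> \<longleftrightarrow>
     (\<exists>(a :: nat \<Rightarrow> nat \<Rightarrow> 'm) (b :: nat set \<Rightarrow> nat \<Rightarrow> 'm).
        (\<forall>i. range (a i) \<subseteq> univ M) \<and> (\<forall>S. range (b S) \<subseteq> univ M) \<and>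
        (\<forall>i S. sat M (\<lambda>v. if v \<in> P then a i v else b S v) \<phi> \<longleftrightarrow> i \<in> S))"

definition NIP :: "('f, 'r) lang \<Rightarrow> ('f, 'r, 'm) struct \<Rightarrow> bool" where
  "NIP L M \<longleftrightarrow> (\<forall>\<phi> P. wf_fm L \<phi> \<longrightarrow> \<not> has_IP M P \<phi>)"

section \<open>Indiscernible sequences\<close>

text \<open>
  A sequence of tuples consists of a reflexive linear order \<open>r\<close>, whose field is the set of
  indices, and the family of its members. The index set \<open>V\<close> of the members is kept separate.
\<close>

type_synonym ('o, 'v, 'm) tseq = "'o rel \<times> ('o \<Rightarrow> 'v \<Rightarrow> 'm)"

definition is_tseq :: "('f, 'r, 'm) struct \<Rightarrow> 'v set \<Rightarrow> ('o, 'v, 'm) tseq \<Rightarrow> bool" where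
  "is_tseq M V I \<longleftrightarrow> Linear_order (fst I) \<and> (\<forall>t\<in>Field (fst I). snd I t ` V \<subseteq> univ M)"

definition without_endpoints :: "('o, 'v, 'm) tseq \<Rightarrow> bool" where
  "without_endpoints I \<longleftrightarrow> Field (fst I) \<noteq> {} \<and>
     (\<forall>t\<in>Field (fst I). (\<exists>s. s \<noteq> t \<and> (s, t) \<in> fst I) \<and> (\<exists>s. s \<noteq> t \<and> (t, s) \<in> fst I))"

definition order_sum :: "'o rel \<Rightarrow> 'p rel \<Rightarrow> ('o + 'p) rel" where
  "order_sum r s = map_prod Inl Inl ` r \<union> map_prod Inr Inr ` s \<union> (Inl ` Field r) \<times> (Inr ` Field s)"

definition concat_tseq ::
    "('o, 'v, 'm) tseq \<Rightarrow> ('p, 'v, 'm) tseq \<Rightarrow> ('o + 'p, 'v, 'm) tseq" where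
  "concat_tseq I J = (order_sum (fst I) (fst J), case_sum (snd I) (snd J))"

definition single_tseq :: "('v \<Rightarrow> 'm) \<Rightarrow> (unit, 'v, 'm) tseq" where
  "single_tseq c = ({((), ())}, \<lambda>_. c)"

definition insert_tseq ::
    "('o, 'v, 'm) tseq \<Rightarrow> ('v \<Rightarrow> 'm) \<Rightarrow> ('p, 'v, 'm) tseq \<Rightarrow> ('o + (unit + 'p), 'v, 'm) tseq" where
  "insert_tseq I c J = concat_tseq I (concat_tseq (single_tseq c) J)"

definition tseq_elems :: "'v set \<Rightarrow> ('o, 'v, 'm) tseq \<Rightarrow> 'm set" where
  "tseq_elems V I = (\<Union>t\<in>Field (fst I). snd I t ` V)"

definition increasing :: "'o rel \<Rightarrow> 'o list \<Rightarrow> bool" where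
  "increasing r ts \<longleftrightarrow> set ts \<subseteq> Field r \<and> sorted_wrt (\<lambda>s t. s \<noteq> t \<and> (s, t) \<in> r) ts"

definition indiscernible ::
    "('f, 'r) lang \<Rightarrow> ('f, 'r, 'm) struct \<Rightarrow> 'v set \<Rightarrow> ('o, 'v, 'm) tseq \<Rightarrow> 'm set \<Rightarrow> bool" where
  "indiscernible L M V I C \<longleftrightarrow>
     (\<forall>ss ts. increasing (fst I) ss \<and> increasing (fst I) ts \<and> length ss = length ts \<longrightarrow>
        tp L M ({..<length ss} \<times> V) (\<lambda>(k, v). snd I (ss ! k) v) C =
        tp L M ({..<length ts} \<times> V) (\<lambda>(k, v). snd I (ts ! k) v) C)"

definition mutually_indiscernible ::
    "('f, 'r) lang \<Rightarrow> ('f, 'r, 'm) struct \<Rightarrow> 'i set \<Rightarrow> ('i \<Rightarrow> 'v set) \<Rightarrow> ('i \<Rightarrow> ('o, 'v, 'm) tseq) \<Rightarrow>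
     'm set \<Rightarrow> bool" where
  "mutually_indiscernible L M K V I C \<longleftrightarrow>
     (\<forall>i\<in>K. indiscernible L M (V i) (I i) (C \<union> (\<Union>j\<in>K - {i}. tseq_elems (V j) (I j))))"

section \<open>The rank\<close>

text \<open>
  \<open>str_less L U \<mu> X \<pi> C \<kappa>\<close> is $\mathrm{str}(\pi, C) < \kappa$ for a partial type \<open>\<pi>\<close> over \<open>C\<close> in the
  variables \<open>X\<close>. As always in a monster model, sequences and tuples are small. Their index sets
  are taken inside \<open>'m\<close>; this is no restriction when the universe is infinite, since every
  small order is then isomorphic to one on a subset of \<open>'m\<close>, and nothing is lost when it is
  finite, since indiscernible sequences without endpoints are then constant.
\<close>

definition str_less ::
    "('f, 'r) lang \<Rightarrow> ('f, 'r, 'm) struct \<Rightarrow> 'k rel \<Rightarrow> 'x set \<Rightarrow> ('f, 'r, 'x, 'm) pfm set \<Rightarrow> 'm set \<Rightarrow>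
     'i rel \<Rightarrow> bool" where
  "str_less L U \<mu> X \<pi> C \<kappa> \<longleftrightarrow>
     \<not> (\<exists>(d :: 'x \<Rightarrow> 'm) (V :: 'i \<Rightarrow> 'm set) (I :: 'i \<Rightarrow> ('m, 'm, 'm) tseq)
          (J :: 'i \<Rightarrow> ('m, 'm, 'm) tseq) (c :: 'i \<Rightarrow> 'm \<Rightarrow> 'm).
          realizes U X d \<pi> \<and>
          (\<forall>i\<in>Field \<kappa>. |V i| <o \<mu> \<and>
             is_tseq U (V i) (I i) \<and> |Field (fst (I i))| <o \<mu> \<and> without_endpoints (I i) \<and>
             is_tseq U (V i) (J i) \<and> |Field (fst (J i))| <o \<mu> \<and> without_endpoints (J i) \<and>
             c i ` V i \<subseteq> univ U) \<and>
          mutually_indiscernible L U (Field \<kappa>) V (\<lambda>i. concat_tseq (I i) (J i)) (C \<union> d ` X) \<and>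
          mutually_indiscernible L U (Field \<kappa>) V (\<lambda>i. insert_tseq (I i) (c i) (J i)) C \<and>
          (\<forall>i\<in>Field \<kappa>. \<not> indiscernible L U (V i) (insert_tseq (I i) (c i) (J i)) (C \<union> d ` X)))"

definition str_tp_less ::
    "('f, 'r) lang \<Rightarrow> ('f, 'r, 'm) struct \<Rightarrow> 'k rel \<Rightarrow> 'x set \<Rightarrow> ('x \<Rightarrow> 'm) \<Rightarrow> 'm set \<Rightarrow> 'i rel \<Rightarrow> bool" where
  "str_tp_less L U \<mu> X a A \<kappa> \<longleftrightarrow> str_less L U \<mu> X (tp L U X a A) A \<kappa>"

text \<open>$\kappa - 1$, which is $\kappa$ itself when $\kappa$ is infinite.\<close>

definition card_pred :: "'i rel \<Rightarrow> 'i rel" where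
  "card_pred \<kappa> = |Field \<kappa> - {SOME x. x \<in> Field \<kappa>}|"

end

theory Submission
  imports Defs "HOL-Library.Nat_Bijection"
begin

text \<open>
  Suppose that \<open>I_i + c_i + J_i\<close>, for \<open>i\<close> in an index set \<open>K\<close> of size \<open>\<kappa>1 + \<kappa>2 - 1\<close>, witness that the
  rank of \<open>a, b\<close> over \<open>A\<close> is not small. Take a maximal \<open>S \<subseteq> K\<close> such that the sequences stay mutually
  indiscernible over \<open>A a\<close> after the \<open>c_i\<close> with \<open>i \<in> S\<close> have been inserted. If \<open>|S| \<ge> \<kappa>2\<close>, the sequences in \<open>S\<close>
  are a pattern for \<open>b\<close> over \<open>A a\<close>. Otherwise \<open>|K - S| \<ge> \<kappa>1\<close>, and for each \<open>i \<in> K - S\<close> some formula over \<open>A a\<close>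
  distinguishes \<open>c_i\<close> from its neighbours, but it may mention members of the other sequences.
  By saturation, insert new sequences \<open>I_i*\<close> and \<open>J_i*\<close> directly around each \<open>c_i\<close>: the members mentioned
  by the formulas then lie outside \<open>I_i* + c_i + J_i*\<close> and can be added to its members as constant
  coordinates, which gives a pattern for \<open>a\<close> over \<open>A\<close>. Saturation applies because NIP bounds \<open>|K|\<close>.
\<close>

section \<open>Syntax and satisfaction\<close>

text \<open>The rank asks each sequence to fail over the base and the realization alone, but
  maximality of \<open>S\<close> yields a failure whose formula may also mention old members of all
  sequences and central members from \<open>S\<close>. Made constant coordinates, these would break
  indiscernibility if they lay among the positions of the new sequence, because their order relative
  to a member would change with its position. The stretching therefore has to secure at once
  indiscernibility over \<open>A a\<close> with the centres in \<open>S\<close>, indiscernibility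
  over \<open>A\<close> with all centres, and the truth values of the distinguishing formulas.
  Finite parts of these demands hold in the old sequences because \<open>I_i\<close> has no last and
  \<open>J_i\<close> no first position, so that finitely many new positions fit near the centre. The
  definition of the rank does not bound the number of sequences, whereas saturation realizes types
  in fewer than \<open>\<mu>\<close> variables only; this is where NIP enters. The term -1 is a
  count: for finite cardinals, fewer than \<kappa>2 indices in \<open>S\<close> and fewer than
  \<kappa>1 outside make at most \<kappa>1 + \<kappa>2 - 2.\<close>

lemma finite_fv_trm: "finite (fv_trm t)"
  by (induction t) auto

lemma finite_fv: "finite (fv \<phi>)"
  by (induction \<phi>) (auto simp: finite_fv_trm)

lemma eval_cong: "(\<And>x. x \<in> fv_trm t \<Longrightarrow> e x = e' x) \<Longrightarrow> eval M e t = eval M e' t"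
proof (induction t)
  case (Fn f ts)
  then have "map (eval M e) ts = map (eval M e') ts"
    by (intro map_cong) auto
  then show ?case by (metis eval.simps(2))
qed simp

lemma sat_cong: "(\<And>x. x \<in> fv \<phi> \<Longrightarrow> e x = e' x) \<Longrightarrow> sat M e \<phi> \<longleftrightarrow> sat M e' \<phi>"
proof (induction \<phi> arbitrary: e e')
  case (Eq s t)
  then show ?case using eval_cong[of s e e' M] eval_cong[of t e e' M] by auto
next
  case (Rl R ts)
  then have "map (eval M e) ts = map (eval M e') ts"
    by (intro map_cong refl eval_cong) auto
  then show ?case by (metis sat.simps(2))
next
  case (Neg \<phi>)
  then show ?case by (metis fv.simps(3) sat.simps(3))
next
  case (Conj \<phi> \<psi>)
  have "sat M e \<phi> \<longleftrightarrow> sat M e' \<phi>" "sat M e \<psi> \<longleftrightarrow> sat M e' \<psi>"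
    by (rule Conj.IH; simp add: Conj.prems)+
  then show ?case by simp
next
  case (Ex x \<phi>)
  have "sat M (e(x := m)) \<phi> \<longleftrightarrow> sat M (e'(x := m)) \<phi>" for m
    by (rule Ex.IH) (use Ex.prems in auto)
  then show ?case by simp
qed

lemma psat_cong:
  assumes "\<And>x. x \<in> fv \<phi> \<Longrightarrow> case_sum d id (\<sigma> x) = case_sum d' id (\<sigma>' x)"
  shows "psat M d (\<phi>, \<sigma>) \<longleftrightarrow> psat M d' (\<phi>, \<sigma>')"
  unfolding psat_def prod.case by (rule sat_cong) (use assms in auto)

lemma psat_Neg: "psat M d (Neg \<phi>, \<sigma>) \<longleftrightarrow> \<not> psat M d (\<phi>, \<sigma>)"
  by (simp add: psat_def)

lemma fms_over_Neg: "(Neg \<phi>, \<sigma>) \<in> fms_over L X C \<longleftrightarrow> (\<phi>, \<sigma>) \<in> fms_over L X C"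
  by (simp add: fms_over_def)

lemma fms_overD: "(\<phi>, \<sigma>) \<in> fms_over L X C \<Longrightarrow> x \<in> fv \<phi> \<Longrightarrow> \<sigma> x \<in> X <+> C"
  by (auto simp: fms_over_def)

lemma fms_overI: "wf_fm L \<phi> \<Longrightarrow> (\<And>x. x \<in> fv \<phi> \<Longrightarrow> \<sigma> x \<in> X <+> C) \<Longrightarrow> (\<phi>, \<sigma>) \<in> fms_over L X C"
  by (auto simp: fms_over_def)

lemma fms_over_wf: "(\<phi>, \<sigma>) \<in> fms_over L X C \<Longrightarrow> wf_fm L \<phi>"
  by (auto simp: fms_over_def)

lemma fms_over_mono:
  "\<theta> \<in> fms_over L X C \<Longrightarrow> X \<subseteq> X' \<Longrightarrow> C \<subseteq> C' \<Longrightarrow> \<theta> \<in> fms_over L X' C'"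
  by (fastforce simp: fms_over_def)

text \<open>Bound variables are renamed together with the free ones, so an injective renaming cannot
  cause capture and no fresh names have to be chosen.\<close>

primrec rename_trm :: "(nat \<Rightarrow> nat) \<Rightarrow> 'f trm \<Rightarrow> 'f trm" where
  "rename_trm \<rho> (Var x) = Var (\<rho> x)"
| "rename_trm \<rho> (Fn f ts) = Fn f (map (rename_trm \<rho>) ts)"

primrec rename :: "(nat \<Rightarrow> nat) \<Rightarrow> ('f, 'r) fm \<Rightarrow> ('f, 'r) fm" where
  "rename \<rho> (Eq s t) = Eq (rename_trm \<rho> s) (rename_trm \<rho> t)"
| "rename \<rho> (Rl R ts) = Rl R (map (rename_trm \<rho>) ts)"
| "rename \<rho> (Neg \<phi>) = Neg (rename \<rho> \<phi>)"
| "rename \<rho> (Conj \<phi> \<psi>) = Conj (rename \<rho> \<phi>) (rename \<rho> \<psi>)"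
| "rename \<rho> (Ex x \<phi>) = Ex (\<rho> x) (rename \<rho> \<phi>)"

lemma eval_rename_trm: "eval M e (rename_trm \<rho> t) = eval M (\<lambda>x. e (\<rho> x)) t"
proof (induction t)
  case (Fn f ts)
  then have "map (eval M e \<circ> rename_trm \<rho>) ts = map (eval M (\<lambda>x. e (\<rho> x))) ts" by simp
  then show ?case by (metis eval.simps(2) map_map rename_trm.simps(2))
qed simp

lemma sat_rename: "inj \<rho> \<Longrightarrow> sat M e (rename \<rho> \<phi>) \<longleftrightarrow> sat M (\<lambda>x. e (\<rho> x)) \<phi>"
proof (induction \<phi> arbitrary: e)
  case (Rl R ts)
  have "map (eval M e \<circ> rename_trm \<rho>) ts = map (eval M (\<lambda>x. e (\<rho> x))) ts"
    by (simp add: eval_rename_trm)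
  then show ?case by (metis map_map rename.simps(2) sat.simps(2))
next
  case (Ex x \<phi>)
  have "(\<lambda>y. (e(\<rho> x := m)) (\<rho> y)) = (\<lambda>y. e (\<rho> y))(x := m)" for m
    using Ex.prems by (auto simp: fun_eq_iff inj_eq)
  then show ?case using Ex.IH[OF Ex.prems] by (simp del: fun_upd_apply)
qed (simp_all add: eval_rename_trm)

lemma fv_rename_trm: "fv_trm (rename_trm \<rho> t) = \<rho> ` fv_trm t"
  by (induction t) (auto simp: image_UN)

lemma fv_rename: "inj \<rho> \<Longrightarrow> fv (rename \<rho> \<phi>) = \<rho> ` fv \<phi>"
proof (induction \<phi>)
  case (Rl R ts)
  then show ?case by (auto simp: fv_rename_trm)
qed (simp_all add: fv_rename_trm image_Un image_set_diff)

lemma wf_rename_trm: "wf_trm L (rename_trm \<rho> t) \<longleftrightarrow> wf_trm L t"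
  by (induction t) auto

lemma wf_rename: "wf_fm L (rename \<rho> \<phi>) \<longleftrightarrow> wf_fm L \<phi>"
  by (induction \<phi>) (auto simp: wf_rename_trm)

section \<open>Definability of conjunctions and projections\<close>

text \<open>The two formulas may use the same variable for different things. Moving one to the even
  and the other to the odd variables lets a single substitution serve both.\<close>

lemma pfm_Conj:
  assumes "\<theta>1 \<in> fms_over L Z C" "\<theta>2 \<in> fms_over L Z C"
  shows "\<exists>\<theta>\<in>fms_over L Z C. \<forall>d. psat M d \<theta> \<longleftrightarrow> psat M d \<theta>1 \<and> psat M d \<theta>2"
proof -
  obtain \<phi>1 \<sigma>1 \<phi>2 \<sigma>2 where eq: "\<theta>1 = (\<phi>1, \<sigma>1)" "\<theta>2 = (\<phi>2, \<sigma>2)" by force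
  let ?r1 = "\<lambda>n::nat. 2 * n" and ?r2 = "\<lambda>n::nat. 2 * n + 1"
  have inj: "inj ?r1" "inj ?r2" by (auto intro!: injI)
  let ?\<phi> = "Conj (rename ?r1 \<phi>1) (rename ?r2 \<phi>2)"
  let ?\<sigma> = "\<lambda>n. if even n then \<sigma>1 (n div 2) else \<sigma>2 (n div 2)"
  have "(\<lambda>x. (case_sum d id \<circ> ?\<sigma>) (?r1 x)) = case_sum d id \<circ> \<sigma>1"
       "(\<lambda>x. (case_sum d id \<circ> ?\<sigma>) (?r2 x)) = case_sum d id \<circ> \<sigma>2" for d
    by (auto simp: fun_eq_iff)
  then have "psat M d (?\<phi>, ?\<sigma>) \<longleftrightarrow> psat M d \<theta>1 \<and> psat M d \<theta>2" for d
    unfolding eq psat_def prod.case sat.simps sat_rename[OF inj(1)] sat_rename[OF inj(2)] by metis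
  moreover have "(?\<phi>, ?\<sigma>) \<in> fms_over L Z C"
    using assms unfolding eq by (intro fms_overI) (auto simp: fv_rename[OF inj(1)] fv_rename[OF inj(2)[simplified]]
      wf_rename dest: fms_over_wf fms_overD)
  ultimately show ?thesis by blast
qed

lemma pfm_finite_Conj:
  assumes "finite \<Gamma>" "\<Gamma> \<subseteq> fms_over L Z C" "univ M \<noteq> {}"
  shows "\<exists>\<theta>\<in>fms_over L Z C. \<forall>d. psat M d \<theta> \<longleftrightarrow> (\<forall>\<gamma>\<in>\<Gamma>. psat M d \<gamma>)"
  using assms(1,2)
proof (induction \<Gamma>)
  case empty
  \<comment> \<open>The true formula has to be closed because \<open>Z\<close> and \<open>C\<close>
    may both be empty; it holds because the universe is nonempty.\<close>
  let ?\<phi> = "Ex 0 (Eq (Var 0) (Var 0))"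
  have "(?\<phi>, \<sigma>) \<in> fms_over L Z C" "psat M d (?\<phi>, \<sigma>)" for \<sigma> d
    using assms(3) by (auto simp: fms_over_def psat_def)
  then show ?case by blast
next
  case (insert \<gamma> \<Gamma>)
  then obtain \<theta> where \<theta>: "\<theta> \<in> fms_over L Z C" "\<forall>d. psat M d \<theta> \<longleftrightarrow> (\<forall>\<gamma>\<in>\<Gamma>. psat M d \<gamma>)"
    by auto
  from pfm_Conj[OF _ this(1), of \<gamma> M] insert.prems
  show ?case using \<theta>(2) by (metis insert_iff insert_subset)
qed

lemma equated_variables:
  "\<exists>\<epsilon>::('f, 'r) fm. (\<forall>L. wf_fm L \<epsilon>) \<and> fv \<epsilon> \<subseteq> insert v (set vs) \<and>
     (\<forall>e. sat M e \<epsilon> \<longleftrightarrow> (\<forall>w\<in>set vs. e w = e v))"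
proof (induction vs)
  case Nil
  show ?case by (rule exI[of _ "Eq (Var v) (Var v)"]) simp
next
  case (Cons w vs)
  then obtain \<epsilon> :: "('f, 'r) fm" where "\<forall>L. wf_fm L \<epsilon>" "fv \<epsilon> \<subseteq> insert v (set vs)"
    "\<forall>e. sat M e \<epsilon> \<longleftrightarrow> (\<forall>w\<in>set vs. e w = e v)" by blast
  then show ?case by (intro exI[of _ "Conj (Eq (Var w) (Var v)) \<epsilon>"]) auto
qed

lemma sat_foldr_Ex:
  "sat M e (foldr Ex vs \<phi>) \<longleftrightarrow>
     (\<exists>e'. (\<forall>x\<in>set vs. e' x \<in> univ M) \<and> (\<forall>x. x \<notin> set vs \<longrightarrow> e' x = e x) \<and> sat M e' \<phi>)"
proof (induction vs arbitrary: e)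
  case Nil
  then show ?case by (auto simp: fun_eq_iff[symmetric])
next
  case (Cons v vs)
  show ?case (is "?l \<longleftrightarrow> ?r")
  proof
    assume ?l
    then show ?r by (auto simp: Cons.IH) (metis fun_upd_apply)
  next
    assume ?r
    then obtain e' where e': "\<forall>x\<in>set (v # vs). e' x \<in> univ M" "\<forall>x. x \<notin> set (v # vs) \<longrightarrow> e' x = e x"
      "sat M e' \<phi>" by blast
    then have "\<forall>x. x \<notin> set vs \<longrightarrow> e' x = (e(v := e' v)) x" by auto
    with e' show ?l by (auto simp: Cons.IH simp del: fun_upd_apply intro!: bexI[of _ "e' v"] exI[of _ e'])
  qed
qed

lemma fv_foldr_Ex: "fv (foldr Ex vs \<phi>) = fv \<phi> - set vs"
  by (induction vs) auto

lemma wf_foldr_Ex: "wf_fm L (foldr Ex vs \<phi>) \<longleftrightarrow> wf_fm L \<phi>"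
  by (induction vs) auto

text \<open>Several variables of the formula may stand for the same \<open>y\<close>; instead of substituting, they
  are all quantified and required to be equal.\<close>

lemma pfm_Ex:
  assumes "\<theta> \<in> fms_over L Z C" "univ M \<noteq> {}"
  shows "\<exists>\<theta>'\<in>fms_over L (Z - {y}) C. \<forall>d. psat M d \<theta>' \<longleftrightarrow> (\<exists>m\<in>univ M. psat M (d(y := m)) \<theta>)"
proof -
  obtain \<phi> \<sigma> where eq: "\<theta> = (\<phi>, \<sigma>)" by force
  obtain vs where vs: "set vs = {x \<in> fv \<phi>. \<sigma> x = Inl y}"
    using finite_list[of "{x \<in> fv \<phi>. \<sigma> x = Inl y}"] finite_fv[of \<phi>] by auto
  show ?thesis
  proof (cases vs)
    case Nil
    then have no: "x \<in> fv \<phi> \<Longrightarrow> \<sigma> x \<noteq> Inl y" for x using vs by auto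
    have "psat M (d(y := m)) \<theta> \<longleftrightarrow> psat M d \<theta>" for d m
      unfolding eq by (rule psat_cong) (use no in \<open>auto split: sum.splits\<close>)
    moreover have "\<theta> \<in> fms_over L (Z - {y}) C"
      using assms(1) no unfolding eq by (fastforce simp: fms_over_def)
    ultimately show ?thesis using assms(2) by blast
  next
    case (Cons v ws)
    then have v: "v \<in> fv \<phi>" "\<sigma> v = Inl y" using vs by auto
    obtain \<epsilon> :: "('a, 'b) fm" where \<epsilon>: "\<forall>L. wf_fm L \<epsilon>" "fv \<epsilon> \<subseteq> insert v (set vs)"
      "\<forall>e. sat M e \<epsilon> \<longleftrightarrow> (\<forall>w\<in>set vs. e w = e v)" using equated_variables by blast
    let ?\<phi> = "foldr Ex vs (Conj \<epsilon> \<phi>)"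
    have vin: "v \<in> set vs" using Cons by simp
    have "(?\<phi>, \<sigma>) \<in> fms_over L (Z - {y}) C"
    proof (rule fms_overI)
      show "wf_fm L ?\<phi>" using assms(1) \<epsilon>(1) unfolding eq
        by (auto simp: wf_foldr_Ex dest: fms_over_wf)
      fix x assume "x \<in> fv ?\<phi>"
      then have "x \<in> fv \<phi>" "x \<notin> set vs" using \<epsilon>(2) vin by (auto simp: fv_foldr_Ex)
      then show "\<sigma> x \<in> (Z - {y}) <+> C" using assms(1) vs unfolding eq by (auto dest: fms_overD)
    qed
    moreover have "psat M d (?\<phi>, \<sigma>) \<longleftrightarrow> (\<exists>m\<in>univ M. psat M (d(y := m)) \<theta>)" for d
    proof
      assume "psat M d (?\<phi>, \<sigma>)"
      then obtain e' where e': "\<forall>x\<in>set vs. e' x \<in> univ M"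
        "\<forall>x. x \<notin> set vs \<longrightarrow> e' x = case_sum d id (\<sigma> x)" "\<forall>w\<in>set vs. e' w = e' v" "sat M e' \<phi>"
        by (auto simp: psat_def sat_foldr_Ex \<epsilon>(3))
      have "sat M e' \<phi> \<longleftrightarrow> sat M (case_sum (d(y := e' v)) id \<circ> \<sigma>) \<phi>"
      proof (rule sat_cong)
        fix x assume x: "x \<in> fv \<phi>"
        show "e' x = (case_sum (d(y := e' v)) id \<circ> \<sigma>) x"
        proof (cases "x \<in> set vs")
          case True then show ?thesis using e'(3) vs by auto
        next
          case False then show ?thesis using e'(2) vs x by (auto split: sum.splits)
        qed
      qed
      then have "psat M (d(y := e' v)) \<theta>" using e'(4) by (simp add: eq psat_def)
      then show "\<exists>m\<in>univ M. psat M (d(y := m)) \<theta>" using e'(1) vin by blast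
    next
      assume "\<exists>m\<in>univ M. psat M (d(y := m)) \<theta>"
      then obtain m where m: "m \<in> univ M" "psat M (d(y := m)) \<theta>" by blast
      let ?e = "\<lambda>x. if x \<in> set vs then m else case_sum d id (\<sigma> x)"
      have "sat M ?e \<phi> \<longleftrightarrow> sat M (case_sum (d(y := m)) id \<circ> \<sigma>) \<phi>"
        by (rule sat_cong) (use vs in \<open>auto split: sum.splits\<close>)
      then have "sat M ?e \<phi>" using m by (simp add: eq psat_def)
      then show "psat M d (?\<phi>, \<sigma>)"
        using m(1) vin unfolding psat_def prod.case sat_foldr_Ex
        by (intro exI[of _ ?e]) (auto simp: \<epsilon>(3))
    qed
    ultimately show ?thesis by blast
  qed
qed

lemma pfm_finite_Ex:
  assumes "finite Y" "\<theta> \<in> fms_over L Z C" "univ M \<noteq> {}"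
  shows "\<exists>\<theta>'\<in>fms_over L (Z - Y) C. \<forall>d. psat M d \<theta>' \<longleftrightarrow>
    (\<exists>d'. d' ` Y \<subseteq> univ M \<and> (\<forall>y. y \<notin> Y \<longrightarrow> d' y = d y) \<and> psat M d' \<theta>)"
  using assms(1)
proof (induction Y)
  case empty
  then show ?case using assms(2) by (auto simp: fun_eq_iff[symmetric])
next
  case (insert y Y)
  then obtain \<theta>1 where \<theta>1: "\<theta>1 \<in> fms_over L (Z - Y) C" "\<And>d. psat M d \<theta>1 \<longleftrightarrow>
    (\<exists>d'. d' ` Y \<subseteq> univ M \<and> (\<forall>y. y \<notin> Y \<longrightarrow> d' y = d y) \<and> psat M d' \<theta>)" by blast
  obtain \<theta>2 where \<theta>2: "\<theta>2 \<in> fms_over L (Z - Y - {y}) C"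
    "\<And>d. psat M d \<theta>2 \<longleftrightarrow> (\<exists>m\<in>univ M. psat M (d(y := m)) \<theta>1)"
    using pfm_Ex[OF \<theta>1(1) assms(3)] by blast
  have "psat M d \<theta>2 \<longleftrightarrow>
     (\<exists>d'. d' ` insert y Y \<subseteq> univ M \<and> (\<forall>z. z \<notin> insert y Y \<longrightarrow> d' z = d z) \<and> psat M d' \<theta>)" for d
  proof
    assume "psat M d \<theta>2"
    then obtain m d' where "m \<in> univ M" "d' ` Y \<subseteq> univ M" "\<forall>z. z \<notin> Y \<longrightarrow> d' z = (d(y := m)) z"
      "psat M d' \<theta>" using \<theta>1(2) \<theta>2(2) by metis
    then show "\<exists>d'. d' ` insert y Y \<subseteq> univ M \<and> (\<forall>z. z \<notin> insert y Y \<longrightarrow> d' z = d z) \<and> psat M d' \<theta>"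
      using insert.hyps(2) by (intro exI[of _ d']) auto
  next
    assume "\<exists>d'. d' ` insert y Y \<subseteq> univ M \<and> (\<forall>z. z \<notin> insert y Y \<longrightarrow> d' z = d z) \<and> psat M d' \<theta>"
    then obtain d' where d': "d' ` insert y Y \<subseteq> univ M" "\<forall>z. z \<notin> insert y Y \<longrightarrow> d' z = d z"
      "psat M d' \<theta>" by blast
    then have "psat M (d(y := d' y)) \<theta>1" by (auto simp: \<theta>1(2) intro!: exI[of _ d'])
    then show "psat M d \<theta>2" using d'(1) \<theta>2(2) by auto
  qed
  moreover have "Z - Y - {y} = Z - insert y Y" by auto
  ultimately show ?case using \<theta>2(1) by metis
qed

section \<open>Small cardinals\<close>

lemma card_of_lists_le:
  assumes "infinite B" "|A| \<le>o |B|"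
  shows "|lists A| \<le>o |B|"
proof -
  have len: "|{xs \<in> lists A. length xs = n}| \<le>o |B|" for n
  proof (induction n)
    case 0
    have eq: "{xs \<in> lists A. length xs = 0} = {[]}" by auto
    have "B \<noteq> {}" using assms(1) by auto
    then show ?case unfolding eq by (rule card_of_singl_ordLeq)
  next
    case (Suc n)
    have "{xs \<in> lists A. length xs = Suc n} \<subseteq>
        (\<lambda>(x, xs). x # xs) ` (A \<times> {xs \<in> lists A. length xs = n})"
      by (auto simp: length_Suc_conv)
    then have "|{xs \<in> lists A. length xs = Suc n}| \<le>o |A \<times> {xs \<in> lists A. length xs = n}|"
      by (rule ordLeq_transitive[OF card_of_mono1 card_of_image])
    moreover have "|A \<times> {xs \<in> lists A. length xs = n}| \<le>o |B|"
      using assms Suc by (intro card_of_Sigma_ordLeq_infinite) auto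
    ultimately show ?case using ordLeq_transitive by blast
  qed
  have "lists A = (\<Union>n. {xs \<in> lists A. length xs = n})" by auto
  moreover have "|\<Union>n. {xs \<in> lists A. length xs = n}| \<le>o |B|"
    using assms(1) len infinite_iff_card_of_nat
    by (intro card_of_UNION_ordLeq_infinite) auto
  ultimately show ?thesis by simp
qed

lemma finite_le_nat: "finite A \<Longrightarrow> |A| \<le>o |UNIV :: nat set|"
  using finite_ordLess_infinite[OF card_of_Well_order card_of_Well_order, of A "UNIV :: nat set"]
  by (simp add: Field_card_of ordLess_imp_ordLeq)

locale small_cardinal =
  fixes \<mu> :: "'k rel"
  assumes Card_\<mu>: "Card_order \<mu>" and uncountable: "natLeq <o \<mu>"
begin

lemma infinite_\<mu>: "infinite (Field \<mu>)"
proof -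
  have "natLeq \<le>o |Field \<mu>|"
    using uncountable card_of_Field_ordIso[OF Card_\<mu>] ordIso_symmetric ordLess_imp_ordLeq
      ordLeq_ordIso_trans by blast
  then show ?thesis using infinite_iff_natLeq_ordLeq by blast
qed

lemma small_nat: "|UNIV :: nat set| <o \<mu>"
  using uncountable card_of_nat ordIso_ordLess_trans by blast

lemma small_le: "|A| \<le>o |B| \<Longrightarrow> |B| <o \<mu> \<Longrightarrow> |A| <o \<mu>"
  by (rule ordLeq_ordLess_trans)

lemma small_subset: "A \<subseteq> B \<Longrightarrow> |B| <o \<mu> \<Longrightarrow> |A| <o \<mu>"
  using small_le card_of_mono1 by blast

lemma small_image: "|A| <o \<mu> \<Longrightarrow> |f ` A| <o \<mu>"
  using small_le card_of_image by blast

lemma small_Un: "|A| <o \<mu> \<Longrightarrow> |B| <o \<mu> \<Longrightarrow> |A \<union> B| <o \<mu>"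
  using card_of_Un_ordLess_infinite_Field[OF infinite_\<mu> Card_\<mu>] by blast

lemma small_Plus: "|A| <o \<mu> \<Longrightarrow> |B| <o \<mu> \<Longrightarrow> |A <+> B| <o \<mu>"
  using card_of_Plus_ordLess_infinite_Field[OF infinite_\<mu> Card_\<mu>] by blast

lemma small_countable: "|A| \<le>o |UNIV :: nat set| \<Longrightarrow> |A| <o \<mu>"
  using small_nat small_le by blast

lemma small_finite: "finite A \<Longrightarrow> |A| <o \<mu>"
  by (intro small_countable finite_le_nat)

text \<open>The absorption laws of cardinal arithmetic need an infinite bound, while a small set may
  be finite. Adding the natural numbers keeps it small since \<open>\<mu>\<close> is
  uncountable.\<close>

lemma infinite_small_bound:
  fixes A :: "'a set"
  assumes "|A| <o \<mu>"
  obtains B :: "(nat + 'a) set" where "infinite B" "|A| \<le>o |B|" "|UNIV :: nat set| \<le>o |B|" "|B| <o \<mu>"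
proof
  show "infinite ((UNIV :: nat set) <+> A)" by (simp add: finite_Plus_iff)
  show "|A| \<le>o |(UNIV :: nat set) <+> A|" by (rule card_of_Plus2)
  show "|UNIV :: nat set| \<le>o |(UNIV :: nat set) <+> A|" by (rule card_of_Plus1)
  show "|(UNIV :: nat set) <+> A| <o \<mu>" using small_Plus small_nat assms by blast
qed

lemma small_lists:
  fixes A :: "'a set"
  assumes "|A| <o \<mu>"
  shows "|lists A| <o \<mu>"
proof -
  obtain B :: "(nat + 'a) set" where "infinite B" "|A| \<le>o |B|" "|B| <o \<mu>"
    using infinite_small_bound[OF assms] by metis
  then show ?thesis using card_of_lists_le small_le by blast
qed

lemma small_Times:
  fixes A :: "'a set" and B :: "'b set"
  assumes "|A| <o \<mu>" "|B| <o \<mu>"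
  shows "|A \<times> B| <o \<mu>"
proof -
  obtain D :: "(nat + ('a + 'b)) set" where D: "infinite D" "|A <+> B| \<le>o |D|" "|D| <o \<mu>"
    using infinite_small_bound[OF small_Plus[OF assms]] by metis
  have "|A| \<le>o |D|" "|B| \<le>o |D|"
    using D(2) card_of_Plus1 card_of_Plus2 ordLeq_transitive by blast+
  then have "|A \<times> B| \<le>o |D|" using D(1) by (intro card_of_Sigma_ordLeq_infinite) auto
  then show ?thesis using D(3) small_le by blast
qed

text \<open>Regularity of \<open>\<mu>\<close> is not assumed, so a small union of small sets may
  fail to be small. A common countable bound on the pieces avoids this.\<close>

lemma small_UN_countable:
  fixes K :: "'a set"
  assumes "|K| <o \<mu>" "\<And>k. k \<in> K \<Longrightarrow> |F k| \<le>o |UNIV :: nat set|"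
  shows "|\<Union>k\<in>K. F k| <o \<mu>"
proof -
  obtain B :: "(nat + 'a) set" where B: "infinite B" "|K| \<le>o |B|" "|UNIV :: nat set| \<le>o |B|" "|B| <o \<mu>"
    using infinite_small_bound[OF assms(1)] by metis
  have "|\<Union>k\<in>K. F k| \<le>o |B|"
    using B assms(2) ordLeq_transitive by (intro card_of_UNION_ordLeq_infinite) blast+
  then show ?thesis using B(4) small_le by blast
qed

end

section \<open>Monster models\<close>

lemma eval_in_univ:
  assumes "is_struct L M" "wf_trm L t" "e ` fv_trm t \<subseteq> univ M"
  shows "eval M e t \<in> univ M"
  using assms(2,3)
proof (induction t)
  case (Fn f ts)
  then have "set (map (eval M e) ts) \<subseteq> univ M" by fastforce
  moreover have "(f, length (map (eval M e) ts)) \<in> funs L" using Fn.prems by simp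
  ultimately have "fn M f (map (eval M e) ts) \<in> univ M"
    using assms(1) unfolding is_struct_def by blast
  then show ?case by (metis eval.simps(2))
qed simp

lemma eval_automorphism:
  assumes "is_struct L M" "automorphism L M g" "wf_trm L t" "e ` fv_trm t \<subseteq> univ M"
  shows "eval M (\<lambda>x. g (e x)) t = g (eval M e t)"
  using assms(3,4)
proof (induction t)
  case (Fn f ts)
  have ts: "set (map (eval M e) ts) \<subseteq> univ M"
    using Fn.prems eval_in_univ[OF assms(1)] by fastforce
  have "map (eval M (\<lambda>x. g (e x))) ts = map g (map (eval M e) ts)"
    using Fn by fastforce
  moreover have "(f, length (map (eval M e) ts)) \<in> funs L" using Fn.prems by simp
  then have "g (fn M f (map (eval M e) ts)) = fn M f (map g (map (eval M e) ts))"
    using assms(2) ts unfolding automorphism_def by blast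
  ultimately show ?case by (metis eval.simps(2))
qed simp

lemma sat_automorphism:
  assumes "is_struct L M" "automorphism L M g" "wf_fm L \<phi>" "e ` fv \<phi> \<subseteq> univ M"
  shows "sat M (\<lambda>x. g (e x)) \<phi> \<longleftrightarrow> sat M e \<phi>"
  using assms(3,4)
proof (induction \<phi> arbitrary: e)
  case (Eq s t)
  then have "e ` fv_trm s \<subseteq> univ M" "e ` fv_trm t \<subseteq> univ M" "wf_trm L s" "wf_trm L t" by auto
  moreover have "inj_on g (univ M)"
    using assms(2) by (auto simp: automorphism_def bij_betw_def)
  ultimately show ?case
    using assms(1) by (simp add: eval_automorphism[OF assms(1,2)] eval_in_univ inj_on_eq_iff)
next
  case (Rl R ts)
  have ts: "set (map (eval M e) ts) \<subseteq> univ M"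
    using Rl.prems eval_in_univ[OF assms(1)] by fastforce
  have "map (eval M (\<lambda>x. g (e x))) ts = map g (map (eval M e) ts)"
    using Rl eval_automorphism[OF assms(1,2)] by fastforce
  moreover have "(R, length (map (eval M e) ts)) \<in> rels L" using Rl.prems by simp
  then have "rl M R (map (eval M e) ts) \<longleftrightarrow> rl M R (map g (map (eval M e) ts))"
    using assms(2) ts unfolding automorphism_def by blast
  ultimately show ?case by (metis sat.simps(2))
next
  case (Conj \<phi> \<psi>)
  then show ?case by (simp add: image_Un)
next
  case (Ex x \<phi>)
  have IH: "sat M (\<lambda>y. g ((e(x := m)) y)) \<phi> \<longleftrightarrow> sat M (e(x := m)) \<phi>" if "m \<in> univ M" for m
    using Ex that by (intro Ex.IH) auto
  have upd: "(\<lambda>y. g ((e(x := m)) y)) = (\<lambda>y. g (e y))(x := g m)" for m by auto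
  have surj: "g ` univ M = univ M" using assms(2) by (auto simp: automorphism_def bij_betw_def)
  have "sat M (\<lambda>y. g (e y)) (Ex x \<phi>) \<longleftrightarrow> (\<exists>m\<in>g ` univ M. sat M ((\<lambda>y. g (e y))(x := m)) \<phi>)"
    using surj by simp
  also have "\<dots> \<longleftrightarrow> (\<exists>m\<in>univ M. sat M (e(x := m)) \<phi>)"
    using IH unfolding upd by blast
  finally show ?case by simp
qed simp

lemma saturatedD:
  "saturated L M \<mu> \<Longrightarrow> A \<subseteq> univ M \<Longrightarrow> |A| <o \<mu> \<Longrightarrow> partial_type L M UNIV A \<pi> \<Longrightarrow>
     \<exists>d. realizes M (UNIV :: unit set) d \<pi>"
  unfolding saturated_def by blast

locale monster =
  fixes L :: "('f, 'r) lang" and T :: "('f, 'r) fm set" and U :: "('f, 'r, 'm) struct"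
    and \<mu> :: "'k rel"
  assumes monster: "monster_model L T U \<mu>"
begin

sublocale small_cardinal \<mu>
  using monster by unfold_locales (auto simp: monster_model_def)

lemma struct: "is_struct L U"
  using monster by (auto simp: monster_model_def is_model_def)

lemma nonempty: "univ U \<noteq> {}"
  using struct by (auto simp: is_struct_def)

lemma psat_automorphism:
  assumes "automorphism L U g" "(\<phi>, \<sigma>) \<in> fms_over L X C" "C \<subseteq> univ U" "d ` X \<subseteq> univ U"
  shows "psat U (\<lambda>x. g (d x)) (\<phi>, \<lambda>x. map_sum id g (\<sigma> x)) \<longleftrightarrow> psat U d (\<phi>, \<sigma>)"
proof -
  have "case_sum d id (\<sigma> x) \<in> univ U" if "x \<in> fv \<phi>" for x
    using fms_overD[OF assms(2) that] assms(3,4) by auto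
  then have "sat U (\<lambda>x. g (case_sum d id (\<sigma> x))) \<phi> \<longleftrightarrow> sat U (\<lambda>x. case_sum d id (\<sigma> x)) \<phi>"
    using fms_over_wf[OF assms(2)] by (intro sat_automorphism[OF struct assms(1)]) auto
  moreover have "sat U (\<lambda>x. g (case_sum d id (\<sigma> x))) \<phi> \<longleftrightarrow>
      psat U (\<lambda>x. g (d x)) (\<phi>, \<lambda>x. map_sum id g (\<sigma> x))"
    unfolding psat_def prod.case by (rule sat_cong) (auto split: sum.splits)
  ultimately show ?thesis by (simp add: psat_def comp_def)
qed

text \<open>Sending \<open>u z\<close> to \<open>w z\<close> and fixing \<open>A\<close> is a
  partial elementary map, which strong homogeneity extends. The implication between the types is
  enough because negations turn it into an equivalence.\<close>

lemma same_type_automorphism: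
  fixes u w :: "'z \<Rightarrow> 'm"
  assumes A: "A \<subseteq> univ U" "|A| <o \<mu>" and Z: "|Z| <o \<mu>"
    and uw: "u ` Z \<subseteq> univ U" "w ` Z \<subseteq> univ U"
    and same: "\<And>\<theta>. \<theta> \<in> fms_over L Z A \<Longrightarrow> psat U u \<theta> \<Longrightarrow> psat U w \<theta>"
  obtains g where "automorphism L U g" "\<And>x. x \<in> A \<Longrightarrow> g x = x" "\<And>z. z \<in> Z \<Longrightarrow> g (u z) = w z"
proof -
  have iff: "psat U u (\<phi>, \<sigma>) \<longleftrightarrow> psat U w (\<phi>, \<sigma>)" if "(\<phi>, \<sigma>) \<in> fms_over L Z A" for \<phi> \<sigma>
    using same[of "(\<phi>, \<sigma>)"] same[of "(Neg \<phi>, \<sigma>)"] that by (auto simp: psat_Neg fms_over_Neg)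
  define \<sigma>0 where "\<sigma>0 x = (SOME s. s \<in> Z <+> A \<and> case_sum u id s = x)" for x
  have \<sigma>0: "\<sigma>0 x \<in> Z <+> A \<and> case_sum u id (\<sigma>0 x) = x" if "x \<in> u ` Z \<union> A" for x
    unfolding \<sigma>0_def by (rule someI_ex) (use that in \<open>force intro: exI[of _ "Inl _"] exI[of _ "Inr _"]\<close>)
  define h where "h x = case_sum w id (\<sigma>0 x)" for x
  have h: "h (case_sum u id s) = case_sum w id s" if "s \<in> Z <+> A" for s
  proof -
    let ?x = "case_sum u id s"
    have x: "?x \<in> u ` Z \<union> A" using that by auto
    \<comment> \<open>An element can have several names, as a value of \<open>u\<close> or as a
      parameter. The equality of two names belongs to the type of \<open>u\<close>, so
      \<open>w\<close> interprets both alike and the choice in \<open>\<sigma>0\<close> does not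
      matter.\<close>
    let ?\<sigma> = "\<lambda>n::nat. if n = 0 then \<sigma>0 ?x else s"
    have "(Eq (Var 0) (Var 1), ?\<sigma>) \<in> fms_over L Z A"
      using that \<sigma>0[OF x] by (auto simp: fms_over_def)
    from iff[OF this] show ?thesis using \<sigma>0[OF x] by (simp add: psat_def h_def)
  qed
  have "partial_elementary L U (u ` Z \<union> A) h"
    unfolding partial_elementary_def
  proof (intro conjI allI impI)
    show "u ` Z \<union> A \<subseteq> univ U" using A uw by auto
    show "h ` (u ` Z \<union> A) \<subseteq> univ U"
    proof
      fix y assume "y \<in> h ` (u ` Z \<union> A)"
      then obtain x where "x \<in> u ` Z \<union> A" "y = h x" by blast
      then show "y \<in> univ U" using \<sigma>0[of x] A uw unfolding h_def by auto
    qed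
    fix \<phi> e assume *: "wf_fm L \<phi> \<and> e ` fv \<phi> \<subseteq> u ` Z \<union> A"
    then have e: "x \<in> fv \<phi> \<Longrightarrow> e x \<in> u ` Z \<union> A" for x by auto
    have "sat U e \<phi> \<longleftrightarrow> psat U u (\<phi>, \<lambda>x. \<sigma>0 (e x))"
      unfolding psat_def prod.case by (rule sat_cong) (use \<sigma>0[OF e] in auto)
    also have "\<dots> \<longleftrightarrow> psat U w (\<phi>, \<lambda>x. \<sigma>0 (e x))"
      by (rule iff, rule fms_overI) (use * \<sigma>0[OF e] in auto)
    also have "\<dots> \<longleftrightarrow> sat U (h \<circ> e) \<phi>"
      by (simp add: psat_def h_def comp_def)
    finally show "sat U e \<phi> \<longleftrightarrow> sat U (h \<circ> e) \<phi>" .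
  qed
  moreover have "|u ` Z \<union> A| <o \<mu>" using small_Un small_image Z A by blast
  moreover have "strongly_homogeneous L U \<mu>" using monster by (simp add: monster_model_def)
  ultimately have "\<exists>g. automorphism L U g \<and> (\<forall>x\<in>u ` Z \<union> A. g x = h x)"
    unfolding strongly_homogeneous_def by simp
  then obtain g where g: "automorphism L U g" "\<And>x. x \<in> u ` Z \<union> A \<Longrightarrow> g x = h x"
    by blast
  show thesis
  proof
    show "automorphism L U g" by fact
    show "g x = x" if "x \<in> A" for x using g(2)[of x] h[of "Inr x"] that by auto
    show "g (u z) = w z" if "z \<in> Z" for z using g(2)[of "u z"] h[of "Inl z"] that by auto
  qed
qed

text \<open>Saturation is assumed for types in one variable only. The condition on the value at
  \<open>z\<close> becomes such a formula: the values \<open>p\<close> are plugged in as parameters,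
  and the finitely many other variables that occur are quantified away.\<close>

lemma pfm_projection:
  fixes z :: 'z
  assumes "finite \<Gamma>" "\<Gamma> \<subseteq> fms_over L Z B" "z \<notin> D" "z \<in> Z"
    and ne: "p ` D \<subseteq> univ U"
  shows "\<exists>\<theta>\<in>fms_over L (UNIV :: unit set) (B \<union> p ` D). \<forall>m\<in>univ U. psat U (\<lambda>_. m) \<theta> \<longleftrightarrow>
     (\<exists>d. realizes U Z d \<Gamma> \<and> (\<forall>y\<in>D. d y = p y) \<and> d z = m)"
proof -
  obtain \<theta>1 where "\<theta>1 \<in> fms_over L Z B" "\<forall>d. psat U d \<theta>1 \<longleftrightarrow> (\<forall>\<gamma>\<in>\<Gamma>. psat U d \<gamma>)"
    using pfm_finite_Conj[OF assms(1,2) nonempty] by blast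
  moreover obtain \<phi> \<sigma> where "\<theta>1 = (\<phi>, \<sigma>)" by force
  ultimately have \<theta>1: "(\<phi>, \<sigma>) \<in> fms_over L Z B" "\<And>d. psat U d (\<phi>, \<sigma>) \<longleftrightarrow> (\<forall>\<gamma>\<in>\<Gamma>. psat U d \<gamma>)"
    by auto
  define plug where "plug s = (case s of Inl y \<Rightarrow> if y \<in> D then Inr (p y) else Inl y | Inr c \<Rightarrow> Inr c)" for s
  define Y where "Y = {y. Inl y \<in> \<sigma> ` fv \<phi>} - D - {z}"
  have "{y. Inl y \<in> \<sigma> ` fv \<phi>} = Inl -` (\<sigma> ` fv \<phi>)" by auto
  then have Y: "finite Y" "Y \<subseteq> Z" "Y \<inter> D = {}" "z \<notin> Y"
    using finite_vimageI[OF finite_imageI[OF finite_fv[of \<phi>]], of Inl \<sigma>] \<theta>1(1)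
    unfolding Y_def fms_over_def by auto
  have "(\<phi>, \<lambda>x. plug (\<sigma> x)) \<in> fms_over L (insert z Y) (B \<union> p ` D)"
  proof (rule fms_overI)
    fix x assume x: "x \<in> fv \<phi>"
    show "plug (\<sigma> x) \<in> insert z Y <+> (B \<union> p ` D)"
    proof (cases "\<sigma> x")
      case (Inl y)
      then show ?thesis using imageI[OF x, of \<sigma>] by (auto simp: plug_def Y_def)
    next
      case (Inr c)
      then show ?thesis using fms_overD[OF \<theta>1(1) x] by (auto simp: plug_def)
    qed
  qed (rule fms_over_wf[OF \<theta>1(1)])
  from pfm_finite_Ex[OF Y(1) this nonempty] obtain \<theta>2
    where \<theta>2: "\<theta>2 \<in> fms_over L (insert z Y - Y) (B \<union> p ` D)" "\<And>d. psat U d \<theta>2 \<longleftrightarrow>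
      (\<exists>d'. d' ` Y \<subseteq> univ U \<and> (\<forall>y. y \<notin> Y \<longrightarrow> d' y = d y) \<and> psat U d' (\<phi>, \<lambda>x. plug (\<sigma> x)))"
    by blast
  obtain \<phi>2 \<sigma>2 where eq: "\<theta>2 = (\<phi>2, \<sigma>2)" by force
  let ?\<theta> = "(\<phi>2, \<lambda>x. map_sum (\<lambda>_. ()) id (\<sigma>2 x))"
  have plugged: "psat U d' (\<phi>, \<lambda>x. plug (\<sigma> x)) \<longleftrightarrow> psat U (\<lambda>y. if y \<in> D then p y else d' y) (\<phi>, \<sigma>)" for d'
    by (rule psat_cong) (auto simp: plug_def split: sum.splits)
  have "?\<theta> \<in> fms_over L UNIV (B \<union> p ` D)"
    using \<theta>2(1) unfolding eq by (fastforce simp: fms_over_def)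
  moreover have "psat U (\<lambda>_. m) ?\<theta> \<longleftrightarrow>
     (\<exists>d. realizes U Z d \<Gamma> \<and> (\<forall>y\<in>D. d y = p y) \<and> d z = m)" if m: "m \<in> univ U" for m
  proof -
    have "psat U (\<lambda>_. m) ?\<theta> \<longleftrightarrow> psat U (\<lambda>_. m) \<theta>2"
      unfolding eq by (rule psat_cong) (auto split: sum.splits)
    also have "\<dots> \<longleftrightarrow> (\<exists>d. realizes U Z d \<Gamma> \<and> (\<forall>y\<in>D. d y = p y) \<and> d z = m)"
    proof
      assume "psat U (\<lambda>_. m) \<theta>2"
      then obtain d' where d': "d' ` Y \<subseteq> univ U" "\<forall>y. y \<notin> Y \<longrightarrow> d' y = m"
        "psat U (\<lambda>y. if y \<in> D then p y else d' y) (\<phi>, \<sigma>)" unfolding \<theta>2(2) plugged by auto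
      \<comment> \<open>Outside \<open>Y\<close> the assignment \<open>d'\<close> has the value
        \<open>m\<close>; this gives \<open>z\<close> its value and keeps all unmentioned variables
        inside the universe.\<close>
      let ?d = "\<lambda>y. if y \<in> D then p y else d' y"
      have "realizes U Z ?d \<Gamma>" unfolding realizes_def
        using d' ne m \<theta>1(2) by (auto 0 3)
      then show "\<exists>d. realizes U Z d \<Gamma> \<and> (\<forall>y\<in>D. d y = p y) \<and> d z = m"
        using d'(2) Y(4) assms(3) by (intro exI[of _ ?d]) auto
    next
      assume "\<exists>d. realizes U Z d \<Gamma> \<and> (\<forall>y\<in>D. d y = p y) \<and> d z = m"
      then obtain d where d: "realizes U Z d \<Gamma>" "\<And>y. y \<in> D \<Longrightarrow> d y = p y" "d z = m" by blast
      let ?d = "\<lambda>y. if y \<in> Y then d y else m"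
      have "psat U (\<lambda>y. if y \<in> D then p y else ?d y) (\<phi>, \<sigma>) \<longleftrightarrow> psat U d (\<phi>, \<sigma>)"
        by (rule psat_cong) (use d in \<open>auto simp: Y_def split: sum.splits dest: image_eqI[OF sym]\<close>)
      then have "psat U ?d (\<phi>, \<lambda>x. plug (\<sigma> x))"
        unfolding plugged using d(1) \<theta>1(2) by (auto simp: realizes_def)
      moreover have "?d ` Y \<subseteq> univ U" using d(1) Y(2) by (auto simp: realizes_def)
      ultimately show "psat U (\<lambda>_. m) \<theta>2" unfolding \<theta>2(2)
        by (intro exI[of _ ?d]) auto
    qed
    finally show ?thesis .
  qed
  ultimately show ?thesis by blast
qed

text \<open>A maximal partial assignment that is compatible with every finite part of the type is total,
  since it can otherwise be extended by realizing a type in one variable.\<close>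

theorem realize_small_type:
  fixes \<Gamma> :: "('f, 'r, 'z, 'm) pfm set"
  assumes \<Gamma>: "partial_type L U Z B \<Gamma>" and B: "B \<subseteq> univ U" "|B| <o \<mu>" and Z: "|Z| <o \<mu>"
  shows "\<exists>d. realizes U Z d \<Gamma>"
proof -
  define good where "good G \<longleftrightarrow> G \<subseteq> Z \<times> univ U \<and>
    (\<forall>\<Gamma>0. finite \<Gamma>0 \<and> \<Gamma>0 \<subseteq> \<Gamma> \<longrightarrow> (\<exists>d. realizes U Z d \<Gamma>0 \<and> (\<forall>(z, m)\<in>G. d z = m)))" for G
  have goodD: "\<exists>d. realizes U Z d \<Gamma>0 \<and> (\<forall>(z, m)\<in>G. d z = m)"
    if "good G" "finite \<Gamma>0" "\<Gamma>0 \<subseteq> \<Gamma>" for G \<Gamma>0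
    using that unfolding good_def by simp
  have over: "\<Gamma> \<subseteq> fms_over L Z B" using \<Gamma> by (simp add: partial_type_def)
  have "good {}" using \<Gamma> by (auto simp: good_def partial_type_def)
  moreover have "good (\<Union>\<C>)" if ne: "\<C> \<noteq> {}" and chain: "subset.chain {G. good G} \<C>" for \<C>
    unfolding good_def
  proof (intro conjI allI impI)
    have gd: "good G" if "G \<in> \<C>" for G using chain that by (auto simp: subset.chain_def)
    then show sub: "\<Union>\<C> \<subseteq> Z \<times> univ U" by (auto simp: good_def)
    fix \<Gamma>0 assume \<Gamma>0: "finite \<Gamma>0 \<and> \<Gamma>0 \<subseteq> \<Gamma>"
    \<comment> \<open>Already for the empty part of the type, goodness provides an assignment
      extending \<open>G\<close>; hence a good \<open>G\<close> is the graph of a function.\<close>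
    have functional: "m = m'" if zm: "(z, m) \<in> \<Union>\<C>" "(z, m') \<in> \<Union>\<C>" for z m m'
    proof -
      obtain G where G: "G \<in> \<C>" "{(z, m), (z, m')} \<subseteq> G"
        using finite_subset_Union_chain[of "{(z, m), (z, m')}" \<C>] ne chain zm by auto
      obtain d where "\<forall>(z, m)\<in>G. d z = m" using goodD[OF gd[OF G(1)], of "{}"] by auto
      with G(2) have "d z = m" "d z = m'" by auto
      then show ?thesis by simp
    qed
    \<comment> \<open>A finite part mentions finitely many variables, so the relevant piece of the
      union lies in one member of the chain.\<close>
    define vars where "vars = (\<Union>(\<phi>, \<sigma>)\<in>\<Gamma>0. Inl -` (\<sigma> ` fv \<phi>))"
    have finv: "finite vars" using \<Gamma>0 unfolding vars_def
      by (auto intro!: finite_vimageI finite_imageI simp: finite_fv)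
    have "{zm \<in> \<Union>\<C>. fst zm \<in> vars} \<subseteq> (\<lambda>z. (z, THE m. (z, m) \<in> \<Union>\<C>)) ` vars"
    proof
      fix zm assume "zm \<in> {zm \<in> \<Union>\<C>. fst zm \<in> vars}"
      then obtain z m where zm: "zm = (z, m)" "(z, m) \<in> \<Union>\<C>" "z \<in> vars" by (cases zm) auto
      then have "(THE m. (z, m) \<in> \<Union>\<C>) = m" using functional by (intro the_equality) blast+
      then show "zm \<in> (\<lambda>z. (z, THE m. (z, m) \<in> \<Union>\<C>)) ` vars" using zm by auto
    qed
    then have "finite {zm \<in> \<Union>\<C>. fst zm \<in> vars}" using finv finite_subset by blast
    then obtain G where G: "G \<in> \<C>" "{zm \<in> \<Union>\<C>. fst zm \<in> vars} \<subseteq> G"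
      using finite_subset_Union_chain[of "{zm \<in> \<Union>\<C>. fst zm \<in> vars}" \<C>] ne chain by blast
    obtain d where "realizes U Z d \<Gamma>0 \<and> (\<forall>(z, m)\<in>G. d z = m)"
      using goodD[OF gd[OF G(1)], of \<Gamma>0] \<Gamma>0 by auto
    then have d: "realizes U Z d \<Gamma>0" "\<And>z m. (z, m) \<in> G \<Longrightarrow> d z = m" by auto
    \<comment> \<open>The values prescribed by the union are used where they exist. On
      \<open>vars\<close> nothing changes, so the finite part stays satisfied.\<close>
    define d' where "d' z = (if \<exists>m. (z, m) \<in> \<Union>\<C> then THE m. (z, m) \<in> \<Union>\<C> else d z)" for z
    have d'_eq: "d' z = m" if "(z, m) \<in> \<Union>\<C>" for z m
      using that functional unfolding d'_def by (auto intro!: the_equality)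
    have d'_vars: "d' z = d z" if "z \<in> vars" for z
    proof (cases "\<exists>m. (z, m) \<in> \<Union>\<C>")
      case True
      then obtain m where m: "(z, m) \<in> \<Union>\<C>" by blast
      then have "(z, m) \<in> G" using G(2) that by auto
      then show ?thesis using d(2) d'_eq[OF m] by auto
    qed (auto simp: d'_def)
    have "d' ` Z \<subseteq> univ U"
    proof
      fix m assume "m \<in> d' ` Z"
      then obtain z where z: "z \<in> Z" "m = d' z" by blast
      show "m \<in> univ U"
      proof (cases "\<exists>m. (z, m) \<in> \<Union>\<C>")
        case True then show ?thesis using d'_eq z sub by blast
      next
        case False then show ?thesis using d(1) z by (auto simp: d'_def realizes_def)
      qed
    qed
    moreover have "psat U d' (\<phi>, \<sigma>)" if "(\<phi>, \<sigma>) \<in> \<Gamma>0" for \<phi> \<sigma>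
    proof -
      have "psat U d' (\<phi>, \<sigma>) \<longleftrightarrow> psat U d (\<phi>, \<sigma>)"
      proof (rule psat_cong)
        fix x assume "x \<in> fv \<phi>"
        then have "z \<in> vars" if "\<sigma> x = Inl z" for z
          using \<open>(\<phi>, \<sigma>) \<in> \<Gamma>0\<close> imageI[OF \<open>x \<in> fv \<phi>\<close>, of \<sigma>] that unfolding vars_def by auto
        then show "case_sum d' id (\<sigma> x) = case_sum d id (\<sigma> x)"
          using d'_vars by (auto split: sum.splits)
      qed
      then show ?thesis using d(1) that by (auto simp: realizes_def)
    qed
    ultimately have "realizes U Z d' \<Gamma>0" by (auto simp: realizes_def)
    then show "\<exists>d. realizes U Z d \<Gamma>0 \<and> (\<forall>(z, m)\<in>\<Union>\<C>. d z = m)" using d'_eq by blast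
  qed
  ultimately obtain G where G: "good G" "\<And>H. good H \<Longrightarrow> G \<subseteq> H \<Longrightarrow> H = G"
    using subset_Zorn_nonempty[of "{G. good G}"] by auto
  define D where "D = fst ` G"
  obtain p where "\<forall>(z, m)\<in>G. p z = m"
    using goodD[OF G(1), of "{}"] by auto
  then have p: "\<And>z m. (z, m) \<in> G \<Longrightarrow> p z = m" by auto
  have Gp: "G = (\<lambda>z. (z, p z)) ` D" unfolding D_def using p by force
  have DZ: "D \<subseteq> Z" "p ` D \<subseteq> univ U" using G(1) p unfolding good_def D_def by force+
  have ext: "(\<forall>(z, m)\<in>G. d z = m) \<longleftrightarrow> (\<forall>y\<in>D. d y = p y)" for d unfolding Gp by auto
  have "D = Z"
  proof (rule ccontr)
    assume "D \<noteq> Z"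
    then obtain z where z: "z \<in> Z" "z \<notin> D" using DZ by auto
    let ?F = "{\<Gamma>0. finite \<Gamma>0 \<and> \<Gamma>0 \<subseteq> \<Gamma>}"
    \<comment> \<open>With \<open>p\<close> fixed on \<open>D\<close>, each finite part imposes one
      formula on the value at the new variable \<open>z\<close>; all these formulas together form
      the type to be realized.\<close>
    have "\<forall>\<Gamma>0\<in>?F. \<exists>\<theta>. \<theta> \<in> fms_over L (UNIV :: unit set) (B \<union> p ` D) \<and> (\<forall>m\<in>univ U. psat U (\<lambda>_. m) \<theta> \<longleftrightarrow>
       (\<exists>d. realizes U Z d \<Gamma>0 \<and> (\<forall>y\<in>D. d y = p y) \<and> d z = m))" (is "\<forall>\<Gamma>0\<in>?F. ?Q \<Gamma>0")
    proof
      fix \<Gamma>0 assume "\<Gamma>0 \<in> ?F"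
      then have "finite \<Gamma>0" "\<Gamma>0 \<subseteq> fms_over L Z B" using over by auto
      from pfm_projection[OF this z(2,1) DZ(2)]
      show "?Q \<Gamma>0" by (simp add: Bex_def)
    qed
    from bchoice[OF this] obtain \<Theta> where \<Theta>0: "\<forall>\<Gamma>0\<in>?F. \<Theta> \<Gamma>0 \<in> fms_over L (UNIV :: unit set) (B \<union> p ` D) \<and>
      (\<forall>m\<in>univ U. psat U (\<lambda>_. m) (\<Theta> \<Gamma>0) \<longleftrightarrow>
        (\<exists>d. realizes U Z d \<Gamma>0 \<and> (\<forall>y\<in>D. d y = p y) \<and> d z = m))" ..
    have \<Theta>: "\<Gamma>0 \<in> ?F \<Longrightarrow> \<Theta> \<Gamma>0 \<in> fms_over L (UNIV :: unit set) (B \<union> p ` D)"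
      "\<Gamma>0 \<in> ?F \<Longrightarrow> m \<in> univ U \<Longrightarrow> psat U (\<lambda>_. m) (\<Theta> \<Gamma>0) \<longleftrightarrow>
       (\<exists>d. realizes U Z d \<Gamma>0 \<and> (\<forall>y\<in>D. d y = p y) \<and> d z = m)" for \<Gamma>0 m
      using bspec[OF \<Theta>0, of \<Gamma>0] by simp_all
    have "partial_type L U UNIV (B \<union> p ` D) (\<Theta> ` ?F)"
      unfolding partial_type_def
    proof (intro conjI allI impI)
      show "\<Theta> ` ?F \<subseteq> fms_over L UNIV (B \<union> p ` D)" using \<Theta>(1) by blast
      fix \<pi>0 assume "finite \<pi>0 \<and> \<pi>0 \<subseteq> \<Theta> ` ?F"
      \<comment> \<open>Finitely many of these formulas come from finitely many finite parts. Their
        union is again a finite part compatible with \<open>p\<close>, and the value at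
        \<open>z\<close> of an assignment for it satisfies them all.\<close>
      then obtain FF where FF: "FF \<subseteq> ?F" "finite FF" "\<pi>0 = \<Theta> ` FF"
        by (metis (no_types, lifting) finite_subset_image)
      then have "finite (\<Union>FF)" "\<Union>FF \<subseteq> \<Gamma>" by auto
      then obtain d where d: "realizes U Z d (\<Union>FF)" "\<forall>y\<in>D. d y = p y"
        using goodD[OF G(1), of "\<Union>FF"] unfolding ext by auto
      have dz: "d z \<in> univ U" using d(1) z(1) by (auto simp: realizes_def)
      have "psat U (\<lambda>_. d z) (\<Theta> \<Gamma>0)" if "\<Gamma>0 \<in> FF" for \<Gamma>0
      proof -
        have "realizes U Z d \<Gamma>0" using d(1) that by (auto simp: realizes_def)
        then show ?thesis using \<Theta>(2)[of \<Gamma>0 "d z", OF subsetD[OF FF(1) that] dz] d(2) by blast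
      qed
      then have "realizes U UNIV (\<lambda>_::unit. d z) \<pi>0" using dz FF(3) by (auto simp: realizes_def)
      then show "\<exists>d. realizes U (UNIV :: unit set) d \<pi>0" by blast
    qed
    note type = this
    have card: "|B \<union> p ` D| <o \<mu>"
      using B(2) Z DZ(1) small_Un small_image small_subset by blast
    have sub: "B \<union> p ` D \<subseteq> univ U" using B DZ by auto
    have sat: "saturated L U \<mu>" using monster by (simp add: monster_model_def)
    from saturatedD[OF sat sub card type]
    obtain dd where dd: "realizes U (UNIV :: unit set) dd (\<Theta> ` ?F)" ..
    define m where "m = dd ()"
    have "dd = (\<lambda>_. m)" by (auto simp: m_def)
    then have m: "m \<in> univ U" "\<And>\<Gamma>0. \<Gamma>0 \<in> ?F \<Longrightarrow> psat U (\<lambda>_. m) (\<Theta> \<Gamma>0)"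
      using dd by (auto simp: realizes_def)
    have "good (insert (z, m) G)"
      unfolding good_def
    proof (intro conjI allI impI)
      show "insert (z, m) G \<subseteq> Z \<times> univ U" using G(1) m(1) z(1) by (auto simp: good_def)
      fix \<Gamma>0 assume "finite \<Gamma>0 \<and> \<Gamma>0 \<subseteq> \<Gamma>"
      then have "\<Gamma>0 \<in> ?F" by simp
      then have "\<exists>d. realizes U Z d \<Gamma>0 \<and> (\<forall>y\<in>D. d y = p y) \<and> d z = m"
        using \<Theta>(2)[of \<Gamma>0 m, THEN iffD1] m by simp
      then show "\<exists>d. realizes U Z d \<Gamma>0 \<and> (\<forall>(z, m)\<in>insert (z, m) G. d z = m)"
        unfolding ext[symmetric] by auto
    qed
    then have "insert (z, m) G = G" using G(2) by blast
    then show False using z(2) unfolding D_def by force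
  qed
  have "psat U p \<theta>" if \<theta>: "\<theta> \<in> \<Gamma>" for \<theta>
  proof -
    obtain d where d: "realizes U Z d {\<theta>}" "\<forall>y\<in>Z. d y = p y"
      using goodD[OF G(1), of "{\<theta>}"] \<theta> unfolding ext \<open>D = Z\<close> by auto
    obtain \<phi> \<sigma> where eq: "\<theta> = (\<phi>, \<sigma>)" by force
    have "psat U p (\<phi>, \<sigma>) \<longleftrightarrow> psat U d (\<phi>, \<sigma>)"
      using over \<theta> d(2) unfolding eq by (intro psat_cong) (force dest!: fms_overD split: sum.splits)
    then show ?thesis using d(1) eq by (auto simp: realizes_def)
  qed
  then show ?thesis using DZ(2) unfolding \<open>D = Z\<close> realizes_def by blast
qed

end

section \<open>Mutual indiscernibility in terms of arrays\<close>

text \<open>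
  A slot \<open>(i, t, v)\<close> is the coordinate \<open>v\<close> of the member at position \<open>t\<close> of the \<open>i\<close>-th sequence.
  Mutual indiscernibility says that the truth of a formula does not change when its slots are
  moved simultaneously within their sequences without changing the order of the positions.
\<close>

definition slot_kind :: "'i \<times> 'o \<times> 'v \<Rightarrow> 'i \<times> 'v" where
  "slot_kind = (\<lambda>(i, t, v). (i, v))"

definition slot_le :: "('i \<Rightarrow> 'o \<Rightarrow> 'o \<Rightarrow> bool) \<Rightarrow> 'i \<times> 'o \<times> 'v \<Rightarrow> 'i \<times> 'o \<times> 'v \<Rightarrow> bool" where
  "slot_le le = (\<lambda>(i, s, v) (j, t, w). i = j \<and> le i s t)"

text \<open>All ordered pairs of variables are compared in both directions, so for antisymmetric
  orders the coincidences between positions are preserved as well. Slots of different sequences are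
  never comparable, so nothing is required of their relative order.\<close>

definition similar ::
    "('i \<Rightarrow> 'o \<Rightarrow> 'o \<Rightarrow> bool) \<Rightarrow> nat set \<Rightarrow> (nat \<Rightarrow> ('i \<times> 'o \<times> 'v) + 'm) \<Rightarrow> (nat \<Rightarrow> ('i \<times> 'o \<times> 'v) + 'm) \<Rightarrow>
     bool" where
  "similar le F \<sigma> \<tau> \<longleftrightarrow> (\<forall>x\<in>F. map_sum slot_kind id (\<sigma> x) = map_sum slot_kind id (\<tau> x)) \<and>
     (\<forall>x\<in>F. \<forall>y\<in>F. \<forall>p q p' q'. \<sigma> x = Inl p \<and> \<sigma> y = Inl q \<and> \<tau> x = Inl p' \<and> \<tau> y = Inl q' \<longrightarrow>
        (slot_le le p q \<longleftrightarrow> slot_le le p' q'))"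

definition array_indiscernible ::
    "('f, 'r) lang \<Rightarrow> ('f, 'r, 'm) struct \<Rightarrow> ('i \<Rightarrow> 'o \<Rightarrow> 'o \<Rightarrow> bool) \<Rightarrow> ('i \<times> 'o \<times> 'v) set \<Rightarrow>
     ('i \<times> 'o \<times> 'v \<Rightarrow> 'm) \<Rightarrow> 'm set \<Rightarrow> bool" where
  "array_indiscernible L M le P e C \<longleftrightarrow>
     (\<forall>\<phi> \<sigma> \<tau>. (\<phi>, \<sigma>) \<in> fms_over L P C \<and> (\<phi>, \<tau>) \<in> fms_over L P C \<and> similar le (fv \<phi>) \<sigma> \<tau> \<longrightarrow>
        (psat M e (\<phi>, \<sigma>) \<longleftrightarrow> psat M e (\<phi>, \<tau>)))"

lemma array_indiscernibleD:
  "array_indiscernible L M le P e C \<Longrightarrow> (\<phi>, \<sigma>) \<in> fms_over L P C \<Longrightarrow> (\<phi>, \<tau>) \<in> fms_over L P C \<Longrightarrow>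
     similar le (fv \<phi>) \<sigma> \<tau> \<Longrightarrow> psat M e (\<phi>, \<sigma>) \<longleftrightarrow> psat M e (\<phi>, \<tau>)"
  by (simp add: array_indiscernible_def)

lemma array_indiscernible_mono:
  "array_indiscernible L M le P e C \<Longrightarrow> P' \<subseteq> P \<Longrightarrow> C' \<subseteq> C \<Longrightarrow> array_indiscernible L M le P' e C'"
  unfolding array_indiscernible_def using fms_over_mono by meson

lemma similar_Inr: "similar le F \<sigma> \<tau> \<Longrightarrow> x \<in> F \<Longrightarrow> \<sigma> x = Inr c \<longleftrightarrow> \<tau> x = Inr c"
  by (cases "\<sigma> x"; cases "\<tau> x") (force simp: similar_def)+

lemma similar_Inl:
  "similar le F \<sigma> \<tau> \<Longrightarrow> x \<in> F \<Longrightarrow> \<sigma> x = Inl p \<Longrightarrow> \<exists>q. \<tau> x = Inl q \<and> slot_kind p = slot_kind q"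
  by (cases "\<tau> x") (force simp: similar_def)+

lemma similar_le:
  "similar le F \<sigma> \<tau> \<Longrightarrow> x \<in> F \<Longrightarrow> y \<in> F \<Longrightarrow> \<sigma> x = Inl p \<Longrightarrow> \<sigma> y = Inl q \<Longrightarrow> \<tau> x = Inl p' \<Longrightarrow>
     \<tau> y = Inl q' \<Longrightarrow> slot_le le p q \<longleftrightarrow> slot_le le p' q'"
  unfolding similar_def by blast

lemma similarI:
  assumes "\<And>x. x \<in> F \<Longrightarrow> map_sum slot_kind id (\<sigma> x) = map_sum slot_kind id (\<tau> x)"
    and "\<And>x y p q p' q'. x \<in> F \<Longrightarrow> y \<in> F \<Longrightarrow> \<sigma> x = Inl p \<Longrightarrow> \<sigma> y = Inl q \<Longrightarrow> \<tau> x = Inl p' \<Longrightarrow>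
       \<tau> y = Inl q' \<Longrightarrow> slot_le le p q \<longleftrightarrow> slot_le le p' q'"
  shows "similar le F \<sigma> \<tau>"
  using assms by (simp add: similar_def)

lemma similar_sym: "similar le F \<sigma> \<tau> \<Longrightarrow> similar le F \<tau> \<sigma>"
  by (auto simp: similar_def)

lemma similar_trans:
  assumes "similar le F \<sigma> \<tau>" "similar le F \<tau> \<rho>"
  shows "similar le F \<sigma> \<rho>"
proof (rule similarI)
  fix x assume "x \<in> F"
  then show "map_sum slot_kind id (\<sigma> x) = map_sum slot_kind id (\<rho> x)"
    using assms by (simp add: similar_def)
next
  fix x y p q p' q'
  assume *: "x \<in> F" "y \<in> F" "\<sigma> x = Inl p" "\<sigma> y = Inl q" "\<rho> x = Inl p'" "\<rho> y = Inl q'"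
  obtain p1 q1 where "\<tau> x = Inl p1" "\<tau> y = Inl q1" using similar_Inl[OF assms(1)] * by blast
  then show "slot_le le p q \<longleftrightarrow> slot_le le p' q'"
    using similar_le[OF assms(1) *(1-4)] similar_le[OF assms(2) *(1,2) _ _ *(5,6)] by blast
qed

lemma fms_over_map:
  assumes "(\<phi>, \<sigma>) \<in> fms_over L P C" "G ` P \<subseteq> P'"
  shows "(\<phi>, \<lambda>x. map_sum G id (\<sigma> x)) \<in> fms_over L P' C"
proof (rule fms_overI)
  fix x assume "x \<in> fv \<phi>"
  then show "map_sum G id (\<sigma> x) \<in> P' <+> C" using fms_overD[OF assms(1)] assms(2) by fastforce
qed (rule fms_over_wf[OF assms(1)])

text \<open>The substitutions are pushed forward along \<open>G\<close>. The order condition is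
  stated for two pairs of slots because \<open>G\<close> need not preserve the order: it suffices
  that comparisons of images are determined by the kinds and the comparisons of the arguments. This
  admits coordinates on which \<open>G\<close> ignores the position.\<close>

lemma array_indiscernible_transfer:
  assumes ind: "array_indiscernible L M le' P' e' C" and G: "G ` P \<subseteq> P'"
    and e: "\<And>p. p \<in> P \<Longrightarrow> e' (G p) = e p"
    and kind: "\<And>p q. p \<in> P \<Longrightarrow> q \<in> P \<Longrightarrow> slot_kind p = slot_kind q \<Longrightarrow> slot_kind (G p) = slot_kind (G q)"
    and ord: "\<And>p q p' q'. {p, q, p', q'} \<subseteq> P \<Longrightarrow> slot_kind p = slot_kind p' \<Longrightarrow> slot_kind q = slot_kind q' \<Longrightarrow>
      slot_le le p q \<longleftrightarrow> slot_le le p' q' \<Longrightarrow> slot_le le' (G p) (G q) \<longleftrightarrow> slot_le le' (G p') (G q')"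
  shows "array_indiscernible L M le P e C"
  unfolding array_indiscernible_def
proof (intro allI impI, elim conjE)
  fix \<phi> \<sigma> \<tau>
  assume \<sigma>: "(\<phi>, \<sigma>) \<in> fms_over L P C" and \<tau>: "(\<phi>, \<tau>) \<in> fms_over L P C"
    and sim: "similar le (fv \<phi>) \<sigma> \<tau>"
  let ?G = "\<lambda>\<sigma> x. map_sum G id (\<sigma> x)"
  have psat: "psat M e' (\<phi>, ?G \<rho>) \<longleftrightarrow> psat M e (\<phi>, \<rho>)" if "(\<phi>, \<rho>) \<in> fms_over L P C" for \<rho>
  proof (rule psat_cong)
    fix x assume "x \<in> fv \<phi>"
    from fms_overD[OF that this] show "case_sum e' id (map_sum G id (\<rho> x)) = case_sum e id (\<rho> x)"
      using e by (elim PlusE) auto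
  qed
  have in_P: "\<sigma> x = Inl p \<Longrightarrow> p \<in> P" "\<tau> x = Inl p \<Longrightarrow> p \<in> P" if "x \<in> fv \<phi>" for x p
    using fms_overD[OF \<sigma> that] fms_overD[OF \<tau> that] by auto
  have "similar le' (fv \<phi>) (?G \<sigma>) (?G \<tau>)"
  proof (rule similarI)
    fix x assume x: "x \<in> fv \<phi>"
    show "map_sum slot_kind id (map_sum G id (\<sigma> x)) = map_sum slot_kind id (map_sum G id (\<tau> x))"
    proof (cases "\<sigma> x")
      case (Inl p)
      then obtain q where q: "\<tau> x = Inl q" "slot_kind p = slot_kind q" using similar_Inl[OF sim x] by blast
      then show ?thesis using Inl kind[OF in_P(1)[OF x Inl] in_P(2)[OF x q(1)] q(2)] by simp
    next
      case (Inr c)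
      then have "\<tau> x = Inr c" using similar_Inr[OF sim x] by blast
      then show ?thesis using Inr by simp
    qed
  next
    fix x y p q p' q'
    assume *: "x \<in> fv \<phi>" "y \<in> fv \<phi>" "map_sum G id (\<sigma> x) = Inl p" "map_sum G id (\<sigma> y) = Inl q"
      "map_sum G id (\<tau> x) = Inl p'" "map_sum G id (\<tau> y) = Inl q'"
    then obtain p1 q1 p1' q1' where eq: "\<sigma> x = Inl p1" "\<sigma> y = Inl q1" "\<tau> x = Inl p1'" "\<tau> y = Inl q1'"
      "p = G p1" "q = G q1" "p' = G p1'" "q' = G q1'"
      by (cases "\<sigma> x"; cases "\<sigma> y"; cases "\<tau> x"; cases "\<tau> y") auto
    have "slot_kind p1 = slot_kind p1'" "slot_kind q1 = slot_kind q1'"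
      using similar_Inl[OF sim *(1) eq(1)] similar_Inl[OF sim *(2) eq(2)] eq by auto
    then show "slot_le le' p q \<longleftrightarrow> slot_le le' p' q'"
      unfolding eq using similar_le[OF sim *(1,2) eq(1-4)] in_P[OF *(1)] in_P[OF *(2)] eq(1-4)
      by (intro ord) auto
  qed
  then have "psat M e' (\<phi>, ?G \<sigma>) \<longleftrightarrow> psat M e' (\<phi>, ?G \<tau>)"
    by (intro array_indiscernibleD[OF ind] fms_over_map[OF \<sigma> G] fms_over_map[OF \<tau> G])
  then show "psat M e (\<phi>, \<sigma>) \<longleftrightarrow> psat M e (\<phi>, \<tau>)" using psat \<sigma> \<tau> by blast
qed

section \<open>Equivalence of the array formulation with mutual indiscernibility\<close>

lemma increasing_list_ex:
  assumes "Linear_order r" "finite A" "A \<subseteq> Field r"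
  shows "\<exists>ss. increasing r ss \<and> set ss = A"
  using assms(2,3)
proof (induction "card A" arbitrary: A)
  case 0
  then show ?case by (intro exI[of _ "[]"]) (auto simp: increasing_def)
next
  case (Suc n)
  then have "A \<noteq> {}" by auto
  obtain m where m: "m \<in> A" "\<forall>a\<in>A. (a, m) \<in> r"
    using \<open>finite A\<close> \<open>A \<noteq> {}\<close> \<open>A \<subseteq> Field r\<close>
  proof (induction A arbitrary: thesis rule: finite_ne_induct)
    case (singleton x)
    then show ?case using assms(1) by (auto simp: order_on_defs refl_on_def)
  next
    case (insert x F)
    then obtain m where m: "m \<in> F" "\<forall>a\<in>F. (a, m) \<in> r" by auto
    have "x \<in> Field r" "m \<in> Field r" using insert.prems m(1) by auto
    then have xm: "(x, m) \<in> r \<or> (m, x) \<in> r" "(x, x) \<in> r"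
      using assms(1) unfolding order_on_defs refl_on_def total_on_def by metis+
    from xm(1) show ?case
    proof
      assume "(x, m) \<in> r" then show ?thesis using m insert.prems(1)[of m] by auto
    next
      assume *: "(m, x) \<in> r"
      have "\<forall>a\<in>F. (a, x) \<in> r" using m * assms(1) by (auto simp: order_on_defs dest: transD)
      then show ?thesis using insert.prems(1)[of x] \<open>(x, x) \<in> r\<close> by auto
    qed
  qed
  have "n = card (A - {m})" "finite (A - {m})" "A - {m} \<subseteq> Field r"
    using Suc.hyps(2) Suc.prems m(1) by auto
  then obtain ss where ss: "increasing r ss" "set ss = A - {m}"
    using Suc.hyps(1) by blast
  then have "increasing r (ss @ [m])" "set (ss @ [m]) = A"
    using m Suc.prems by (auto simp: increasing_def sorted_wrt_append)
  then show ?case by blast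
qed

lemma increasing_nth_le:
  assumes "Linear_order r" "increasing r ss" "k < length ss" "l < length ss"
  shows "(ss ! k, ss ! l) \<in> r \<longleftrightarrow> k \<le> l"
proof -
  have less: "(ss ! k, ss ! l) \<in> r \<and> ss ! k \<noteq> ss ! l" if "k < l" "l < length ss" for k l
    using assms(2) that by (auto simp: increasing_def sorted_wrt_iff_nth_less)
  have "ss ! k \<in> Field r" using assms(2,3) by (auto simp: increasing_def)
  then have "(ss ! k, ss ! k) \<in> r" using assms(1) by (auto simp: order_on_defs refl_on_def)
  moreover have "antisym r" using assms(1) by (auto simp: order_on_defs)
  ultimately show ?thesis
    using less[of k l] less[of l k] assms(3,4) by (metis antisymD linorder_neqE_nat nat_less_le not_le)
qed

definition tseq_le :: "('i \<Rightarrow> ('o, 'v, 'm) tseq) \<Rightarrow> 'i \<Rightarrow> 'o \<Rightarrow> 'o \<Rightarrow> bool" where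
  "tseq_le I i s t \<longleftrightarrow> (s, t) \<in> fst (I i)"

definition tseq_slots :: "'i set \<Rightarrow> ('i \<Rightarrow> 'v set) \<Rightarrow> ('i \<Rightarrow> ('o, 'v, 'm) tseq) \<Rightarrow> ('i \<times> 'o \<times> 'v) set" where
  "tseq_slots K V I = {(i, t, v). i \<in> K \<and> t \<in> Field (fst (I i)) \<and> v \<in> V i}"

definition tseq_val :: "('i \<Rightarrow> ('o, 'v, 'm) tseq) \<Rightarrow> 'i \<times> 'o \<times> 'v \<Rightarrow> 'm" where
  "tseq_val I = (\<lambda>(i, t, v). snd (I i) t v)"

text \<open>A parameter that comes from another sequence is replaced by a slot holding it. This slot
  stays fixed when \<open>ss\<close> is exchanged for \<open>ts\<close>, and it is incomparable to
  the slots of the sequence \<open>i\<close>, so the two substitutions are similar.\<close>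

lemma mutually_indiscernible_if_array:
  fixes I :: "'i \<Rightarrow> ('o, 'v, 'm) tseq"
  assumes lin: "\<And>i. i \<in> K \<Longrightarrow> Linear_order (fst (I i))"
    and ind: "array_indiscernible L M (tseq_le I) (tseq_slots K V I) (tseq_val I) C"
  shows "mutually_indiscernible L M K V I C"
  unfolding mutually_indiscernible_def indiscernible_def
proof (intro ballI allI impI, elim conjE)
  fix i ss ts
  assume i: "i \<in> K" and ss: "increasing (fst (I i)) ss" and ts: "increasing (fst (I i)) ts"
    and len: "length ss = length ts"
  let ?C = "C \<union> (\<Union>j\<in>K - {i}. tseq_elems (V j) (I j))"
  define slot where "slot m = (SOME p. p \<in> tseq_slots (K - {i}) V I \<and> tseq_val I p = m)" for m
  have slot: "slot m \<in> tseq_slots (K - {i}) V I \<and> tseq_val I (slot m) = m"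
    if "m \<in> ?C" "m \<notin> C" for m
    unfolding slot_def by (rule someI_ex) (use that in \<open>force simp: tseq_slots_def tseq_val_def tseq_elems_def\<close>)
  define lift :: "'o list \<Rightarrow> (nat \<times> 'v) + 'm \<Rightarrow> ('i \<times> 'o \<times> 'v) + 'm" where
    "lift us s = (case s of Inl (k, v) \<Rightarrow> Inl (i, us ! k, v) | Inr m \<Rightarrow> if m \<in> C then Inr m else Inl (slot m))"
    for us s
  have iff: "psat M (\<lambda>(k, v). snd (I i) (ss ! k) v) (\<phi>, \<rho>) \<longleftrightarrow> psat M (\<lambda>(k, v). snd (I i) (ts ! k) v) (\<phi>, \<rho>)"
    if \<rho>: "(\<phi>, \<rho>) \<in> fms_over L ({..<length ss} \<times> V i) ?C" for \<phi> \<rho>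
  proof -
    have cases: "(\<exists>k v. \<rho> x = Inl (k, v) \<and> k < length ss \<and> v \<in> V i) \<or>
        (\<exists>m. \<rho> x = Inr m \<and> m \<in> C) \<or> (\<exists>m. \<rho> x = Inr m \<and> m \<notin> C \<and> m \<in> ?C)" if "x \<in> fv \<phi>" for x
      using fms_overD[OF \<rho> that] by auto
    have lifted: "psat M (\<lambda>(k, v). snd (I i) (us ! k) v) (\<phi>, \<rho>) \<longleftrightarrow>
        psat M (tseq_val I) (\<phi>, \<lambda>x. lift us (\<rho> x))" for us
    proof (rule psat_cong)
      fix x assume "x \<in> fv \<phi>"
      from cases[OF this] show "case_sum (\<lambda>(k, v). snd (I i) (us ! k) v) id (\<rho> x) =
          case_sum (tseq_val I) id (lift us (\<rho> x))"
        by (elim disjE exE conjE) (use slot in \<open>auto simp: lift_def tseq_val_def\<close>)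
    qed
    have over: "(\<phi>, \<lambda>x. lift us (\<rho> x)) \<in> fms_over L (tseq_slots K V I) C"
      if us: "increasing (fst (I i)) us" "length us = length ss" for us
    proof (rule fms_overI)
      fix x assume "x \<in> fv \<phi>"
      from cases[OF this] show "lift us (\<rho> x) \<in> tseq_slots K V I <+> C"
      proof (elim disjE exE conjE)
        fix k v assume "\<rho> x = Inl (k, v)" "k < length ss" "v \<in> V i"
        then show ?thesis using i us by (auto simp: lift_def tseq_slots_def increasing_def)
      next
        fix m assume "\<rho> x = Inr m" "m \<notin> C" "m \<in> ?C"
        then show ?thesis using slot[of m] by (auto simp: lift_def tseq_slots_def)
      qed (auto simp: lift_def)
    qed (rule fms_over_wf[OF \<rho>])
    have "similar (tseq_le I) (fv \<phi>) (\<lambda>x. lift ss (\<rho> x)) (\<lambda>x. lift ts (\<rho> x))"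
    proof (rule similarI)
      fix x assume "x \<in> fv \<phi>"
      from cases[OF this] show "map_sum slot_kind id (lift ss (\<rho> x)) = map_sum slot_kind id (lift ts (\<rho> x))"
        by (elim disjE exE conjE) (auto simp: lift_def slot_kind_def)
    next
      fix x y p q p' q'
      assume *: "x \<in> fv \<phi>" "y \<in> fv \<phi>" "lift ss (\<rho> x) = Inl p" "lift ss (\<rho> y) = Inl q"
        "lift ts (\<rho> x) = Inl p'" "lift ts (\<rho> y) = Inl q'"
      have nth: "(ss ! k, ss ! l) \<in> fst (I i) \<longleftrightarrow> (ts ! k, ts ! l) \<in> fst (I i)"
        if "k < length ss" "l < length ss" for k l
        using that len increasing_nth_le[OF lin[OF i]] ss ts by metis
      have no: "fst (slot m) \<noteq> i" if "m \<notin> C" "m \<in> ?C" for m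
        using slot[OF that(2,1)] by (auto simp: tseq_slots_def)
      from cases[OF *(1)] cases[OF *(2)] show "slot_le (tseq_le I) p q \<longleftrightarrow> slot_le (tseq_le I) p' q'"
        using *(3-) nth no
        by (elim disjE exE conjE) (fastforce simp: lift_def slot_le_def tseq_le_def split: if_splits prod.splits)+
    qed
    then have "psat M (tseq_val I) (\<phi>, \<lambda>x. lift ss (\<rho> x)) \<longleftrightarrow> psat M (tseq_val I) (\<phi>, \<lambda>x. lift ts (\<rho> x))"
      using over ss ts len by (intro array_indiscernibleD[OF ind]) auto
    then show ?thesis unfolding lifted .
  qed
  show "tp L M ({..<length ss} \<times> V i) (\<lambda>(k, v). snd (I i) (ss ! k) v) ?C =
      tp L M ({..<length ts} \<times> V i) (\<lambda>(k, v). snd (I i) (ts ! k) v) ?C"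
    unfolding tp_def len[symmetric] using iff by auto
qed

lemma indiscernibleD:
  "indiscernible L M V I C \<Longrightarrow> increasing (fst I) ss \<Longrightarrow> increasing (fst I) ts \<Longrightarrow> length ss = length ts \<Longrightarrow>
     tp L M ({..<length ss} \<times> V) (\<lambda>(k, v). snd I (ss ! k) v) C =
     tp L M ({..<length ts} \<times> V) (\<lambda>(k, v). snd I (ts ! k) v) C"
  unfolding indiscernible_def by blast

text \<open>The positions used in the sequence \<open>i\<close> are listed in increasing order, and
  by similarity their new positions form an increasing list too. The slots of the other sequences
  agree, so their values serve as the parameters allowed in the indiscernibility of the sequence
  \<open>i\<close>.\<close>

lemma move_one_sequence:
  assumes lin: "Linear_order (fst (I i))" and i: "i \<in> K"
    and mi: "mutually_indiscernible L M K V I C"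
    and \<sigma>: "(\<phi>, \<sigma>) \<in> fms_over L (tseq_slots K V I) C" and \<tau>: "(\<phi>, \<tau>) \<in> fms_over L (tseq_slots K V I) C"
    and sim: "similar (tseq_le I) (fv \<phi>) \<sigma> \<tau>"
    and agree: "\<And>x j t v. x \<in> fv \<phi> \<Longrightarrow> \<sigma> x = Inl (j, t, v) \<Longrightarrow> j \<noteq> i \<Longrightarrow> \<tau> x = \<sigma> x"
  shows "psat M (tseq_val I) (\<phi>, \<sigma>) \<longleftrightarrow> psat M (tseq_val I) (\<phi>, \<tau>)"
proof -
  let ?r = "fst (I i)"
  let ?C = "C \<union> (\<Union>j\<in>K - {i}. tseq_elems (V j) (I j))"
  define A where "A = {t. \<exists>x\<in>fv \<phi>. \<exists>v. \<sigma> x = Inl (i, t, v)}"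
  have "A \<subseteq> (\<lambda>x. fst (snd (projl (\<sigma> x)))) ` fv \<phi>" unfolding A_def by (force simp: image_iff)
  then have "finite A" using finite_fv finite_subset by blast
  moreover have AF: "A \<subseteq> Field ?r"
    unfolding A_def using fms_overD[OF \<sigma>] by (fastforce simp: tseq_slots_def)
  ultimately obtain ss where ss: "increasing ?r ss" "set ss = A"
    using increasing_list_ex[OF lin] by blast
  define h where "h t = (SOME u. \<exists>x\<in>fv \<phi>. \<exists>v. \<sigma> x = Inl (i, t, v) \<and> \<tau> x = Inl (i, u, v))" for t
  have h: "\<exists>x\<in>fv \<phi>. \<exists>v. \<sigma> x = Inl (i, t, v) \<and> \<tau> x = Inl (i, h t, v)" if "t \<in> A" for t
  proof -
    obtain x v where x: "x \<in> fv \<phi>" "\<sigma> x = Inl (i, t, v)" using \<open>t \<in> A\<close> by (auto simp: A_def)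
    then obtain q where "\<tau> x = Inl q" "slot_kind (i, t, v) = slot_kind q"
      using similar_Inl[OF sim] by metis
    then have "\<exists>u. \<tau> x = Inl (i, u, v)" by (cases q) (auto simp: slot_kind_def)
    then have "\<exists>u. \<exists>x\<in>fv \<phi>. \<exists>v. \<sigma> x = Inl (i, t, v) \<and> \<tau> x = Inl (i, u, v)" using x by blast
    then show ?thesis unfolding h_def by (rule someI_ex)
  qed
  have hF: "h t \<in> Field ?r" if "t \<in> A" for t
    using h[OF that] fms_overD[OF \<tau>] by (fastforce simp: tseq_slots_def)
  have h_le: "(s, t) \<in> ?r \<longleftrightarrow> (h s, h t) \<in> ?r" if st: "s \<in> A" "t \<in> A" for s t
  proof -
    obtain x v y w where "x \<in> fv \<phi>" "\<sigma> x = Inl (i, s, v)" "\<tau> x = Inl (i, h s, v)"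
      "y \<in> fv \<phi>" "\<sigma> y = Inl (i, t, w)" "\<tau> y = Inl (i, h t, w)"
      using h[OF st(1)] h[OF st(2)] by blast
    then show ?thesis using similar_le[OF sim, of x y] by (auto simp: slot_le_def tseq_le_def)
  qed
  have anti: "s = t" if "(s, t) \<in> ?r" "(t, s) \<in> ?r" for s t
    using that lin by (auto simp: order_on_defs antisym_def)
  have refl: "(t, t) \<in> ?r" if "t \<in> Field ?r" for t
    using that lin by (auto simp: order_on_defs refl_on_def)
  \<comment> \<open>The new position depends on the old one alone: if two variables share a
    position, similarity gives both inequalities between their new positions, and antisymmetry
    identifies them.\<close>
  have \<tau>h: "\<tau> x = Inl (i, h t, v)" if x: "x \<in> fv \<phi>" "\<sigma> x = Inl (i, t, v)" for x t v
  proof -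
    have t: "t \<in> A" using x A_def by auto
    obtain q where q: "\<tau> x = Inl q" "slot_kind (i, t, v) = slot_kind q"
      using similar_Inl[OF sim x] by blast
    then obtain u where u: "\<tau> x = Inl (i, u, v)" by (cases q) (auto simp: slot_kind_def)
    obtain y w where y: "y \<in> fv \<phi>" "\<sigma> y = Inl (i, t, w)" "\<tau> y = Inl (i, h t, w)" using h[OF t] by blast
    have "(t, t) \<in> ?r" using refl t AF by auto
    then have "(u, h t) \<in> ?r" "(h t, u) \<in> ?r"
      using similar_le[OF sim x(1) y(1) x(2) y(2) u y(3)] similar_le[OF sim y(1) x(1) y(2) x(2) y(3) u]
      by (auto simp: slot_le_def tseq_le_def)
    then show ?thesis using u anti by blast
  qed
  let ?ts = "map h ss"
  have ts: "increasing ?r ?ts"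
    unfolding increasing_def
  proof
    show "set ?ts \<subseteq> Field ?r" using hF ss(2) by auto
    have "h s \<noteq> h t \<and> (h s, h t) \<in> ?r" if "s \<in> A" "t \<in> A" "s \<noteq> t" "(s, t) \<in> ?r" for s t
      using that h_le[of s t] h_le[of t s] anti refl AF by (metis hF)
    then show "sorted_wrt (\<lambda>s t. s \<noteq> t \<and> (s, t) \<in> ?r) ?ts"
      using ss unfolding increasing_def sorted_wrt_map
      by (auto intro: sorted_wrt_mono_rel[of ss "\<lambda>s t. s \<noteq> t \<and> (s, t) \<in> ?r"])
  qed
  define pos where "pos t = (SOME k. k < length ss \<and> ss ! k = t)" for t
  have pos: "pos t < length ss \<and> ss ! pos t = t" if "t \<in> A" for t
    unfolding pos_def by (rule someI_ex) (use that ss(2) in \<open>metis in_set_conv_nth\<close>)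
  define \<rho> where "\<rho> x = (case \<sigma> x of Inl (j, t, v) \<Rightarrow> if j = i then Inl (pos t, v) else Inr (tseq_val I (j, t, v))
    | Inr m \<Rightarrow> Inr m)" for x
  have cases: "(\<exists>t v. \<sigma> x = Inl (i, t, v) \<and> \<tau> x = Inl (i, h t, v) \<and> t \<in> A \<and> v \<in> V i \<and> \<rho> x = Inl (pos t, v)) \<or>
      (\<exists>m\<in>?C. \<rho> x = Inr m \<and> \<tau> x = \<sigma> x \<and> case_sum (tseq_val I) id (\<sigma> x) = m)" if x: "x \<in> fv \<phi>" for x
  proof (cases "\<sigma> x")
    case (Inl p)
    obtain j t v where p: "p = (j, t, v)" by (cases p) auto
    have P: "j \<in> K" "t \<in> Field (fst (I j))" "v \<in> V j"
      using fms_overD[OF \<sigma> x] Inl p by (auto simp: tseq_slots_def)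
    show ?thesis
    proof (cases "j = i")
      case True
      then have "\<sigma> x = Inl (i, t, v)" using Inl p by simp
      then show ?thesis using \<tau>h[OF x] x P True by (auto simp: A_def \<rho>_def)
    next
      case False
      then have "tseq_val I (j, t, v) \<in> ?C" using P by (auto simp: tseq_val_def tseq_elems_def)
      then show ?thesis using agree[OF x, of j t v] Inl p False by (auto simp: \<rho>_def)
    qed
  next
    case (Inr c)
    then have "\<tau> x = Inr c" using similar_Inr[OF sim x] by auto
    then show ?thesis using Inr fms_overD[OF \<sigma> x] by (auto simp: \<rho>_def)
  qed
  have "(\<phi>, \<rho>) \<in> fms_over L ({..<length ss} \<times> V i) ?C"
  proof (rule fms_overI)
    fix x assume "x \<in> fv \<phi>"
    from cases[OF this] show "\<rho> x \<in> ({..<length ss} \<times> V i) <+> ?C"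
      using pos by (elim disjE exE bexE conjE) auto
  qed (rule fms_over_wf[OF \<sigma>])
  moreover have ind: "indiscernible L M (V i) (I i) ?C"
    using mi i unfolding mutually_indiscernible_def by blast
  have "tp L M ({..<length ss} \<times> V i) (\<lambda>(k, v). snd (I i) (ss ! k) v) ?C =
      tp L M ({..<length ?ts} \<times> V i) (\<lambda>(k, v). snd (I i) (?ts ! k) v) ?C"
    by (rule indiscernibleD[OF ind ss(1) ts]) simp
  ultimately have "psat M (\<lambda>(k, v). snd (I i) (ss ! k) v) (\<phi>, \<rho>) \<longleftrightarrow>
      psat M (\<lambda>(k, v). snd (I i) (?ts ! k) v) (\<phi>, \<rho>)"
    unfolding tp_def set_eq_iff by auto
  moreover have "psat M (\<lambda>(k, v). snd (I i) (ss ! k) v) (\<phi>, \<rho>) \<longleftrightarrow> psat M (tseq_val I) (\<phi>, \<sigma>)"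
  proof (rule psat_cong)
    fix x assume "x \<in> fv \<phi>"
    from cases[OF this] show "case_sum (\<lambda>(k, v). snd (I i) (ss ! k) v) id (\<rho> x) = case_sum (tseq_val I) id (\<sigma> x)"
      using pos by (elim disjE exE bexE conjE) (auto simp: tseq_val_def)
  qed
  moreover have "psat M (\<lambda>(k, v). snd (I i) (?ts ! k) v) (\<phi>, \<rho>) \<longleftrightarrow> psat M (tseq_val I) (\<phi>, \<tau>)"
  proof (rule psat_cong)
    fix x assume "x \<in> fv \<phi>"
    from cases[OF this] show "case_sum (\<lambda>(k, v). snd (I i) (?ts ! k) v) id (\<rho> x) = case_sum (tseq_val I) id (\<tau> x)"
      using pos by (elim disjE exE bexE conjE) (auto simp: tseq_val_def)
  qed
  ultimately show ?thesis by blast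
qed

text \<open>Only finitely many sequences occur in a formula, and they can be moved one after the
  other. \<open>mix N\<close> is the stage at which exactly the sequences in \<open>N\<close> have
  been moved.\<close>

lemma array_if_mutually_indiscernible:
  fixes I :: "'i \<Rightarrow> ('o, 'v, 'm) tseq"
  assumes lin: "\<And>i. i \<in> K \<Longrightarrow> Linear_order (fst (I i))"
    and mi: "mutually_indiscernible L M K V I C"
  shows "array_indiscernible L M (tseq_le I) (tseq_slots K V I) (tseq_val I) C"
  unfolding array_indiscernible_def
proof (intro allI impI, elim conjE)
  fix \<phi> \<sigma> \<tau>
  assume \<sigma>: "(\<phi>, \<sigma>) \<in> fms_over L (tseq_slots K V I) C"
    and \<tau>: "(\<phi>, \<tau>) \<in> fms_over L (tseq_slots K V I) C"
    and sim: "similar (tseq_le I) (fv \<phi>) \<sigma> \<tau>"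
  define mix where "mix N x = (case \<sigma> x of Inl p \<Rightarrow> if fst p \<in> N then \<tau> x else \<sigma> x | Inr c \<Rightarrow> Inr c)" for N x
  have mix_cases: "mix N x = \<sigma> x \<or> mix N x = \<tau> x" for N x
    by (auto simp: mix_def split: sum.splits)
  have over: "(\<phi>, mix N) \<in> fms_over L (tseq_slots K V I) C" for N
  proof (rule fms_overI)
    fix x assume "x \<in> fv \<phi>"
    then show "mix N x \<in> tseq_slots K V I <+> C"
      using mix_cases[of N x] fms_overD[OF \<sigma>] fms_overD[OF \<tau>] by auto
  qed (rule fms_over_wf[OF \<sigma>])
  have fst_kind: "slot_kind p = slot_kind q \<Longrightarrow> fst p = fst q" for p q :: "'i \<times> 'o \<times> 'v"
    by (auto simp: slot_kind_def split: prod.splits)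
  have simN: "similar (tseq_le I) (fv \<phi>) \<sigma> (mix N)" for N
  proof (rule similarI)
    fix x assume "x \<in> fv \<phi>"
    then show "map_sum slot_kind id (\<sigma> x) = map_sum slot_kind id (mix N x)"
      using sim mix_cases[of N x] by (auto simp: similar_def)
  next
    fix x y p q p' q'
    assume *: "x \<in> fv \<phi>" "y \<in> fv \<phi>" "\<sigma> x = Inl p" "\<sigma> y = Inl q" "mix N x = Inl p'" "mix N y = Inl q'"
    obtain p1 q1 where 1: "\<tau> x = Inl p1" "\<tau> y = Inl q1" "slot_kind p = slot_kind p1" "slot_kind q = slot_kind q1"
      using similar_Inl[OF sim *(1,3)] similar_Inl[OF sim *(2,4)] by blast
    have p': "p' = (if fst p \<in> N then p1 else p)" "q' = (if fst q \<in> N then q1 else q)"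
      using * 1 by (auto simp: mix_def)
    show "slot_le (tseq_le I) p q \<longleftrightarrow> slot_le (tseq_le I) p' q'"
    \<comment> \<open>Slots of one sequence are moved together or not at all; slots of different
      sequences are incomparable before and after.\<close>
    proof (cases "fst p = fst q")
      case True
      then show ?thesis using similar_le[OF sim *(1-4) 1(1,2)] by (auto simp: p')
    next
      case False
      then have "fst p' \<noteq> fst q'" using fst_kind[OF 1(3)] fst_kind[OF 1(4)] by (auto simp: p')
      then show ?thesis using False by (auto simp: slot_le_def split: prod.splits)
    qed
  qed
  define N0 where "N0 = {i. \<exists>x\<in>fv \<phi>. \<exists>p. \<sigma> x = Inl p \<and> fst p = i}"
  have "N0 \<subseteq> (\<lambda>x. fst (projl (\<sigma> x))) ` fv \<phi>" unfolding N0_def by (force simp: image_iff)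
  then have "finite N0" using finite_fv finite_subset by blast
  moreover have N0K: "N0 \<subseteq> K"
    unfolding N0_def using fms_overD[OF \<sigma>] by (fastforce simp: tseq_slots_def)
  ultimately have "psat M (tseq_val I) (\<phi>, \<sigma>) \<longleftrightarrow> psat M (tseq_val I) (\<phi>, mix N0)"
  proof (induction N0)
    case empty
    show ?case by (rule psat_cong) (auto simp: mix_def split: sum.splits)
  next
    case (insert i N)
    have "psat M (tseq_val I) (\<phi>, mix N) \<longleftrightarrow> psat M (tseq_val I) (\<phi>, mix (insert i N))"
    proof (rule move_one_sequence[OF lin _ mi over over])
      show "i \<in> K" "i \<in> K" using insert.prems by auto
      show "similar (tseq_le I) (fv \<phi>) (mix N) (mix (insert i N))"
        using similar_trans[OF similar_sym[OF simN] simN] .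
      fix x j t v assume x: "x \<in> fv \<phi>" "mix N x = Inl (j, t, v)" "j \<noteq> i"
      then obtain p where p: "\<sigma> x = Inl p" by (auto simp: mix_def split: sum.splits)
      have "fst p = j" using similar_Inl[OF simN x(1) p, of N] x(2) fst_kind by auto
      then show "mix (insert i N) x = mix N x" using p x(3) by (auto simp: mix_def)
    qed
    then show ?case using insert by auto
  qed
  also have "\<dots> \<longleftrightarrow> psat M (tseq_val I) (\<phi>, \<tau>)"
  proof (rule psat_cong)
    fix x assume x: "x \<in> fv \<phi>"
    have "mix N0 x = \<tau> x"
    proof (cases "\<sigma> x")
      case (Inl p)
      then have "fst p \<in> N0" using x unfolding N0_def by blast
      then show ?thesis using Inl by (simp add: mix_def)
    next
      case (Inr c)
      then have "\<tau> x = Inr c" using similar_Inr[OF sim x] by blast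
      then show ?thesis using Inr by (simp add: mix_def)
    qed
    then show "case_sum (tseq_val I) id (mix N0 x) = case_sum (tseq_val I) id (\<tau> x)" by simp
  qed
  finally show "psat M (tseq_val I) (\<phi>, \<sigma>) \<longleftrightarrow> psat M (tseq_val I) (\<phi>, \<tau>)" .
qed

theorem mutually_indiscernible_iff_array:
  assumes "\<And>i. i \<in> K \<Longrightarrow> Linear_order (fst (I i))"
  shows "mutually_indiscernible L M K V I C \<longleftrightarrow>
    array_indiscernible L M (tseq_le I) (tseq_slots K V I) (tseq_val I) C"
  using mutually_indiscernible_if_array array_if_mutually_indiscernible assms by metis

section \<open>Arrays with a central position\<close>

text \<open>
  The positions of \<open>I + I* + c + J* + J\<close>, where the new sequences \<open>I*\<close> and \<open>J*\<close> are indexed by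
  the integers.
\<close>

datatype 'o pos = OL 'o | IL int | Mid | IR int | OR 'o

fun pos_rank :: "'o pos \<Rightarrow> nat" where
  "pos_rank (OL _) = 0"
| "pos_rank (IL _) = 1"
| "pos_rank Mid = 2"
| "pos_rank (IR _) = 3"
| "pos_rank (OR _) = 4"

fun pos_le :: "'o rel \<Rightarrow> 'o rel \<Rightarrow> 'o pos \<Rightarrow> 'o pos \<Rightarrow> bool" where
  "pos_le r s (OL x) (OL y) \<longleftrightarrow> (x, y) \<in> r"
| "pos_le r s (IL x) (IL y) \<longleftrightarrow> x \<le> y"
| "pos_le r s (IR x) (IR y) \<longleftrightarrow> x \<le> y"
| "pos_le r s (OR x) (OR y) \<longleftrightarrow> (x, y) \<in> s"
| "pos_le r s p q \<longleftrightarrow> pos_rank p \<le> pos_rank q"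

definition array_le :: "('i \<Rightarrow> ('o, 'v, 'm) tseq) \<Rightarrow> ('i \<Rightarrow> ('o, 'v, 'm) tseq) \<Rightarrow> 'i \<Rightarrow> 'o pos \<Rightarrow> 'o pos \<Rightarrow> bool" where
  "array_le I J i = pos_le (fst (I i)) (fst (J i))"

text \<open>The value \<open>c i v\<close> at the positions \<open>IL\<close> and \<open>IR\<close>
  is a placeholder. The outer and central slots do not include these positions; the stretched array
  assigns new values there.\<close>

definition array_val ::
    "('i \<Rightarrow> ('o, 'v, 'm) tseq) \<Rightarrow> ('i \<Rightarrow> 'v \<Rightarrow> 'm) \<Rightarrow> ('i \<Rightarrow> ('o, 'v, 'm) tseq) \<Rightarrow> 'i \<times> 'o pos \<times> 'v \<Rightarrow> 'm" where
  "array_val I c J = (\<lambda>(i, p, v). case p of OL t \<Rightarrow> snd (I i) t v | OR t \<Rightarrow> snd (J i) t v | _ \<Rightarrow> c i v)"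

definition outer_slots ::
    "'i set \<Rightarrow> ('i \<Rightarrow> 'v set) \<Rightarrow> ('i \<Rightarrow> ('o, 'v, 'm) tseq) \<Rightarrow> ('i \<Rightarrow> ('o, 'v, 'm) tseq) \<Rightarrow> ('i \<times> 'o pos \<times> 'v) set" where
  "outer_slots K V I J =
     {(i, p, v). i \<in> K \<and> v \<in> V i \<and> p \<in> OL ` Field (fst (I i)) \<union> OR ` Field (fst (J i))}"

definition mid_slots :: "'i set \<Rightarrow> ('i \<Rightarrow> 'v set) \<Rightarrow> ('i \<times> 'o pos \<times> 'v) set" where
  "mid_slots K V = {(i, p, v). i \<in> K \<and> v \<in> V i \<and> p = Mid}"

definition inner_slots :: "'i set \<Rightarrow> ('i \<Rightarrow> 'v set) \<Rightarrow> ('i \<times> 'o pos \<times> 'v) set" where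
  "inner_slots K V = {(i, p, v). i \<in> K \<and> v \<in> V i \<and> p \<in> range IL \<union> range IR}"

lemma array_indiscernible_reposition:
  assumes ind: "array_indiscernible L M le' P' e' C"
    and in_P': "\<And>i t v. (i, t, v) \<in> P \<Longrightarrow> (i, f t, v) \<in> P'"
    and e: "\<And>i t v. (i, t, v) \<in> P \<Longrightarrow> e' (i, f t, v) = e (i, t, v)"
    and le: "\<And>i s t v w. (i, s, v) \<in> P \<Longrightarrow> (i, t, w) \<in> P \<Longrightarrow> le' i (f s) (f t) \<longleftrightarrow> le i s t"
  shows "array_indiscernible L M le P e C"
proof (rule array_indiscernible_transfer[OF ind, where G = "\<lambda>(i, t, v). (i, f t, v)"])
  have *: "slot_le le' (i, f s, v) (j, f t, w) \<longleftrightarrow> slot_le le (i, s, v) (j, t, w)"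
    if "(i, s, v) \<in> P" "(j, t, w) \<in> P" for i s v j t w
    using le that by (auto simp: slot_le_def)
  fix p q p' q' assume "{p, q, p', q'} \<subseteq> P" "slot_le le p q \<longleftrightarrow> slot_le le p' q'"
  then show "slot_le le' ((\<lambda>(i, t, v). (i, f t, v)) p) ((\<lambda>(i, t, v). (i, f t, v)) q) \<longleftrightarrow>
     slot_le le' ((\<lambda>(i, t, v). (i, f t, v)) p') ((\<lambda>(i, t, v). (i, f t, v)) q')"
    using * by (cases p; cases q; cases p'; cases q') simp
qed (use in_P' e in \<open>auto simp: slot_kind_def\<close>)

section \<open>Ordered sums, and the given sequences as arrays\<close>

lemma Linear_orderD:
  assumes "Linear_order r"
  shows "x \<in> Field r \<Longrightarrow> (x, x) \<in> r" "(x, y) \<in> r \<Longrightarrow> (y, z) \<in> r \<Longrightarrow> (x, z) \<in> r"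
    "(x, y) \<in> r \<Longrightarrow> (y, x) \<in> r \<Longrightarrow> x = y"
    "x \<in> Field r \<Longrightarrow> y \<in> Field r \<Longrightarrow> (x, y) \<in> r \<or> (y, x) \<in> r"
  using assms unfolding order_on_defs refl_on_def total_on_def by (metis transD antisymD)+

lemma Field_order_sum: "Field (order_sum r s) = Inl ` Field r \<union> Inr ` Field s"
  unfolding order_sum_def Field_def by (auto simp: image_iff)

lemma in_order_sum:
  "(Inl x, Inl y) \<in> order_sum r s \<longleftrightarrow> (x, y) \<in> r"
  "(Inr u, Inr v) \<in> order_sum r s \<longleftrightarrow> (u, v) \<in> s"
  "(Inl x, Inr v) \<in> order_sum r s \<longleftrightarrow> x \<in> Field r \<and> v \<in> Field s"
  "(Inr u, Inl y) \<notin> order_sum r s"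
  by (auto simp: order_sum_def)

lemma Linear_order_order_sum:
  assumes "Linear_order r" "Linear_order s"
  shows "Linear_order (order_sum r s)"
proof -
  have r: "refl_on (Field r) r" "trans r" "antisym r"
    and s: "refl_on (Field s) s" "trans s" "antisym s"
    using assms by (auto simp: order_on_defs)
  have F: "(x, y) \<in> r \<Longrightarrow> x \<in> Field r \<and> y \<in> Field r" "(u, v) \<in> s \<Longrightarrow> u \<in> Field s \<and> v \<in> Field s" for x y u v
    by (auto simp: Field_def)
  have "trans (order_sum r s)"
  proof (rule transI)
    fix x y z assume "(x, y) \<in> order_sum r s" "(y, z) \<in> order_sum r s"
    then show "(x, z) \<in> order_sum r s"
      by (cases x; cases y; cases z; simp add: in_order_sum)
        (meson transD[OF r(2)] transD[OF s(2)] F)+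
  qed
  moreover have "antisym (order_sum r s)"
  proof (rule antisymI)
    fix x y assume "(x, y) \<in> order_sum r s" "(y, x) \<in> order_sum r s"
    then show "x = y"
      by (cases x; cases y; simp add: in_order_sum) (meson antisymD[OF r(3)] antisymD[OF s(3)])+
  qed
  moreover have "refl_on (Field (order_sum r s)) (order_sum r s)"
    using r(1) s(1) by (auto simp: refl_on_def Field_order_sum in_order_sum)
  moreover have "total_on (Field (order_sum r s)) (order_sum r s)"
    using Linear_orderD(4)[OF assms(1)] Linear_orderD(4)[OF assms(2)]
    unfolding total_on_def Field_order_sum by (auto simp: in_order_sum; blast)
  moreover have "order_sum r s \<subseteq> Field (order_sum r s) \<times> Field (order_sum r s)"
    by (auto simp: Field_def)
  ultimately show ?thesis by (simp add: order_on_defs)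
qed

lemma concat_simps:
  "fst (concat_tseq I J) = order_sum (fst I) (fst J)"
  "snd (concat_tseq I J) = case_sum (snd I) (snd J)"
  by (simp_all add: concat_tseq_def)

lemma single_simps:
  "fst (single_tseq c) = {((), ())}" "snd (single_tseq c) = (\<lambda>_. c)" "Field {((), ())} = {()}"
  by (auto simp: single_tseq_def Field_def)

text \<open>The tuples \<open>c\<close> are arbitrary here because no outer slot reads them; keeping
  them lets one array serve both this statement and the one with the centres inserted.\<close>

lemma mutually_indiscernible_concat_iff:
  assumes lin: "\<And>i. i \<in> K \<Longrightarrow> Linear_order (fst (I i))" "\<And>i. i \<in> K \<Longrightarrow> Linear_order (fst (J i))"
  shows "mutually_indiscernible L M K V (\<lambda>i. concat_tseq (I i) (J i)) C \<longleftrightarrow>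
    array_indiscernible L M (array_le I J) (outer_slots K V I J) (array_val I c J) C"
    (is "_ \<longleftrightarrow> array_indiscernible _ _ ?le ?P ?e _")
proof -
  let ?I = "\<lambda>i. concat_tseq (I i) (J i)"
  define f where "f p = (case p of OL t \<Rightarrow> Inl t | OR t \<Rightarrow> Inr t | _ \<Rightarrow> undefined)" for p :: "'b pos"
  have "mutually_indiscernible L M K V ?I C \<longleftrightarrow>
      array_indiscernible L M (tseq_le ?I) (tseq_slots K V ?I) (tseq_val ?I) C"
    by (rule mutually_indiscernible_iff_array) (simp add: concat_simps Linear_order_order_sum lin)
  also have "\<dots> \<longleftrightarrow> array_indiscernible L M ?le ?P ?e C"
  proof
    assume "array_indiscernible L M (tseq_le ?I) (tseq_slots K V ?I) (tseq_val ?I) C"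
    then show "array_indiscernible L M ?le ?P ?e C"
      by (rule array_indiscernible_reposition[where f = f])
        (auto simp: f_def outer_slots_def tseq_slots_def concat_simps Field_order_sum tseq_val_def
          array_val_def tseq_le_def array_le_def in_order_sum)
  next
    assume "array_indiscernible L M ?le ?P ?e C"
    then show "array_indiscernible L M (tseq_le ?I) (tseq_slots K V ?I) (tseq_val ?I) C"
      by (rule array_indiscernible_reposition[where f = "case_sum OL OR"])
        (auto simp: outer_slots_def tseq_slots_def concat_simps Field_order_sum tseq_val_def
          array_val_def tseq_le_def array_le_def in_order_sum)
  qed
  finally show ?thesis .
qed

lemma mutually_indiscernible_insert_iff:
  assumes lin: "\<And>i. i \<in> K \<Longrightarrow> Linear_order (fst (I i))" "\<And>i. i \<in> K \<Longrightarrow> Linear_order (fst (J i))"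
  shows "mutually_indiscernible L M K V (\<lambda>i. insert_tseq (I i) (c i) (J i)) C \<longleftrightarrow>
    array_indiscernible L M (array_le I J) (outer_slots K V I J \<union> mid_slots K V) (array_val I c J) C"
    (is "_ \<longleftrightarrow> array_indiscernible _ _ ?le ?P ?e _")
proof -
  let ?I = "\<lambda>i. insert_tseq (I i) (c i) (J i)"
  define f where "f p = (case p of OL t \<Rightarrow> Inl t | OR t \<Rightarrow> Inr (Inr t) | _ \<Rightarrow> Inr (Inl ()))" for p :: "'b pos"
  have "Linear_order {((), ())}"
    by (auto simp: order_on_defs refl_on_def Field_def trans_def antisym_def total_on_def)
  then have "mutually_indiscernible L M K V ?I C \<longleftrightarrow>
      array_indiscernible L M (tseq_le ?I) (tseq_slots K V ?I) (tseq_val ?I) C"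
    by (intro mutually_indiscernible_iff_array)
      (simp add: insert_tseq_def concat_simps single_simps Linear_order_order_sum lin)
  also have "\<dots> \<longleftrightarrow> array_indiscernible L M ?le ?P ?e C"
  proof
    assume "array_indiscernible L M (tseq_le ?I) (tseq_slots K V ?I) (tseq_val ?I) C"
    then show "array_indiscernible L M ?le ?P ?e C"
      by (rule array_indiscernible_reposition[where f = f])
        (auto simp: f_def outer_slots_def mid_slots_def tseq_slots_def insert_tseq_def concat_simps
          single_simps Field_order_sum tseq_val_def array_val_def tseq_le_def array_le_def in_order_sum)
  next
    assume "array_indiscernible L M ?le ?P ?e C"
    then show "array_indiscernible L M (tseq_le ?I) (tseq_slots K V ?I) (tseq_val ?I) C"
      by (rule array_indiscernible_reposition[where f = "case_sum OL (case_sum (\<lambda>_. Mid) OR)"])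
        (auto simp: outer_slots_def mid_slots_def tseq_slots_def insert_tseq_def concat_simps
          single_simps Field_order_sum tseq_val_def array_val_def tseq_le_def array_le_def in_order_sum)
  qed
  finally show ?thesis .
qed

lemma indiscernible_insert_iff:
  assumes "Linear_order (fst (I i))" "Linear_order (fst (J i))"
  shows "indiscernible L M (V i) (insert_tseq (I i) (c i) (J i)) C \<longleftrightarrow>
    array_indiscernible L M (array_le I J) (outer_slots {i} V I J \<union> mid_slots {i} V) (array_val I c J) C"
  using mutually_indiscernible_insert_iff[of "{i}" I J L M V c C] assms
  by (simp add: mutually_indiscernible_def)

section \<open>Finite sets of positions\<close>

lemma ex_upper:
  assumes lin: "Linear_order r" and ne: "Field r \<noteq> {}"
    and up: "\<forall>t\<in>Field r. \<exists>s. s \<noteq> t \<and> (t, s) \<in> r" and "finite A"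
  shows "\<exists>t\<in>Field r. \<forall>s\<in>A \<inter> Field r. (s, t) \<in> r \<and> (t, s) \<notin> r"
  using \<open>finite A\<close>
proof (induction A)
  case empty
  then show ?case using ne by auto
next
  case (insert a A)
  then obtain t where t: "t \<in> Field r" "\<forall>s\<in>A \<inter> Field r. (s, t) \<in> r \<and> (t, s) \<notin> r" by blast
  define m where "m = (if a \<in> Field r \<and> (t, a) \<in> r then a else t)"
  have m: "m \<in> Field r" "(t, m) \<in> r" "a \<in> Field r \<Longrightarrow> (a, m) \<in> r"
    using t(1) Linear_orderD(1,4)[OF lin] unfolding m_def by (auto split: if_splits)
  obtain u where u: "u \<noteq> m" "(m, u) \<in> r" using up m(1) by blast
  have "(s, u) \<in> r \<and> (u, s) \<notin> r" if "s \<in> insert a A \<inter> Field r" for s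
  proof -
    have "(s, m) \<in> r" using that t(2) m Linear_orderD(2)[OF lin] by blast
    then show ?thesis using u Linear_orderD(2,3)[OF lin] by metis
  qed
  then show ?case using u(2) by (auto simp: Field_def)
qed

text \<open>The integers are treated in increasing order; since there is no last position, each can
  be sent strictly above \<open>A\<close> and all earlier images.\<close>

lemma embed_integers_above:
  assumes lin: "Linear_order r" and ne: "Field r \<noteq> {}"
    and up: "\<forall>t\<in>Field r. \<exists>s. s \<noteq> t \<and> (t, s) \<in> r" and "finite A" "finite (Q :: int set)"
  shows "\<exists>h. (\<forall>x\<in>Q. h x \<in> Field r \<and> (\<forall>s\<in>A \<inter> Field r. (s, h x) \<in> r \<and> (h x, s) \<notin> r)) \<and>
    (\<forall>x\<in>Q. \<forall>y\<in>Q. (h x, h y) \<in> r \<longleftrightarrow> x \<le> y)"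
  using \<open>finite Q\<close>
proof (induction Q rule: finite_linorder_max_induct)
  case empty
  then show ?case by simp
next
  case (insert b Q)
  then obtain h where h: "\<forall>x\<in>Q. h x \<in> Field r \<and> (\<forall>s\<in>A \<inter> Field r. (s, h x) \<in> r \<and> (h x, s) \<notin> r)"
    "\<forall>x\<in>Q. \<forall>y\<in>Q. (h x, h y) \<in> r \<longleftrightarrow> x \<le> y" by blast
  obtain t where t: "t \<in> Field r" "\<forall>s\<in>(A \<union> h ` Q) \<inter> Field r. (s, t) \<in> r \<and> (t, s) \<notin> r"
    using ex_upper[OF lin ne up, of "A \<union> h ` Q"] \<open>finite A\<close> insert.hyps(1) by auto
  have "(t, t) \<in> r" using t(1) Linear_orderD(1)[OF lin] by blast
  then show ?case
    using h t insert.hyps(2) by (intro exI[of _ "h(b := t)"]) (auto simp: not_le[symmetric])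
qed

lemma embed_integers_below:
  assumes lin: "Linear_order r" and ne: "Field r \<noteq> {}"
    and down: "\<forall>t\<in>Field r. \<exists>s. s \<noteq> t \<and> (s, t) \<in> r" and "finite A" "finite (Q :: int set)"
  shows "\<exists>h. (\<forall>x\<in>Q. h x \<in> Field r \<and> (\<forall>s\<in>A \<inter> Field r. (h x, s) \<in> r \<and> (s, h x) \<notin> r)) \<and>
    (\<forall>x\<in>Q. \<forall>y\<in>Q. (h x, h y) \<in> r \<longleftrightarrow> x \<le> y)"
proof -
  have "Linear_order (r\<inverse>)" using lin by (simp add: linear_order_on_converse)
  moreover have "finite (uminus ` Q)" using assms by simp
  ultimately obtain h where
    h: "\<forall>x\<in>uminus ` Q. h x \<in> Field r \<and> (\<forall>s\<in>A \<inter> Field r. (h x, s) \<in> r \<and> (s, h x) \<notin> r)"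
    "\<forall>x\<in>uminus ` Q. \<forall>y\<in>uminus ` Q. (h y, h x) \<in> r \<longleftrightarrow> x \<le> y"
    using embed_integers_above[of "r\<inverse>" A "uminus ` Q"] ne down \<open>finite A\<close> by auto
  then show ?thesis by (intro exI[of _ "\<lambda>x. h (- x)"]) auto
qed

text \<open>The finite approximation of the stretched order: the new left positions go into
  \<open>r\<close> above every old left position in \<open>F\<close>, the new right ones into
  \<open>s\<close> below every old right position. All other positions stay where they are.\<close>

lemma embed_positions:
  assumes lin: "Linear_order r" "Linear_order s" and ne: "Field r \<noteq> {}" "Field s \<noteq> {}"
    and up: "\<forall>t\<in>Field r. \<exists>u. u \<noteq> t \<and> (t, u) \<in> r"
    and down: "\<forall>t\<in>Field s. \<exists>u. u \<noteq> t \<and> (u, t) \<in> s"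
    and F: "finite F" "\<And>x. OL x \<in> F \<Longrightarrow> x \<in> Field r" "\<And>x. OR x \<in> F \<Longrightarrow> x \<in> Field s"
  shows "\<exists>f. (\<forall>q. IL q \<in> F \<longrightarrow> f (IL q) \<in> OL ` Field r) \<and> (\<forall>q. IR q \<in> F \<longrightarrow> f (IR q) \<in> OR ` Field s) \<and>
    (\<forall>p. p \<notin> range IL \<union> range IR \<longrightarrow> f p = p) \<and>
    (\<forall>p\<in>F. \<forall>q\<in>F. pos_le r s (f p) (f q) \<longleftrightarrow> pos_le r s p q)"
proof -
  have fin: "finite (OL -` F)" "finite (OR -` F)" "finite (IL -` F)" "finite (IR -` F)"
    using F(1) by (auto intro!: finite_vimageI injI)
  obtain h where h: "\<forall>x\<in>IL -` F. h x \<in> Field r \<and> (\<forall>s\<in>OL -` F \<inter> Field r. (s, h x) \<in> r \<and> (h x, s) \<notin> r)"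
    "\<forall>x\<in>IL -` F. \<forall>y\<in>IL -` F. (h x, h y) \<in> r \<longleftrightarrow> x \<le> y"
    using embed_integers_above[OF lin(1) ne(1) up fin(1,3)] by blast
  obtain k where k: "\<forall>x\<in>IR -` F. k x \<in> Field s \<and> (\<forall>t\<in>OR -` F \<inter> Field s. (k x, t) \<in> s \<and> (t, k x) \<notin> s)"
    "\<forall>x\<in>IR -` F. \<forall>y\<in>IR -` F. (k x, k y) \<in> s \<longleftrightarrow> x \<le> y"
    using embed_integers_below[OF lin(2) ne(2) down fin(2,4)] by blast
  define f where "f p = (case p of IL q \<Rightarrow> OL (h q) | IR q \<Rightarrow> OR (k q) | _ \<Rightarrow> p)" for p
  have "pos_le r s (f p) (f q) \<longleftrightarrow> pos_le r s p q" if "p \<in> F" "q \<in> F" for p q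
    using that h k F(2,3) by (cases p; cases q) (auto simp: f_def)
  moreover have "\<forall>q. IL q \<in> F \<longrightarrow> f (IL q) \<in> OL ` Field r" "\<forall>q. IR q \<in> F \<longrightarrow> f (IR q) \<in> OR ` Field s"
    using h(1) k(1) by (auto simp: f_def)
  moreover have "\<forall>p. p \<notin> range IL \<union> range IR \<longrightarrow> f p = p" by (auto simp: f_def split: pos.splits)
  ultimately show ?thesis by blast
qed

definition recenter :: "'i \<Rightarrow> 'o pos \<Rightarrow> 'i \<times> 'o pos \<times> 'v \<Rightarrow> 'i \<times> 'o pos \<times> 'v" where
  "recenter i p = (\<lambda>(j, q, v). if j = i \<and> q = Mid then (i, p, v) else (j, q, v))"

lemma similar_recenter:
  assumes "\<And>x q v. x \<in> F \<Longrightarrow> \<sigma> x = Inl (i, q, v) \<Longrightarrow>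
    (le i Mid q \<longleftrightarrow> le i p (if q = Mid then p else q)) \<and> (le i q Mid \<longleftrightarrow> le i (if q = Mid then p else q) p)"
  shows "similar le F \<sigma> (\<lambda>x. map_sum (recenter i p) id (\<sigma> x))"
proof (rule similarI)
  fix x
  show "map_sum slot_kind id (\<sigma> x) = map_sum slot_kind id (map_sum (recenter i p) id (\<sigma> x))"
    by (cases "\<sigma> x") (auto simp: slot_kind_def recenter_def)
next
  fix x y P Q P' Q'
  assume "x \<in> F" "y \<in> F" "\<sigma> x = Inl P" "\<sigma> y = Inl Q"
    "map_sum (recenter i p) id (\<sigma> x) = Inl P'" "map_sum (recenter i p) id (\<sigma> y) = Inl Q'"
  then show "slot_le le P Q \<longleftrightarrow> slot_le le P' Q'"
    using assms[of x] assms[of y]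
    by (cases P; cases Q) (auto simp: slot_le_def recenter_def split: if_splits)
qed

lemma finite_slots: "finite {p. Inl p \<in> \<sigma> ` fv \<phi>}"
proof -
  have "{p. Inl p \<in> \<sigma> ` fv \<phi>} = Inl -` (\<sigma> ` fv \<phi>)" by auto
  then show ?thesis using finite_vimageI[OF finite_imageI[OF finite_fv], of Inl \<sigma> \<phi>] by simp
qed

text \<open>Normal form of a failure: a formula that distinguishes the centre from a nearby member
  of \<open>I i\<close>. A failure consists of two similar substitutions with different truth
  values. Moving the centre of each to the left makes both avoid it, and there they agree by
  indiscernibility; so one of the two differs from its own moved version.\<close>

lemma central_failure:
  assumes lin: "Linear_order (fst (I i))" and ends: "without_endpoints (I i)" and i: "i \<in> K" "i \<notin> S"
    and P: "P = outer_slots K V I J \<union> mid_slots S V"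
    and ind: "array_indiscernible L M (array_le I J) P e C"
    and not: "\<not> array_indiscernible L M (array_le I J) (P \<union> mid_slots {i} V) e C"
  shows "\<exists>\<phi> \<sigma> t. (\<phi>, \<sigma>) \<in> fms_over L (P \<union> mid_slots {i} V) C \<and> t \<in> Field (fst (I i)) \<and>
    (\<phi>, \<lambda>x. map_sum (recenter i (OL t)) id (\<sigma> x)) \<in> fms_over L P C \<and>
    similar (array_le I J) (fv \<phi>) \<sigma> (\<lambda>x. map_sum (recenter i (OL t)) id (\<sigma> x)) \<and>
    (psat M e (\<phi>, \<sigma>) \<longleftrightarrow> \<not> psat M e (\<phi>, \<lambda>x. map_sum (recenter i (OL t)) id (\<sigma> x)))"
proof -
  have moved: "\<exists>t\<in>Field (fst (I i)). (\<phi>, \<lambda>x. map_sum (recenter i (OL t)) id (\<sigma> x)) \<in> fms_over L P C \<and>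
    similar (array_le I J) (fv \<phi>) \<sigma> (\<lambda>x. map_sum (recenter i (OL t)) id (\<sigma> x))"
    if \<sigma>: "(\<phi>, \<sigma>) \<in> fms_over L (P \<union> mid_slots {i} V) C" for \<phi> \<sigma>
  proof -
    \<comment> \<open>Only the left positions in use matter for the choice of \<open>t\<close>:
      every right position lies above \<open>OL t\<close> just as it lies above
      \<open>Mid\<close>.\<close>
    define A where "A = {s. \<exists>v. Inl (i, OL s, v) \<in> \<sigma> ` fv \<phi>}"
    have "A \<subseteq> (\<lambda>(j, p, v). case p of OL s \<Rightarrow> s | _ \<Rightarrow> undefined) ` {p. Inl p \<in> \<sigma> ` fv \<phi>}"
      unfolding A_def by (force simp: image_iff)
    then have "finite A" using finite_slots finite_subset by blast
    then obtain t where t: "t \<in> Field (fst (I i))"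
      "\<forall>s\<in>A \<inter> Field (fst (I i)). (s, t) \<in> fst (I i) \<and> (t, s) \<notin> fst (I i)"
      using ex_upper[OF lin] ends unfolding without_endpoints_def by metis
    have tt: "(t, t) \<in> fst (I i)" using t(1) Linear_orderD(1)[OF lin] by blast
    have "recenter i (OL t) ` (P \<union> mid_slots {i} V) \<subseteq> P"
      using t(1) i unfolding P recenter_def outer_slots_def mid_slots_def by (auto split: if_splits)
    then have "(\<phi>, \<lambda>x. map_sum (recenter i (OL t)) id (\<sigma> x)) \<in> fms_over L P C"
      by (rule fms_over_map[OF \<sigma>])
    moreover have "similar (array_le I J) (fv \<phi>) \<sigma> (\<lambda>x. map_sum (recenter i (OL t)) id (\<sigma> x))"
    proof (rule similar_recenter)
      fix x q v assume x: "x \<in> fv \<phi>" "\<sigma> x = Inl (i, q, v)"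
      have "(i, q, v) \<in> P \<union> mid_slots {i} V" using fms_overD[OF \<sigma> x(1)] x(2) by auto
      then consider s where "q = OL s" "s \<in> A" "s \<in> Field (fst (I i))" | s where "q = OR s" | "q = Mid"
        using x imageI[OF x(1), of \<sigma>] unfolding P outer_slots_def mid_slots_def A_def by auto
      then show "(array_le I J i Mid q \<longleftrightarrow> array_le I J i (OL t) (if q = Mid then OL t else q)) \<and>
          (array_le I J i q Mid \<longleftrightarrow> array_le I J i (if q = Mid then OL t else q) (OL t))"
        using t(2) tt by cases (auto simp: array_le_def)
    qed
    ultimately show ?thesis using t(1) by blast
  qed
  from not obtain \<phi> \<sigma> \<tau> where \<sigma>: "(\<phi>, \<sigma>) \<in> fms_over L (P \<union> mid_slots {i} V) C"
    and \<tau>: "(\<phi>, \<tau>) \<in> fms_over L (P \<union> mid_slots {i} V) C"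
    and sim: "similar (array_le I J) (fv \<phi>) \<sigma> \<tau>" and ne: "psat M e (\<phi>, \<sigma>) \<longleftrightarrow> \<not> psat M e (\<phi>, \<tau>)"
    unfolding array_indiscernible_def by blast
  obtain t where t: "t \<in> Field (fst (I i))"
    "(\<phi>, \<lambda>x. map_sum (recenter i (OL t)) id (\<sigma> x)) \<in> fms_over L P C"
    "similar (array_le I J) (fv \<phi>) \<sigma> (\<lambda>x. map_sum (recenter i (OL t)) id (\<sigma> x))"
    using moved[OF \<sigma>] by blast
  obtain u where u: "u \<in> Field (fst (I i))"
    "(\<phi>, \<lambda>x. map_sum (recenter i (OL u)) id (\<tau> x)) \<in> fms_over L P C"
    "similar (array_le I J) (fv \<phi>) \<tau> (\<lambda>x. map_sum (recenter i (OL u)) id (\<tau> x))"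
    using moved[OF \<tau>] by blast
  have "psat M e (\<phi>, \<lambda>x. map_sum (recenter i (OL t)) id (\<sigma> x)) \<longleftrightarrow>
      psat M e (\<phi>, \<lambda>x. map_sum (recenter i (OL u)) id (\<tau> x))"
    by (rule array_indiscernibleD[OF ind t(2) u(2)])
      (rule similar_trans[OF similar_trans[OF similar_sym[OF t(3)] sim] u(3)])
  then have "(psat M e (\<phi>, \<sigma>) \<longleftrightarrow> \<not> psat M e (\<phi>, \<lambda>x. map_sum (recenter i (OL t)) id (\<sigma> x))) \<or>
      (psat M e (\<phi>, \<tau>) \<longleftrightarrow> \<not> psat M e (\<phi>, \<lambda>x. map_sum (recenter i (OL u)) id (\<tau> x)))"
    using ne by argo
  then show ?thesis
  proof
    assume "psat M e (\<phi>, \<sigma>) \<longleftrightarrow> \<not> psat M e (\<phi>, \<lambda>x. map_sum (recenter i (OL t)) id (\<sigma> x))"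
    with \<sigma> t show ?thesis by (intro exI[of _ \<phi>] exI[of _ \<sigma>] exI[of _ t]) simp
  next
    assume "psat M e (\<phi>, \<tau>) \<longleftrightarrow> \<not> psat M e (\<phi>, \<lambda>x. map_sum (recenter i (OL u)) id (\<tau> x))"
    with \<tau> u show ?thesis by (intro exI[of _ \<phi>] exI[of _ \<tau>] exI[of _ u]) simp
  qed
qed

section \<open>The number of formulas\<close>

lemma card_of_Un_le: "infinite B \<Longrightarrow> |A| \<le>o |B| \<Longrightarrow> |A'| \<le>o |B| \<Longrightarrow> |A \<union> A'| \<le>o |B|"
  using card_of_Un_ordLeq_infinite_Field[of "|B|" A A'] by (simp add: Field_card_of card_of_card_order_on)

lemma card_of_Times_le: "infinite B \<Longrightarrow> |A| \<le>o |B| \<Longrightarrow> |A'| \<le>o |B| \<Longrightarrow> |A \<times> A'| \<le>o |B|"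
  by (intro card_of_Sigma_ordLeq_infinite) auto

lemma card_of_image_le: "|A| \<le>o |B| \<Longrightarrow> |f ` A| \<le>o |B|"
  using card_of_image ordLeq_transitive by blast

lemma card_of_subset_le: "A' \<subseteq> A \<Longrightarrow> |A| \<le>o |B| \<Longrightarrow> |A'| \<le>o |B|"
  using card_of_mono1 ordLeq_transitive by blast

lemma card_of_UN_size_le:
  fixes F :: "'x \<Rightarrow> nat"
  assumes "infinite B" "\<And>n. |{x. P x \<and> F x < n}| \<le>o |B|"
  shows "|{x. P x}| \<le>o |B|"
proof -
  have "{x. P x} = (\<Union>n. {x. P x \<and> F x < n})" by auto
  moreover have "|\<Union>n. {x. P x \<and> F x < n}| \<le>o |B|"
    using assms infinite_iff_card_of_nat by (intro card_of_UNION_ordLeq_infinite) auto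
  ultimately show ?thesis by simp
qed

lemma card_of_wf_trm_le:
  assumes B: "infinite B" "|UNIV :: nat set| \<le>o |B|" "|funs L| \<le>o |B|"
  shows "|{t. wf_trm L t}| \<le>o |B|"
proof (rule card_of_UN_size_le[OF B(1), where F = size])
  fix n show "|{t. wf_trm L t \<and> size t < n}| \<le>o |B|"
  proof (induction n)
    case 0
    then show ?case by (simp add: card_of_empty)
  next
    case (Suc n)
    let ?T = "{t. wf_trm L t \<and> size t < n}"
    have "{t. wf_trm L t \<and> size t < Suc n} \<subseteq> range Var \<union> (\<lambda>(f, ts). Fn f ts) ` (fst ` funs L \<times> lists ?T)"
    proof
      fix t assume t: "t \<in> {t. wf_trm L t \<and> size t < Suc n}"
      show "t \<in> range Var \<union> (\<lambda>(f, ts). Fn f ts) ` (fst ` funs L \<times> lists ?T)"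
      proof (cases t)
        case (Fn f ts)
        have "size u < n" if "u \<in> set ts" for u
          using t Fn size_list_estimation'[OF that, of "size u" size] by auto
        then have "(f, ts) \<in> fst ` funs L \<times> lists ?T" using t Fn by force
        then show ?thesis unfolding Fn by (intro UnI2 image_eqI[where x = "(f, ts)"]) simp
      qed auto
    qed
    moreover have "|range Var \<union> (\<lambda>(f, ts). Fn f ts) ` (fst ` funs L \<times> lists ?T)| \<le>o |B|"
      by (intro card_of_Un_le card_of_image_le card_of_Times_le card_of_lists_le B Suc)
    ultimately show ?case by (rule card_of_subset_le)
  qed
qed

lemma card_of_wf_fm_le:
  assumes B: "infinite B" "|UNIV :: nat set| \<le>o |B|" "|funs L| \<le>o |B|" "|rels L| \<le>o |B|"
  shows "|{\<phi>. wf_fm L \<phi>}| \<le>o |B|"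
proof (rule card_of_UN_size_le[OF B(1), where F = size])
  fix n show "|{\<phi>. wf_fm L \<phi> \<and> size \<phi> < n}| \<le>o |B|"
  proof (induction n)
    case 0
    then show ?case by (simp add: card_of_empty)
  next
    case (Suc n)
    let ?T = "{t. wf_trm L t}" and ?F = "{\<phi>. wf_fm L \<phi> \<and> size \<phi> < n}"
    let ?R = "(\<lambda>(s, t). Eq s t) ` (?T \<times> ?T) \<union> ((\<lambda>(R, ts). Rl R ts) ` (fst ` rels L \<times> lists ?T) \<union>
      (Neg ` ?F \<union> ((\<lambda>(\<phi>, \<psi>). Conj \<phi> \<psi>) ` (?F \<times> ?F) \<union> (\<lambda>(x, \<phi>). Ex x \<phi>) ` (UNIV \<times> ?F))))"
    have "{\<phi>. wf_fm L \<phi> \<and> size \<phi> < Suc n} \<subseteq> ?R"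
    proof
      fix \<phi> assume \<phi>: "\<phi> \<in> {\<phi>. wf_fm L \<phi> \<and> size \<phi> < Suc n}"
      show "\<phi> \<in> ?R"
      proof (cases \<phi>)
        case (Rl R ts)
        then have "(R, ts) \<in> fst ` rels L \<times> lists ?T" using \<phi> by force
        then show ?thesis unfolding Rl by (rule UnI2[OF UnI1, OF image_eqI[where x = "(R, ts)"], rotated]) simp
      qed (use \<phi> in \<open>auto simp: image_iff\<close>)
    qed
    moreover have "|?R| \<le>o |B|"
      by (intro card_of_Un_le card_of_image_le card_of_Times_le card_of_lists_le B Suc
          card_of_wf_trm_le[OF B(1-3)])
    ultimately show ?case by (rule card_of_subset_le)
  qed
qed

context small_cardinal
begin

text \<open>If every fibre were finite, \<open>K\<close> would be a small union of finite sets and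
  hence small. This pigeonhole works for singular \<open>\<mu>\<close> too, but yields just an
  infinite fibre.\<close>

lemma infinite_fibre:
  assumes "\<mu> \<le>o |K|" "|key ` K| <o \<mu>"
  shows "\<exists>y\<in>key ` K. infinite {k \<in> K. key k = y}"
proof (rule ccontr)
  assume "\<not> ?thesis"
  then have fin: "finite {k \<in> K. key k = y}" if "y \<in> key ` K" for y using that by blast
  have "|\<Union>y\<in>key ` K. {k \<in> K. key k = y}| <o \<mu>"
  proof (rule small_UN_countable[OF assms(2)])
    fix y assume "y \<in> key ` K"
    then show "|{k \<in> K. key k = y}| \<le>o |UNIV :: nat set|" by (intro finite_le_nat fin)
  qed
  moreover have "(\<Union>y\<in>key ` K. {k \<in> K. key k = y}) = K" by auto
  ultimately show False using assms(1) not_ordLess_ordLeq by metis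
qed

end

context monster
begin

lemma small_formulas: "|{\<phi>. wf_fm L \<phi>}| <o \<mu>"
proof -
  have "|funs L <+> rels L| <o \<mu>" using monster small_Plus by (auto simp: monster_model_def)
  then obtain B :: "(nat + ('f \<times> nat) + ('r \<times> nat)) set"
    where B: "infinite B" "|funs L <+> rels L| \<le>o |B|" "|UNIV :: nat set| \<le>o |B|" "|B| <o \<mu>"
    using infinite_small_bound by metis
  have "|funs L| \<le>o |B|" "|rels L| \<le>o |B|"
    using B(2) card_of_Plus1 card_of_Plus2 ordLeq_transitive by blast+
  then show ?thesis using card_of_wf_fm_le[OF B(1,3)] B(4) small_le by blast
qed

section \<open>Conjugate arrays\<close>

lemma similar_map_parameters:
  assumes "similar le F \<sigma> \<tau>"
  shows "similar le F (\<lambda>x. map_sum id h (\<sigma> x)) (\<lambda>x. map_sum id h (\<tau> x))"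
proof (rule similarI)
  fix x assume x: "x \<in> F"
  show "map_sum slot_kind id (map_sum id h (\<sigma> x)) = map_sum slot_kind id (map_sum id h (\<tau> x))"
  proof (cases "\<sigma> x")
    case (Inl p)
    then obtain q where "\<tau> x = Inl q" "slot_kind p = slot_kind q" using similar_Inl[OF assms x] by blast
    then show ?thesis using Inl by simp
  next
    case (Inr c)
    then have "\<tau> x = Inr c" using similar_Inr[OF assms x] by blast
    then show ?thesis using Inr by simp
  qed
next
  fix x y p q p' q'
  assume *: "x \<in> F" "y \<in> F" "map_sum id h (\<sigma> x) = Inl p" "map_sum id h (\<sigma> y) = Inl q"
    "map_sum id h (\<tau> x) = Inl p'" "map_sum id h (\<tau> y) = Inl q'"
  have "\<sigma> x = Inl p" "\<sigma> y = Inl q" "\<tau> x = Inl p'" "\<tau> y = Inl q'"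
    using *(3-) by (cases "\<sigma> x", auto, cases "\<sigma> y", auto, cases "\<tau> x", auto, cases "\<tau> y", auto)
  then show "slot_le le p q \<longleftrightarrow> slot_le le p' q'" using similar_le[OF assms *(1,2)] by blast
qed

lemma array_indiscernible_conjugate:
  assumes g: "automorphism L U g" and C: "C \<subseteq> univ U" and e: "e ` P \<subseteq> univ U"
  shows "array_indiscernible L U le P (\<lambda>p. g (e p)) (g ` C) \<longleftrightarrow> array_indiscernible L U le P e C"
proof
  assume ind: "array_indiscernible L U le P (\<lambda>p. g (e p)) (g ` C)"
  show "array_indiscernible L U le P e C"
    unfolding array_indiscernible_def
  proof (intro allI impI, elim conjE)
    fix \<phi> \<sigma> \<tau>
    assume \<sigma>: "(\<phi>, \<sigma>) \<in> fms_over L P C" and \<tau>: "(\<phi>, \<tau>) \<in> fms_over L P C"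
      and sim: "similar le (fv \<phi>) \<sigma> \<tau>"
    have over: "(\<phi>, \<lambda>x. map_sum id g (\<rho> x)) \<in> fms_over L P (g ` C)" if "(\<phi>, \<rho>) \<in> fms_over L P C" for \<rho>
    proof (rule fms_overI)
      fix x assume "x \<in> fv \<phi>"
      from fms_overD[OF that this] show "map_sum id g (\<rho> x) \<in> P <+> g ` C" by (elim PlusE) auto
    qed (rule fms_over_wf[OF that])
    show "psat U e (\<phi>, \<sigma>) \<longleftrightarrow> psat U e (\<phi>, \<tau>)"
      using array_indiscernibleD[OF ind over[OF \<sigma>] over[OF \<tau>] similar_map_parameters[OF sim]]
      unfolding psat_automorphism[OF g \<sigma> C e] psat_automorphism[OF g \<tau> C e] .
  qed
next
  assume ind: "array_indiscernible L U le P e C"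
  show "array_indiscernible L U le P (\<lambda>p. g (e p)) (g ` C)"
    unfolding array_indiscernible_def
  proof (intro allI impI, elim conjE)
    fix \<phi> \<sigma> \<tau>
    assume \<sigma>: "(\<phi>, \<sigma>) \<in> fms_over L P (g ` C)" and \<tau>: "(\<phi>, \<tau>) \<in> fms_over L P (g ` C)"
      and sim: "similar le (fv \<phi>) \<sigma> \<tau>"
    let ?back = "\<lambda>\<rho> x. map_sum id (inv_into C g) (\<rho> x)"
    have over: "(\<phi>, ?back \<rho>) \<in> fms_over L P C" if "(\<phi>, \<rho>) \<in> fms_over L P (g ` C)" for \<rho>
    proof (rule fms_overI)
      fix x assume "x \<in> fv \<phi>"
      from fms_overD[OF that this] show "?back \<rho> x \<in> P <+> C" by (elim PlusE) (auto intro: inv_into_into)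
    qed (rule fms_over_wf[OF that])
    have pulled: "psat U (\<lambda>p. g (e p)) (\<phi>, \<rho>) \<longleftrightarrow> psat U e (\<phi>, ?back \<rho>)"
      if \<rho>: "(\<phi>, \<rho>) \<in> fms_over L P (g ` C)" for \<rho>
    proof -
      have "psat U (\<lambda>p. g (e p)) (\<phi>, \<rho>) \<longleftrightarrow> psat U (\<lambda>p. g (e p)) (\<phi>, \<lambda>x. map_sum id g (?back \<rho> x))"
      proof (rule psat_cong)
        fix x assume "x \<in> fv \<phi>"
        from fms_overD[OF \<rho> this]
        show "case_sum (\<lambda>p. g (e p)) id (\<rho> x) = case_sum (\<lambda>p. g (e p)) id (map_sum id g (?back \<rho> x))"
          by (elim PlusE) (auto simp: f_inv_into_f)
      qed
      also have "\<dots> \<longleftrightarrow> psat U e (\<phi>, ?back \<rho>)" by (rule psat_automorphism[OF g over[OF \<rho>] C e])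
      finally show ?thesis .
    qed
    show "psat U (\<lambda>p. g (e p)) (\<phi>, \<sigma>) \<longleftrightarrow> psat U (\<lambda>p. g (e p)) (\<phi>, \<tau>)"
      unfolding pulled[OF \<sigma>] pulled[OF \<tau>]
      by (rule array_indiscernibleD[OF ind over[OF \<sigma>] over[OF \<tau>] similar_map_parameters[OF sim]])
  qed
qed

end

section \<open>Bounding the length of a pattern\<close>

text \<open>
  The data of the definition of the rank, in array form: \<open>A\<close> is the base and \<open>D\<close> is the base
  together with the realization.
\<close>

locale pattern = monster L T U \<mu>
  for L :: "('f, 'r) lang" and T :: "('f, 'r) fm set" and U :: "('f, 'r, 'm) struct" and \<mu> :: "'k rel" +
  fixes K :: "'i set" and V :: "'i \<Rightarrow> 'm set" and I J :: "'i \<Rightarrow> ('m, 'm, 'm) tseq" and c :: "'i \<Rightarrow> 'm \<Rightarrow> 'm"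
    and A D :: "'m set"
  assumes tseqs: "\<And>i. i \<in> K \<Longrightarrow> is_tseq U (V i) (I i)" "\<And>i. i \<in> K \<Longrightarrow> is_tseq U (V i) (J i)"
    and endless: "\<And>i. i \<in> K \<Longrightarrow> without_endpoints (I i)" "\<And>i. i \<in> K \<Longrightarrow> without_endpoints (J i)"
    and c: "\<And>i. i \<in> K \<Longrightarrow> c i ` V i \<subseteq> univ U"
    and base: "A \<subseteq> D" "D \<subseteq> univ U" "|D| <o \<mu>"
    and outer_ind: "array_indiscernible L U (array_le I J) (outer_slots K V I J) (array_val I c J) D"
    and full_ind: "array_indiscernible L U (array_le I J) (outer_slots K V I J \<union> mid_slots K V) (array_val I c J) A"
begin

abbreviation "le \<equiv> array_le I J"
abbreviation "val \<equiv> array_val I c J"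
abbreviation "outer \<equiv> outer_slots K V I J"

lemma lin: "i \<in> K \<Longrightarrow> Linear_order (fst (I i))" "i \<in> K \<Longrightarrow> Linear_order (fst (J i))"
  using tseqs by (auto simp: is_tseq_def)

lemma base_small: "|A| <o \<mu>" "A \<subseteq> univ U"
  using base small_subset by blast+

lemma val_univ: "p \<in> outer \<union> mid_slots K V \<Longrightarrow> val p \<in> univ U"
  using tseqs c by (fastforce simp: outer_slots_def mid_slots_def array_val_def is_tseq_def)

text \<open>
  A pattern of length at least \<open>\<mu>\<close> contains infinitely many \<open>i\<close> with the same distinguishing
  formula. For every set of these \<open>i\<close>, mutual indiscernibility over \<open>A\<close> yields an automorphism that
  replaces the central members outside the set by members of the sequences, whence the formula has
  the independence property.
\<close>

theorem NIP_bound: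
  assumes NIP: "NIP L U"
    and not: "\<And>i. i \<in> K \<Longrightarrow> \<not> array_indiscernible L U le (outer_slots {i} V I J \<union> mid_slots {i} V) val D"
  shows "|K| <o \<mu>"
proof (rule ccontr)
  assume "\<not> |K| <o \<mu>"
  then have large: "\<mu> \<le>o |K|"
    using Card_\<mu> card_of_Well_order not_ordLess_iff_ordLeq card_order_on_well_order_on by blast
  let ?re = "\<lambda>i t \<sigma> x. map_sum (recenter i (OL t)) id (\<sigma> x)"
  have "\<forall>i\<in>K. \<exists>\<phi> \<sigma> t. (\<phi>, \<sigma>) \<in> fms_over L (outer_slots {i} V I J \<union> mid_slots {i} V) D \<and>
    (\<phi>, ?re i t \<sigma>) \<in> fms_over L (outer_slots {i} V I J) D \<and> similar le (fv \<phi>) \<sigma> (?re i t \<sigma>) \<and>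
    (psat U val (\<phi>, \<sigma>) \<longleftrightarrow> \<not> psat U val (\<phi>, ?re i t \<sigma>))" (is "\<forall>i\<in>K. ?Q i")
  proof
    fix i assume i: "i \<in> K"
    have "outer_slots {i} V I J = outer_slots {i} V I J \<union> mid_slots {} V" by (auto simp: mid_slots_def)
    moreover have "outer_slots {i} V I J \<subseteq> outer" using i by (auto simp: outer_slots_def)
    then have "array_indiscernible L U le (outer_slots {i} V I J) val D"
      using outer_ind array_indiscernible_mono by blast
    ultimately have "\<exists>\<phi> \<sigma> t. (\<phi>, \<sigma>) \<in> fms_over L (outer_slots {i} V I J \<union> mid_slots {i} V) D \<and>
      t \<in> Field (fst (I i)) \<and> (\<phi>, ?re i t \<sigma>) \<in> fms_over L (outer_slots {i} V I J) D \<and>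
      similar le (fv \<phi>) \<sigma> (?re i t \<sigma>) \<and> (psat U val (\<phi>, \<sigma>) \<longleftrightarrow> \<not> psat U val (\<phi>, ?re i t \<sigma>))"
      by (intro central_failure[where K = "{i}" and S = "{}"] lin i endless not) auto
    then show "?Q i" by (elim exE conjE) (intro exI conjI)
  qed
  then obtain \<Phi> \<Sigma> t where
    over: "\<And>i. i \<in> K \<Longrightarrow> (\<Phi> i, \<Sigma> i) \<in> fms_over L (outer_slots {i} V I J \<union> mid_slots {i} V) D"
    and re_over: "\<And>i. i \<in> K \<Longrightarrow> (\<Phi> i, ?re i (t i) (\<Sigma> i)) \<in> fms_over L (outer_slots {i} V I J) D"
    and sim: "\<And>i. i \<in> K \<Longrightarrow> similar le (fv (\<Phi> i)) (\<Sigma> i) (?re i (t i) (\<Sigma> i))"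
    and differ: "\<And>i. i \<in> K \<Longrightarrow> psat U val (\<Phi> i, \<Sigma> i) \<longleftrightarrow> \<not> psat U val (\<Phi> i, ?re i (t i) (\<Sigma> i))"
    by metis
  define par where "par s = (case s of Inl p \<Rightarrow> None | Inr m \<Rightarrow> Some m)" for s :: "('i \<times> 'm pos \<times> 'm) + 'm"
  \<comment> \<open>The key records everything about a distinguishing formula except which slots it
    uses. There are fewer than \<open>\<mu>\<close> keys, since \<open>D\<close> and the set of
    formulas are small.\<close>
  define key where "key i = (\<Phi> i, map (\<lambda>x. par (\<Sigma> i x)) (sorted_list_of_set (fv (\<Phi> i))), psat U val (\<Phi> i, \<Sigma> i))" for i
  have "key ` K \<subseteq> {\<phi>. wf_fm L \<phi>} \<times> lists (insert None (Some ` D)) \<times> UNIV"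
  proof
    fix y assume "y \<in> key ` K"
    then obtain i where i: "i \<in> K" "y = key i" by blast
    have "par (\<Sigma> i x) \<in> insert None (Some ` D)" if "x \<in> fv (\<Phi> i)" for x
      using fms_overD[OF over[OF i(1)] that] by (auto simp: par_def)
    then have "map (\<lambda>x. par (\<Sigma> i x)) (sorted_list_of_set (fv (\<Phi> i))) \<in> lists (insert None (Some ` D))"
      using finite_fv[of "\<Phi> i"] by (intro in_listsI) fastforce
    then show "y \<in> {\<phi>. wf_fm L \<phi>} \<times> lists (insert None (Some ` D)) \<times> UNIV"
      using fms_over_wf[OF over[OF i(1)]] by (simp add: i(2) key_def)
  qed
  moreover have "|insert None (Some ` D)| <o \<mu>"
    using small_Un[OF small_finite[of "{None}"] small_image[OF base(3), of Some]] by simp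
  then have "|{\<phi>. wf_fm L \<phi>} \<times> lists (insert None (Some ` D)) \<times> (UNIV :: bool set)| <o \<mu>"
    by (rule small_Times[OF small_formulas small_Times[OF small_lists small_finite[OF finite]]])
  ultimately have "|key ` K| <o \<mu>" by (rule small_subset)
  then obtain y where y: "infinite {k \<in> K. key k = y}" using infinite_fibre[OF large] by blast
  obtain \<phi> ps tv where y_eq: "y = (\<phi>, ps, tv)" by (cases y) auto
  from infinite_countable_subset[OF y] obtain f :: "nat \<Rightarrow> 'i"
    where f: "inj f" "range f \<subseteq> {k \<in> K. key k = y}" by blast
  have fK: "f n \<in> K" and \<Phi>f: "\<Phi> (f n) = \<phi>" and tv: "psat U val (\<phi>, \<Sigma> (f n)) = tv"
    and ps: "map (\<lambda>x. par (\<Sigma> (f n) x)) (sorted_list_of_set (fv \<phi>)) = ps" for n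
  proof -
    have "f n \<in> K" "key (f n) = (\<phi>, ps, tv)" using f(2) y_eq by auto
    then show "f n \<in> K" "\<Phi> (f n) = \<phi>" "psat U val (\<phi>, \<Sigma> (f n)) = tv"
      "map (\<lambda>x. par (\<Sigma> (f n) x)) (sorted_list_of_set (fv \<phi>)) = ps" by (auto simp: key_def)
  qed
  have par_eq: "par (\<Sigma> (f n) x) = par (\<Sigma> (f 0) x)" if "x \<in> fv \<phi>" for n x
  proof -
    have "map (\<lambda>x. par (\<Sigma> (f n) x)) (sorted_list_of_set (fv \<phi>)) =
        map (\<lambda>x. par (\<Sigma> (f 0) x)) (sorted_list_of_set (fv \<phi>))"
      using ps[of n] ps[of 0] by (rule trans[OF _ sym])
    then show ?thesis using that finite_fv[of \<phi>] unfolding map_eq_conv by simp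
  qed
  \<comment> \<open>The variables filled by slots form the first group of the partitioned formula.
    Those filled by parameters form the second, and their values \<open>m\<close> are the same for
    all \<open>f n\<close>.\<close>
  define N where "N = {x \<in> fv \<phi>. par (\<Sigma> (f 0) x) = None}"
  have finN: "finite N" using finite_fv[of \<phi>] by (simp add: N_def)
  define slot where "slot n x = projl (\<Sigma> (f n) x)" for n x
  have \<Sigma>_slot: "\<Sigma> (f n) x = Inl (slot n x)" if "x \<in> N" for n x
    using that par_eq[of x n] by (cases "\<Sigma> (f n) x") (auto simp: N_def par_def slot_def)
  define m where "m x = projr (\<Sigma> (f 0) x)" for x
  have \<Sigma>_par: "\<Sigma> (f n) x = Inr (m x)" if "x \<in> fv \<phi>" "x \<notin> N" for n x
    using that par_eq[of x n] by (cases "\<Sigma> (f n) x"; cases "\<Sigma> (f 0) x") (auto simp: N_def par_def m_def)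
  define moved where "moved n x = recenter (f n) (OL (t (f n))) (slot n x)" for n x
  have slot_in: "slot n x \<in> outer_slots {f n} V I J \<union> mid_slots {f n} V" if "x \<in> N" for n x
    using fms_overD[OF over[OF fK[of n]], of x] \<Phi>f[of n] \<Sigma>_slot[OF that, of n] that by (auto simp: N_def)
  have moved_in: "moved n x \<in> outer_slots {f n} V I J" if "x \<in> N" for n x
    using fms_overD[OF re_over[OF fK[of n]], of x] \<Phi>f[of n] \<Sigma>_slot[OF that, of n] that
    by (auto simp: N_def moved_def)
  have mono: "outer_slots {f n} V I J \<subseteq> outer" "mid_slots {f n} V \<subseteq> mid_slots K V" for n
    using fK[of n] by (auto simp: outer_slots_def mid_slots_def)
  have m_in: "m x \<in> D" if "x \<in> fv \<phi>" "x \<notin> N" for x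
    using fms_overD[OF over[OF fK[of 0]], of x] \<Phi>f[of 0] \<Sigma>_par[OF that, of 0] that by auto
  have kinds: "slot_kind (slot n x) = slot_kind (moved n x)" for n x
    by (auto simp: moved_def recenter_def slot_kind_def split: prod.splits)
  have orders: "slot_le le (slot n x) (slot n y) \<longleftrightarrow> slot_le le (moved n x) (moved n y)"
    if "x \<in> N" "y \<in> N" for n x y
  proof (rule similar_le[OF sim[OF fK[of n]]])
    show "x \<in> fv (\<Phi> (f n))" "y \<in> fv (\<Phi> (f n))" using that \<Phi>f[of n] by (simp_all add: N_def)
    show "\<Sigma> (f n) x = Inl (slot n x)" "\<Sigma> (f n) y = Inl (slot n y)" using \<Sigma>_slot that by blast+
    then show "?re (f n) (t (f n)) (\<Sigma> (f n)) x = Inl (moved n x)"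
      "?re (f n) (t (f n)) (\<Sigma> (f n)) y = Inl (moved n y)" by (simp_all add: moved_def)
  qed
  have index: "fst (slot n x) = f n" "fst (moved n x) = f n" if "x \<in> N" for n x
    using slot_in[OF that, of n] moved_in[OF that, of n] by (auto simp: outer_slots_def mid_slots_def)
  obtain u0 where u0: "u0 \<in> univ U" using nonempty by blast
  \<comment> \<open>By indiscernibility with all centres over \<open>A\<close>, the family of slots
    keeps its type over \<open>A\<close> when the centres with \<open>n \<notin> S\<close> are
    moved. The automorphism fixes \<open>A\<close> but may move the parameters from
    \<open>D\<close>.\<close>
  have "\<exists>g. automorphism L U g \<and> (\<forall>x\<in>A. g x = x) \<and>
      (\<forall>n. \<forall>x\<in>N. g (val (slot n x)) = val (if n \<in> S then slot n x else moved n x))" for S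
  proof -
    define s2 where "s2 n x = (if n \<in> S then slot n x else moved n x)" for n x
    let ?Z = "(UNIV :: nat set) \<times> N"
    have small_Z: "|?Z| <o \<mu>" using small_Times small_nat small_finite[OF finN] by blast
    have in_full: "slot n x \<in> outer \<union> mid_slots K V" "s2 n x \<in> outer \<union> mid_slots K V" if "x \<in> N" for n x
      using slot_in[OF that, of n] moved_in[OF that, of n] mono[of n] by (auto simp: s2_def)
    have same: "psat U (\<lambda>(n, x). val (s2 n x)) \<theta>"
      if \<theta>: "\<theta> \<in> fms_over L ?Z A" "psat U (\<lambda>(n, x). val (slot n x)) \<theta>" for \<theta>
    proof -
      obtain \<chi> \<rho> where eq: "\<theta> = (\<chi>, \<rho>)" by force
      let ?G = "\<lambda>s x. map_sum (\<lambda>(n, x). s n x) id (\<rho> x)"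
      have push: "psat U (\<lambda>(n, x). val (s n x)) (\<chi>, \<rho>) \<longleftrightarrow> psat U val (\<chi>, ?G s)" for s
        by (rule psat_cong) (auto split: sum.splits)
      have over1: "(\<chi>, ?G slot) \<in> fms_over L (outer \<union> mid_slots K V) A"
        by (rule fms_over_map[OF \<theta>(1)[unfolded eq]]) (use in_full(1) in force)
      have over2: "(\<chi>, ?G s2) \<in> fms_over L (outer \<union> mid_slots K V) A"
        by (rule fms_over_map[OF \<theta>(1)[unfolded eq]]) (use in_full(2) in force)
      have N: "x \<in> N" if "z \<in> fv \<chi>" "\<rho> z = Inl (n, x)" for z n x
        using fms_overD[OF \<theta>(1)[unfolded eq] that(1)] that(2) by auto
      have "similar le (fv \<chi>) (?G slot) (?G s2)"
      proof (rule similarI)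
        fix z show "map_sum slot_kind id (?G slot z) = map_sum slot_kind id (?G s2 z)"
          using kinds by (cases "\<rho> z") (auto simp: s2_def)
      next
        fix z z' p q p' q'
        assume *: "z \<in> fv \<chi>" "z' \<in> fv \<chi>" "?G slot z = Inl p" "?G slot z' = Inl q"
          "?G s2 z = Inl p'" "?G s2 z' = Inl q'"
        obtain n x where z: "\<rho> z = Inl (n, x)" using *(3) by (cases "\<rho> z") auto
        obtain k y where z': "\<rho> z' = Inl (k, y)" using *(4) by (cases "\<rho> z'") auto
        have xy: "x \<in> N" "y \<in> N" using N *(1,2) z z' by blast+
        have eqs: "p = slot n x" "q = slot k y" "p' = s2 n x" "q' = s2 k y" using * z z' by auto
        show "slot_le le p q \<longleftrightarrow> slot_le le p' q'"
        proof (cases "n = k")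
          case True
          then show ?thesis using orders[OF xy] by (auto simp: eqs s2_def)
        next
          case False
          then have "f n \<noteq> f k" using f(1) by (simp add: inj_eq)
          then have "fst p \<noteq> fst q" "fst p' \<noteq> fst q'" using index xy by (auto simp: eqs s2_def)
          then show ?thesis by (auto simp: slot_le_def split: prod.splits)
        qed
      qed
      then show ?thesis
        using array_indiscernibleD[OF full_ind over1 over2] \<theta>(2) unfolding eq push by blast
    qed
    have univs: "(\<lambda>(n, x). val (slot n x)) ` ?Z \<subseteq> univ U" "(\<lambda>(n, x). val (s2 n x)) ` ?Z \<subseteq> univ U"
      using val_univ[OF in_full(1)] val_univ[OF in_full(2)] by auto
    obtain g where "automorphism L U g" "\<And>x. x \<in> A \<Longrightarrow> g x = x"
      "\<And>z. z \<in> ?Z \<Longrightarrow> g ((\<lambda>(n, x). val (slot n x)) z) = (\<lambda>(n, x). val (s2 n x)) z"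
      using same_type_automorphism[OF base_small(2,1) small_Z univs same] by blast
    then show ?thesis unfolding s2_def by (intro exI[of _ g]) auto
  qed
  then obtain g where g: "\<And>S. automorphism L U (g S)"
    "\<And>S n x. x \<in> N \<Longrightarrow> g S (val (slot n x)) = val (if n \<in> S then slot n x else moved n x)"
    by metis
  define a where "a n x = (if x \<in> N then val (slot n x) else u0)" for n x
  define b where "b S x = (if x \<in> fv \<phi> - N then inv_into (univ U) (g S) (m x) else u0)" for S x
  have img: "g S ` univ U = univ U" for S using g(1)[of S] by (auto simp: automorphism_def bij_betw_def)
  have a_univ: "a n x \<in> univ U" for n x
    using u0 val_univ[of "slot n x"] slot_in[of x n] mono[of n] by (auto simp: a_def)
  have b_univ: "b S x \<in> univ U" for S x
  proof (cases "x \<in> fv \<phi> - N")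
    case True
    then have "m x \<in> g S ` univ U" using m_in base(2) img by auto
    then show ?thesis using True by (auto simp: b_def intro: inv_into_into)
  qed (use u0 in \<open>auto simp: b_def\<close>)
  have gb: "g S (b S x) = m x" if "x \<in> fv \<phi>" "x \<notin> N" for S x
  proof -
    have "m x \<in> g S ` univ U" using m_in[OF that] base(2) img by auto
    then show ?thesis using that by (simp add: b_def f_inv_into_f)
  qed
  have wf: "wf_fm L \<phi>" using fms_over_wf[OF over[OF fK[of 0]]] \<Phi>f[of 0] by simp
  have eval: "sat U (\<lambda>x. if x \<in> N then a n x else b S x) \<phi> \<longleftrightarrow> (n \<in> S \<longleftrightarrow> tv)" for n S
  proof -
    let ?e = "\<lambda>x. if x \<in> N then a n x else b S x"
    have "sat U ?e \<phi> \<longleftrightarrow> sat U (\<lambda>x. g S (?e x)) \<phi>"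
      using sat_automorphism[OF struct g(1) wf, of ?e S] a_univ b_univ by auto
    also have "\<dots> \<longleftrightarrow> psat U val (\<phi>, if n \<in> S then \<Sigma> (f n) else ?re (f n) (t (f n)) (\<Sigma> (f n)))"
      unfolding psat_def prod.case
    proof (rule sat_cong)
      fix x assume x: "x \<in> fv \<phi>"
      show "g S (?e x) = (case_sum val id \<circ> (if n \<in> S then \<Sigma> (f n) else ?re (f n) (t (f n)) (\<Sigma> (f n)))) x"
      proof (cases "x \<in> N")
        case True
        then show ?thesis using g(2)[OF True, of S n] \<Sigma>_slot[OF True, of n] by (simp add: a_def moved_def)
      next
        case False
        then show ?thesis using gb[OF x False, of S] \<Sigma>_par[OF x False, of n] by simp
      qed
    qed
    also have "\<dots> \<longleftrightarrow> (n \<in> S \<longleftrightarrow> tv)" using tv[of n] differ[OF fK[of n]] \<Phi>f[of n] by auto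
    finally show ?thesis .
  qed
  \<comment> \<open>The common truth value \<open>tv\<close> decides whether the original instances
    satisfy the formula or its negation.\<close>
  have "has_IP U N (if tv then \<phi> else Neg \<phi>)"
    unfolding has_IP_def using a_univ b_univ eval by (intro exI[of _ a] exI[of _ b]) auto
  moreover have "wf_fm L (if tv then \<phi> else Neg \<phi>)" using wf by simp
  ultimately show False using NIP unfolding NIP_def by blast
qed

end

section \<open>Stretching the array around the centre\<close>

lemma int_le_nat: "|UNIV :: int set| \<le>o |UNIV :: nat set|"
  using inj_int_encode[of UNIV] by (auto simp: card_of_ordLeq[symmetric])

context pattern
begin

text \<open>Positions are embedded in each sequence separately. The coordinate is kept, so
  \<open>V0 k \<subseteq> V k\<close> ensures that a new slot lands on an old one.\<close>

lemma embed_slots: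
  assumes F: "finite F" "F \<subseteq> outer \<union> mid_slots K V \<union> inner_slots K' V0"
    and K': "K' \<subseteq> K" and V0: "\<And>k. k \<in> K' \<Longrightarrow> V0 k \<subseteq> V k"
  shows "\<exists>g. (\<forall>p\<in>F \<inter> inner_slots K' V0. g p \<in> outer) \<and> (\<forall>p. p \<notin> inner_slots K' V0 \<longrightarrow> g p = p) \<and>
    (\<forall>p. slot_kind (g p) = slot_kind p) \<and>
    (\<forall>p\<in>F. \<forall>q\<in>F. slot_le le (g p) (g q) \<longleftrightarrow> slot_le le p q)"
proof -
  define Fk where "Fk k = {p. \<exists>v. (k, p, v) \<in> F}" for k
  have "\<forall>k\<in>K. \<exists>f. (\<forall>q. IL q \<in> Fk k \<longrightarrow> f (IL q) \<in> OL ` Field (fst (I k))) \<and>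
      (\<forall>q. IR q \<in> Fk k \<longrightarrow> f (IR q) \<in> OR ` Field (fst (J k))) \<and>
      (\<forall>p. p \<notin> range IL \<union> range IR \<longrightarrow> f p = p) \<and>
      (\<forall>p\<in>Fk k. \<forall>q\<in>Fk k. pos_le (fst (I k)) (fst (J k)) (f p) (f q) \<longleftrightarrow> pos_le (fst (I k)) (fst (J k)) p q)" (is "\<forall>k\<in>K. ?Q k")
  proof
    fix k assume k: "k \<in> K"
    have "Fk k \<subseteq> (\<lambda>(k, p, v). p) ` F" unfolding Fk_def by force
    then have "finite (Fk k)" using F(1) finite_subset by blast
    moreover have "x \<in> Field (fst (I k))" if "OL x \<in> Fk k" for x
      using that F(2) unfolding Fk_def outer_slots_def mid_slots_def inner_slots_def by auto
    moreover have "x \<in> Field (fst (J k))" if "OR x \<in> Fk k" for x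
      using that F(2) unfolding Fk_def outer_slots_def mid_slots_def inner_slots_def by auto
    ultimately show "?Q k"
      using endless[OF k] unfolding without_endpoints_def by (intro embed_positions lin k) auto
  qed
  from bchoice[OF this] obtain f where f0: "\<forall>k\<in>K. (\<forall>q. IL q \<in> Fk k \<longrightarrow> f k (IL q) \<in> OL ` Field (fst (I k))) \<and>
      (\<forall>q. IR q \<in> Fk k \<longrightarrow> f k (IR q) \<in> OR ` Field (fst (J k))) \<and>
      (\<forall>p. p \<notin> range IL \<union> range IR \<longrightarrow> f k p = p) \<and>
      (\<forall>p\<in>Fk k. \<forall>q\<in>Fk k. pos_le (fst (I k)) (fst (J k)) (f k p) (f k q) \<longleftrightarrow> pos_le (fst (I k)) (fst (J k)) p q)" ..
  have f: "k \<in> K \<Longrightarrow> IL x \<in> Fk k \<Longrightarrow> f k (IL x) \<in> OL ` Field (fst (I k))"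
    "k \<in> K \<Longrightarrow> IR x \<in> Fk k \<Longrightarrow> f k (IR x) \<in> OR ` Field (fst (J k))"
    "k \<in> K \<Longrightarrow> p \<notin> range IL \<union> range IR \<Longrightarrow> f k p = p"
    "k \<in> K \<Longrightarrow> p \<in> Fk k \<Longrightarrow> q \<in> Fk k \<Longrightarrow>
       pos_le (fst (I k)) (fst (J k)) (f k p) (f k q) \<longleftrightarrow> pos_le (fst (I k)) (fst (J k)) p q" for k x p q
    using bspec[OF f0, of k] by simp_all
  define g where "g = (\<lambda>(k, p, v). if (k, p, v) \<in> inner_slots K' V0 then (k, f k p, v) else (k, p, v))"
  have gF: "g (k, p, v) = (k, f k p, v) \<and> k \<in> K \<and> p \<in> Fk k" if "(k, p, v) \<in> F" for k p v
  proof -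
    have k: "k \<in> K" using that F(2) K' by (auto simp: outer_slots_def mid_slots_def inner_slots_def)
    have "f k p = p" if "(k, p, v) \<notin> inner_slots K' V0"
      using that \<open>(k, p, v) \<in> F\<close> F(2) f(3)[OF k, of p]
      by (auto simp: outer_slots_def mid_slots_def inner_slots_def)
    then show ?thesis using k that by (auto simp: g_def Fk_def)
  qed
  have "g p \<in> outer" if "p \<in> F \<inter> inner_slots K' V0" for p
  proof -
    obtain k q v where p: "p = (k, q, v)" by (cases p) auto
    then have kqv: "(k, q, v) \<in> F" "k \<in> K'" "v \<in> V0 k" "q \<in> range IL \<union> range IR"
      using that by (auto simp: inner_slots_def)
    have "f k q \<in> OL ` Field (fst (I k)) \<union> OR ` Field (fst (J k))"
      using kqv(4) f(1,2)[of k] gF[OF kqv(1)] by auto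
    then show ?thesis using gF[OF kqv(1)] kqv V0 p by (auto simp: outer_slots_def)
  qed
  moreover have "slot_le le (g p) (g q) \<longleftrightarrow> slot_le le p q" if "p \<in> F" "q \<in> F" for p q
  proof -
    obtain k a v where p: "p = (k, a, v)" by (cases p) auto
    obtain l b w where q: "q = (l, b, w)" by (cases q) auto
    show ?thesis using that gF[of k a v] gF[of l b w] f(4)[of k a b] unfolding p q
      by (auto simp: slot_le_def array_le_def)
  qed
  moreover have "\<forall>p. slot_kind (g p) = slot_kind p" "\<forall>p. p \<notin> inner_slots K' V0 \<longrightarrow> g p = p"
    by (auto simp: g_def slot_kind_def)
  ultimately show ?thesis by blast
qed

lemma similar_embedding:
  assumes "\<And>p. slot_kind (g p) = slot_kind p"
    and "\<And>p q. p \<in> F \<Longrightarrow> q \<in> F \<Longrightarrow> slot_le le (g p) (g q) \<longleftrightarrow> slot_le le p q"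
    and "\<And>x p. x \<in> X \<Longrightarrow> \<sigma> x = Inl p \<Longrightarrow> p \<in> F"
  shows "similar le X \<sigma> (\<lambda>x. map_sum g id (\<sigma> x))"
proof (rule similarI)
  fix x show "map_sum slot_kind id (\<sigma> x) = map_sum slot_kind id (map_sum g id (\<sigma> x))"
    using assms(1) by (cases "\<sigma> x") auto
next
  fix x y p q p' q'
  assume "x \<in> X" "y \<in> X" "\<sigma> x = Inl p" "\<sigma> y = Inl q" "map_sum g id (\<sigma> x) = Inl p'" "map_sum g id (\<sigma> y) = Inl q'"
  then show "slot_le le p q \<longleftrightarrow> slot_le le p' q'" using assms(2)[of p q] assms(3) by auto
qed

lemma small_inner_slots:
  assumes "|K'| <o \<mu>" "\<And>k. k \<in> K' \<Longrightarrow> finite (V0 k)"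
  shows "|inner_slots K' V0 :: ('i \<times> 'm pos \<times> 'm) set| <o \<mu>"
proof -
  let ?F = "\<lambda>k. (\<lambda>(q, v). (k, q, v)) ` ((range IL \<union> range IR) \<times> V0 k) :: ('i \<times> 'm pos \<times> 'm) set"
  have "|\<Union>k\<in>K'. ?F k| <o \<mu>"
  proof (rule small_UN_countable[OF assms(1)])
    fix k assume "k \<in> K'"
    then show "|?F k| \<le>o |UNIV :: nat set|"
      using card_of_image_le[OF card_of_Times_le[OF infinite_UNIV_nat
          card_of_Un_le[OF infinite_UNIV_nat card_of_image_le[OF int_le_nat] card_of_image_le[OF int_le_nat]]
          finite_le_nat[OF assms(2)]]] by blast
  qed
  moreover have "inner_slots K' V0 \<subseteq> (\<Union>k\<in>K'. ?F k)" by (force simp: inner_slots_def)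
  ultimately show ?thesis by (rule small_subset[rotated])
qed

text \<open>
  A member \<open>(P, Q, C)\<close> of \<open>CS\<close> demands that the slots in \<open>P\<close>, some of which are new, behave over \<open>C\<close>
  like the old slots in \<open>Q\<close>. A finite part of these demands is met by embedding the finitely many
  new positions into the old sequences, close to the centre.
\<close>

theorem stretch:
  assumes K': "K' \<subseteq> K" "|K'| <o \<mu>"
    and V0: "\<And>k. k \<in> K' \<Longrightarrow> finite (V0 k)" "\<And>k. k \<in> K' \<Longrightarrow> V0 k \<subseteq> V k"
    and W: "W \<subseteq> outer \<union> mid_slots K V" "|W| <o \<mu>"
    and CS: "\<And>P Q C. (P, Q, C) \<in> CS \<Longrightarrow> array_indiscernible L U le Q val C \<and> outer \<subseteq> Q \<and>
      Q \<subseteq> outer \<union> mid_slots K V \<and> C \<subseteq> D \<and>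
      P \<subseteq> (W \<inter> Q) \<union> inner_slots K' V0"
  obtains e where "\<And>p. p \<notin> inner_slots K' V0 \<Longrightarrow> e p = val p" "e ` inner_slots K' V0 \<subseteq> univ U"
    "\<And>P Q C. (P, Q, C) \<in> CS \<Longrightarrow> array_indiscernible L U le P e C"
    "\<And>P Q C \<phi> \<sigma> \<tau>. (P, Q, C) \<in> CS \<Longrightarrow> (\<phi>, \<sigma>) \<in> fms_over L P C \<Longrightarrow> (\<phi>, \<tau>) \<in> fms_over L Q C \<Longrightarrow>
       similar le (fv \<phi>) \<sigma> \<tau> \<Longrightarrow> psat U e (\<phi>, \<sigma>) \<longleftrightarrow> psat U val (\<phi>, \<tau>)"
proof -
  let ?Z = "inner_slots K' V0 :: ('i \<times> 'm pos \<times> 'm) set"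
  \<comment> \<open>A formula on new slots is demanded as soon as some similar instance on old slots
    is true; the indiscernibility of the old array makes the choice of the instance
    irrelevant.\<close>
  define demands where "demands = {(\<phi>, \<sigma>). \<exists>P Q C \<tau>. (P, Q, C) \<in> CS \<and> (\<phi>, \<sigma>) \<in> fms_over L P C \<and>
    (\<phi>, \<tau>) \<in> fms_over L Q C \<and> similar le (fv \<phi>) \<sigma> \<tau> \<and> psat U val (\<phi>, \<tau>)}"
  \<comment> \<open>Old slots keep their values and enter the type as parameters; only the new slots
    are variables.\<close>
  define plug where "plug s = (case s of Inl p \<Rightarrow> if p \<in> ?Z then Inl p else Inr (val p) | Inr m \<Rightarrow> Inr m)" for s
  define \<Gamma> where "\<Gamma> = (\<lambda>(\<phi>, \<sigma>). (\<phi>, \<lambda>x. plug (\<sigma> x))) ` demands"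
  have P_sub: "P \<subseteq> outer \<union> mid_slots K V \<union> ?Z" if "(P, Q, C) \<in> CS" for P Q C
    using CS[OF that] W(1) by blast
  \<comment> \<open>A single embedding serves all triples in \<open>CS\<close> simultaneously: it
    sends new slots to outer ones, which belong to every \<open>Q\<close>, and fixes the old
    slots.\<close>
  have embedding: "\<exists>g. (\<forall>\<phi> \<sigma> P Q C. (\<phi>, \<sigma>) \<in> \<Delta> \<and> (P, Q, C) \<in> CS \<and> (\<phi>, \<sigma>) \<in> fms_over L P C \<longrightarrow>
      (\<phi>, \<lambda>x. map_sum g id (\<sigma> x)) \<in> fms_over L Q C \<and> similar le (fv \<phi>) \<sigma> (\<lambda>x. map_sum g id (\<sigma> x))) \<and>
      (\<forall>p. p \<notin> ?Z \<longrightarrow> g p = p)"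
    if \<Delta>: "finite \<Delta>" for \<Delta>
  proof -
    define F where "F = (\<Union>(\<phi>, \<sigma>)\<in>\<Delta>. {p. Inl p \<in> \<sigma> ` fv \<phi>}) \<inter> (outer \<union> mid_slots K V \<union> ?Z)"
    have "finite (\<Union>(\<phi>, \<sigma>)\<in>\<Delta>. {p. Inl p \<in> \<sigma> ` fv \<phi>})"
      using \<Delta> by (rule finite_UN_I) (simp add: finite_slots split: prod.splits)
    then have "finite F" unfolding F_def by (rule finite_Int[OF disjI1])
    moreover have "F \<subseteq> outer \<union> mid_slots K V \<union> ?Z" unfolding F_def by blast
    ultimately have "\<exists>g. (\<forall>p\<in>F \<inter> ?Z. g p \<in> outer) \<and> (\<forall>p. p \<notin> ?Z \<longrightarrow> g p = p) \<and>
      (\<forall>p. slot_kind (g p) = slot_kind p) \<and> (\<forall>p\<in>F. \<forall>q\<in>F. slot_le le (g p) (g q) \<longleftrightarrow> slot_le le p q)"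
      by (rule embed_slots[OF _ _ K'(1) V0(2)])
    then obtain g where g0: "\<forall>p\<in>F \<inter> ?Z. g p \<in> outer" "\<forall>p. p \<notin> ?Z \<longrightarrow> g p = p"
      "\<forall>p. slot_kind (g p) = slot_kind p" "\<forall>p\<in>F. \<forall>q\<in>F. slot_le le (g p) (g q) \<longleftrightarrow> slot_le le p q"
      by (elim exE conjE)
    have g: "p \<in> F \<Longrightarrow> p \<in> ?Z \<Longrightarrow> g p \<in> outer" "p \<notin> ?Z \<Longrightarrow> g p = p" "slot_kind (g p) = slot_kind p"
      "p \<in> F \<Longrightarrow> q \<in> F \<Longrightarrow> slot_le le (g p) (g q) \<longleftrightarrow> slot_le le p q" for p q
      using g0 by blast+
    have "(\<phi>, \<lambda>x. map_sum g id (\<sigma> x)) \<in> fms_over L Q C \<and> similar le (fv \<phi>) \<sigma> (\<lambda>x. map_sum g id (\<sigma> x))"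
      if "(\<phi>, \<sigma>) \<in> \<Delta>" and PQC: "(P, Q, C) \<in> CS" and \<sigma>: "(\<phi>, \<sigma>) \<in> fms_over L P C" for \<phi> \<sigma> P Q C
    proof
      have inF: "p \<in> F \<and> p \<in> P" if x: "x \<in> fv \<phi>" "\<sigma> x = Inl p" for x p
      proof -
        have "Inl p \<in> \<sigma> ` fv \<phi>" using x by force
        moreover have "p \<in> P" using fms_overD[OF \<sigma> x(1)] x(2) by auto
        ultimately show ?thesis using P_sub[OF PQC] \<open>(\<phi>, \<sigma>) \<in> \<Delta>\<close> unfolding F_def by blast
      qed
      show "(\<phi>, \<lambda>x. map_sum g id (\<sigma> x)) \<in> fms_over L Q C"
      proof (rule fms_overI)
        fix x assume x: "x \<in> fv \<phi>"
        show "map_sum g id (\<sigma> x) \<in> Q <+> C"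
        proof (cases "\<sigma> x")
          case (Inl p)
          then have "g p \<in> Q" using inF[OF x] g(1,2)[of p] CS[OF PQC] by (cases "p \<in> ?Z") auto
          then show ?thesis using Inl by auto
        next
          case (Inr m)
          then show ?thesis using fms_overD[OF \<sigma> x] by auto
        qed
      qed (rule fms_over_wf[OF \<sigma>])
      show "similar le (fv \<phi>) \<sigma> (\<lambda>x. map_sum g id (\<sigma> x))"
        using g(3,4) inF by (intro similar_embedding[where F = F]) blast+
    qed
    then show ?thesis using g(2) by blast
  qed
  have "partial_type L U ?Z (D \<union> val ` W) \<Gamma>"
    unfolding partial_type_def
  proof (intro conjI allI impI)
    show "\<Gamma> \<subseteq> fms_over L ?Z (D \<union> val ` W)"
    proof
      fix \<theta> assume "\<theta> \<in> \<Gamma>"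
      then obtain \<phi> \<sigma> P Q C where \<theta>: "\<theta> = (\<phi>, \<lambda>x. plug (\<sigma> x))" and PQC: "(P, Q, C) \<in> CS"
        and \<sigma>: "(\<phi>, \<sigma>) \<in> fms_over L P C" unfolding \<Gamma>_def demands_def by auto
      have "plug (\<sigma> x) \<in> ?Z <+> (D \<union> val ` W)" if "x \<in> fv \<phi>" for x
        using fms_overD[OF \<sigma> that]
      proof
        fix p assume "p \<in> P" "\<sigma> x = Inl p"
        then show ?thesis using CS[OF PQC] by (auto simp: plug_def)
      next
        fix m assume "m \<in> C" "\<sigma> x = Inr m"
        then show ?thesis using CS[OF PQC] by (auto simp: plug_def)
      qed
      then show "\<theta> \<in> fms_over L ?Z (D \<union> val ` W)" unfolding \<theta> by (intro fms_overI fms_over_wf[OF \<sigma>])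
    qed
    fix \<Gamma>0 assume "finite \<Gamma>0 \<and> \<Gamma>0 \<subseteq> \<Gamma>"
    then obtain \<Delta> where \<Delta>: "\<Delta> \<subseteq> demands" "finite \<Delta>" "\<Gamma>0 = (\<lambda>(\<phi>, \<sigma>). (\<phi>, \<lambda>x. plug (\<sigma> x))) ` \<Delta>"
      unfolding \<Gamma>_def by (metis (no_types, lifting) finite_subset_image)
    obtain g where g: "\<And>\<phi> \<sigma> P Q C. (\<phi>, \<sigma>) \<in> \<Delta> \<Longrightarrow> (P, Q, C) \<in> CS \<Longrightarrow> (\<phi>, \<sigma>) \<in> fms_over L P C \<Longrightarrow>
      (\<phi>, \<lambda>x. map_sum g id (\<sigma> x)) \<in> fms_over L Q C \<and> similar le (fv \<phi>) \<sigma> (\<lambda>x. map_sum g id (\<sigma> x))"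
      and g_id: "\<And>p. p \<notin> ?Z \<Longrightarrow> g p = p"
      using embedding[OF \<Delta>(2)] by metis
    obtain u0 where u0: "u0 \<in> univ U" using nonempty by blast
    \<comment> \<open>New slots that do not occur in the finite part need not be sent to old slots,
      so their value is replaced by \<open>u0\<close> if it lies outside the universe.\<close>
    define d where "d p = (if val (g p) \<in> univ U then val (g p) else u0)" for p
    have "psat U d (\<phi>, \<lambda>x. plug (\<sigma> x))" if "(\<phi>, \<sigma>) \<in> \<Delta>" for \<phi> \<sigma>
    proof -
      obtain P Q C \<tau> where PQC: "(P, Q, C) \<in> CS" and \<sigma>: "(\<phi>, \<sigma>) \<in> fms_over L P C"
        and \<tau>: "(\<phi>, \<tau>) \<in> fms_over L Q C" "similar le (fv \<phi>) \<sigma> \<tau>" "psat U val (\<phi>, \<tau>)"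
        using \<open>(\<phi>, \<sigma>) \<in> \<Delta>\<close> \<Delta>(1) unfolding demands_def by blast
      note g = g[OF \<open>(\<phi>, \<sigma>) \<in> \<Delta>\<close> PQC \<sigma>]
      have "psat U val (\<phi>, \<lambda>x. map_sum g id (\<sigma> x)) \<longleftrightarrow> psat U val (\<phi>, \<tau>)"
        using array_indiscernibleD[OF conjunct1[OF CS[OF PQC]] conjunct1[OF g] \<tau>(1)]
          similar_trans[OF similar_sym[OF conjunct2[OF g]] \<tau>(2)] by blast
      moreover have "psat U d (\<phi>, \<lambda>x. plug (\<sigma> x)) \<longleftrightarrow> psat U val (\<phi>, \<lambda>x. map_sum g id (\<sigma> x))"
      proof (rule psat_cong)
        fix x assume x: "x \<in> fv \<phi>"
        show "case_sum d id (plug (\<sigma> x)) = case_sum val id (map_sum g id (\<sigma> x))"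
        proof (cases "\<sigma> x")
          case (Inl p)
          show ?thesis
          proof (cases "p \<in> ?Z")
            case True
            have "Inl (g p) \<in> Q <+> C" using fms_overD[OF conjunct1[OF g] x] Inl by simp
            then have "val (g p) \<in> univ U" using CS[OF PQC] val_univ by auto
            then show ?thesis using True Inl by (simp add: plug_def d_def)
          next
            case False
            then show ?thesis using Inl g_id by (auto simp: plug_def)
          qed
        qed (simp add: plug_def)
      qed
      ultimately show ?thesis using \<tau>(3) by blast
    qed
    then have "realizes U ?Z d \<Gamma>0" using u0 unfolding realizes_def \<Delta>(3) by (auto simp: d_def)
    then show "\<exists>d. realizes U ?Z d \<Gamma>0" by blast
  qed
  moreover have "D \<union> val ` W \<subseteq> univ U" using base(2) W(1) val_univ by blast
  moreover have "|D \<union> val ` W| <o \<mu>" using small_Un small_image base(3) W(2) by blast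
  moreover have "|?Z| <o \<mu>" using small_inner_slots K'(2) V0(1) by blast
  ultimately obtain d where d: "realizes U ?Z d \<Gamma>" using realize_small_type by blast
  define e where "e p = (if p \<in> ?Z then d p else val p)" for p
  have demanded: "psat U e (\<phi>, \<sigma>)" if "(\<phi>, \<sigma>) \<in> demands" for \<phi> \<sigma>
  proof -
    have "(\<phi>, \<lambda>x. plug (\<sigma> x)) \<in> \<Gamma>" using that unfolding \<Gamma>_def by force
    then have "psat U d (\<phi>, \<lambda>x. plug (\<sigma> x))" using d by (auto simp: realizes_def)
    moreover have "psat U d (\<phi>, \<lambda>x. plug (\<sigma> x)) \<longleftrightarrow> psat U e (\<phi>, \<sigma>)"
      by (rule psat_cong) (auto simp: plug_def e_def split: sum.splits)
    ultimately show ?thesis by blast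
  qed
  have agree: "psat U e (\<phi>, \<sigma>) \<longleftrightarrow> psat U val (\<phi>, \<tau>)"
    if PQC: "(P, Q, C) \<in> CS" and \<sigma>: "(\<phi>, \<sigma>) \<in> fms_over L P C" and \<tau>: "(\<phi>, \<tau>) \<in> fms_over L Q C"
      and sim: "similar le (fv \<phi>) \<sigma> \<tau>" for P Q C \<phi> \<sigma> \<tau>
  proof (cases "psat U val (\<phi>, \<tau>)")
    case True
    then have "(\<phi>, \<sigma>) \<in> demands" unfolding demands_def using PQC \<sigma> \<tau> sim by blast
    then show ?thesis using demanded True by blast
  next
    case False
    \<comment> \<open>A false instance demands the negated formula, so the one-sided demands give an
      equivalence.\<close>
    then have "psat U val (Neg \<phi>, \<tau>)" by (simp add: psat_Neg)
    moreover have "(Neg \<phi>, \<sigma>) \<in> fms_over L P C" "(Neg \<phi>, \<tau>) \<in> fms_over L Q C" "similar le (fv (Neg \<phi>)) \<sigma> \<tau>"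
      using \<sigma> \<tau> sim by (simp_all add: fms_over_Neg)
    ultimately have "(Neg \<phi>, \<sigma>) \<in> demands" unfolding demands_def using PQC by blast
    then show ?thesis using demanded[of "Neg \<phi>" \<sigma>] False by (simp add: psat_Neg)
  qed
  have "array_indiscernible L U le P e C" if PQC: "(P, Q, C) \<in> CS" for P Q C
    unfolding array_indiscernible_def
  proof (intro allI impI, elim conjE)
    fix \<phi> \<sigma> \<sigma>'
    assume \<sigma>: "(\<phi>, \<sigma>) \<in> fms_over L P C" and \<sigma>': "(\<phi>, \<sigma>') \<in> fms_over L P C"
      and sim: "similar le (fv \<phi>) \<sigma> \<sigma>'"
    \<comment> \<open>Both substitutions are similar to the same embedded copy among the old slots,
      so both have its truth value in the old array.\<close>
    obtain g where g: "(\<phi>, \<lambda>x. map_sum g id (\<sigma> x)) \<in> fms_over L Q C"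
      "similar le (fv \<phi>) \<sigma> (\<lambda>x. map_sum g id (\<sigma> x))"
      using embedding[of "{(\<phi>, \<sigma>)}"] PQC \<sigma> by blast
    show "psat U e (\<phi>, \<sigma>) \<longleftrightarrow> psat U e (\<phi>, \<sigma>')"
      using agree[OF PQC \<sigma> g] agree[OF PQC \<sigma>' g(1) similar_trans[OF similar_sym[OF sim] g(2)]] by blast
  qed
  moreover have "e ` ?Z \<subseteq> univ U" using d by (auto simp: realizes_def e_def)
  ultimately show thesis using that[of e] agree by (auto simp: e_def)
qed

end

section \<open>Absorbing parameters into the sequences\<close>

text \<open>The rank requires sequences indexed inside the type \<open>'m\<close>, so the order of
  the integers is copied along an injection.\<close>

definition integer_order :: "(int \<Rightarrow> 'm) \<Rightarrow> 'm rel" where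
  "integer_order \<iota> = {(\<iota> x, \<iota> y) | x y. x \<le> y}"

lemma Field_integer_order: "Field (integer_order \<iota>) = range \<iota>"
  by (auto simp: integer_order_def Field_def)

lemma in_integer_order: "inj \<iota> \<Longrightarrow> (\<iota> x, \<iota> y) \<in> integer_order \<iota> \<longleftrightarrow> x \<le> y"
  by (auto simp: integer_order_def inj_eq)

lemma Linear_integer_order: "inj \<iota> \<Longrightarrow> Linear_order (integer_order \<iota>)"
  unfolding order_on_defs refl_on_def trans_def antisym_def total_on_def Field_integer_order
  by (auto simp: in_integer_order integer_order_def inj_eq)

lemma endless_integer_order:
  assumes "inj \<iota>"
  shows "without_endpoints (integer_order \<iota>, h)"
proof -
  have "\<iota> (z - 1) \<noteq> \<iota> z \<and> (\<iota> (z - 1), \<iota> z) \<in> integer_order \<iota>"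
    "\<iota> (z + 1) \<noteq> \<iota> z \<and> (\<iota> z, \<iota> (z + 1)) \<in> integer_order \<iota>" for z
    using assms by (auto simp: in_integer_order inj_eq)
  then show ?thesis unfolding without_endpoints_def fst_conv Field_integer_order by blast
qed

context pattern
begin

text \<open>
  The distinguishing formula of \<open>i\<close> uses, besides the central member \<open>c i\<close>, finitely many slots of
  other members. Once the array is stretched, these lie outside the new sequences and may be added
  to each of their members as constant coordinates; the coordinates of the resulting tuples are
  the free variables of the formula.
\<close>

theorem absorbed_pattern:
  assumes S: "S \<subseteq> K" and K': "K' \<subseteq> K - S" "|K'| <o \<mu>"
    and ind: "array_indiscernible L U le (outer \<union> mid_slots S V) val D"
    and fail: "\<forall>i\<in>K'. \<not> array_indiscernible L U le (outer \<union> mid_slots S V \<union> mid_slots {i} V) val D"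
  shows "\<exists>(V' :: 'i \<Rightarrow> 'm set) (I' :: 'i \<Rightarrow> ('m, 'm, 'm) tseq) (J' :: 'i \<Rightarrow> ('m, 'm, 'm) tseq) (c' :: 'i \<Rightarrow> 'm \<Rightarrow> 'm).
    (\<forall>i\<in>K'. |V' i| <o \<mu> \<and>
       is_tseq U (V' i) (I' i) \<and> |Field (fst (I' i))| <o \<mu> \<and> without_endpoints (I' i) \<and>
       is_tseq U (V' i) (J' i) \<and> |Field (fst (J' i))| <o \<mu> \<and> without_endpoints (J' i) \<and>
       c' i ` V' i \<subseteq> univ U) \<and>
    mutually_indiscernible L U K' V' (\<lambda>i. concat_tseq (I' i) (J' i)) D \<and>
    mutually_indiscernible L U K' V' (\<lambda>i. insert_tseq (I' i) (c' i) (J' i)) A \<and>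
    (\<forall>i\<in>K'. \<not> indiscernible L U (V' i) (insert_tseq (I' i) (c' i) (J' i)) D)"
proof (cases "K' = {}")
  case True
  then show ?thesis by (auto simp: mutually_indiscernible_def)
next
  case False
  then obtain i0 where i0: "i0 \<in> K'" by blast
  \<comment> \<open>Positions and coordinates of the new sequences must be coded in
    \<open>'m\<close>. One old sequence without endpoints guarantees that \<open>'m\<close> is
    infinite; this is why the case of an empty \<open>K'\<close> is separated.\<close>
  have "infinite (Field (fst (I i0)))"
  proof
    assume "finite (Field (fst (I i0)))"
    moreover have "i0 \<in> K" using i0 K' by blast
    ultimately show False
      using ex_upper[OF lin(1), of i0 "Field (fst (I i0))"] endless(1)[of i0]
      unfolding without_endpoints_def by blast
  qed
  then have "infinite (UNIV :: 'm set)" using finite_subset subset_UNIV by blast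
  then obtain \<iota>0 :: "nat \<Rightarrow> 'm" where "inj \<iota>0" using infinite_countable_subset by blast
  then have "inj (\<lambda>z. \<iota>0 (int_encode z))" using inj_int_encode[of UNIV] by (auto simp: inj_on_def)
  then obtain \<iota> :: "int \<Rightarrow> 'm" where \<iota>: "inj \<iota>" by blast
  let ?PS = "outer \<union> mid_slots S V"
  let ?re = "\<lambda>i p \<sigma> x. map_sum (recenter i p) id (\<sigma> x)"
  have "\<forall>i\<in>K'. \<exists>\<phi> \<sigma> t. (\<phi>, \<sigma>) \<in> fms_over L (?PS \<union> mid_slots {i} V) D \<and> t \<in> Field (fst (I i)) \<and>
    (\<phi>, ?re i (OL t) \<sigma>) \<in> fms_over L ?PS D \<and> similar le (fv \<phi>) \<sigma> (?re i (OL t) \<sigma>) \<and>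
    (psat U val (\<phi>, \<sigma>) \<longleftrightarrow> \<not> psat U val (\<phi>, ?re i (OL t) \<sigma>))" (is "\<forall>i\<in>K'. ?Q i")
  proof
    fix i assume i: "i \<in> K'"
    then have "i \<in> K" "i \<notin> S" using K' by auto
    then show "?Q i"
      by (intro central_failure[where K = K and S = S] lin endless ind bspec[OF fail i]) auto
  qed
  then obtain \<Phi> \<Sigma> t where
    over: "\<And>i. i \<in> K' \<Longrightarrow> (\<Phi> i, \<Sigma> i) \<in> fms_over L (?PS \<union> mid_slots {i} V) D"
    and re_over: "\<And>i. i \<in> K' \<Longrightarrow> (\<Phi> i, ?re i (OL (t i)) (\<Sigma> i)) \<in> fms_over L ?PS D"
    and sim: "\<And>i. i \<in> K' \<Longrightarrow> similar le (fv (\<Phi> i)) (\<Sigma> i) (?re i (OL (t i)) (\<Sigma> i))"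
    and differ: "\<And>i. i \<in> K' \<Longrightarrow> psat U val (\<Phi> i, \<Sigma> i) \<longleftrightarrow> \<not> psat U val (\<Phi> i, ?re i (OL (t i)) (\<Sigma> i))"
    by metis
  define Wi where "Wi i = {p. Inl p \<in> \<Sigma> i ` fv (\<Phi> i)}" for i
  define W where "W = (\<Union>i\<in>K'. Wi i)"
  \<comment> \<open>Just the central coordinates that occur in the formula have to be stretched.
    There are finitely many for each \<open>i\<close>, which keeps the number of new variables below
    \<open>\<mu>\<close>.\<close>
  define V0 where "V0 i = {v. (i, Mid, v) \<in> Wi i}" for i
  have Wi: "Wi i \<subseteq> ?PS \<union> mid_slots {i} V" if "i \<in> K'" for i
    using over[OF that] unfolding Wi_def fms_over_def by auto
  have W_sub: "W \<subseteq> outer \<union> mid_slots K V"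
    using Wi K'(1) S unfolding W_def mid_slots_def by blast
  have "|W| <o \<mu>"
    unfolding W_def Wi_def by (rule small_UN_countable[OF K'(2)]) (rule finite_le_nat[OF finite_slots])
  have V0: "finite (V0 i)" "V0 i \<subseteq> V i" if "i \<in> K'" for i
  proof -
    have "V0 i \<subseteq> (\<lambda>(i, p, v). v) ` Wi i" by (force simp: V0_def)
    then show "finite (V0 i)" using finite_slots finite_subset unfolding Wi_def by blast
    show "V0 i \<subseteq> V i" using Wi[OF that] K'(1) that by (auto simp: V0_def outer_slots_def mid_slots_def)
  qed
  let ?inner = "inner_slots K' V0 :: ('i \<times> 'm pos \<times> 'm) set"
  let ?P1 = "W \<inter> ?PS \<union> ?inner" and ?P2 = "W \<union> ?inner"
  \<comment> \<open>The first demand will give indiscernibility of the new sequences over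
    \<open>D\<close> without their centres, where the centres in \<open>S\<close> may occur as
    constants; the second gives indiscernibility over \<open>A\<close> with all centres.\<close>
  define CS where "CS = {(?P1, ?PS, D), (?P2, outer \<union> mid_slots K V, A)}"
  have K'K: "K' \<subseteq> K" using K' by blast
  have midS: "mid_slots S V \<subseteq> (mid_slots K V :: ('i \<times> 'm pos \<times> 'm) set)" using S by (auto simp: mid_slots_def)
  obtain e where e: "\<And>p. p \<notin> ?inner \<Longrightarrow> e p = val p" "e ` ?inner \<subseteq> univ U"
    "\<And>P Q C. (P, Q, C) \<in> CS \<Longrightarrow> array_indiscernible L U le P e C"
    "\<And>P Q C \<phi> \<sigma> \<tau>. (P, Q, C) \<in> CS \<Longrightarrow> (\<phi>, \<sigma>) \<in> fms_over L P C \<Longrightarrow> (\<phi>, \<tau>) \<in> fms_over L Q C \<Longrightarrow>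
       similar le (fv \<phi>) \<sigma> \<tau> \<Longrightarrow> psat U e (\<phi>, \<sigma>) \<longleftrightarrow> psat U val (\<phi>, \<tau>)"
  proof (rule stretch[OF K'K K'(2) V0 W_sub \<open>|W| <o \<mu>\<close>, of CS])
    fix P Q C assume "(P, Q, C) \<in> CS"
    then consider "P = ?P1" "Q = ?PS" "C = D" | "P = ?P2" "Q = outer \<union> mid_slots K V" "C = A"
      unfolding CS_def by blast
    then show "array_indiscernible L U le Q val C \<and> outer \<subseteq> Q \<and> Q \<subseteq> outer \<union> mid_slots K V \<and> C \<subseteq> D \<and>
      P \<subseteq> W \<inter> Q \<union> ?inner"
    proof cases
      case 1
      then show ?thesis using ind midS by blast
    next
      case 2
      then show ?thesis using full_ind base(1) W_sub by blast
    qed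
  next
    fix e assume "\<And>p. p \<notin> ?inner \<Longrightarrow> e p = val p" "e ` ?inner \<subseteq> univ U"
      "\<And>P Q C. (P, Q, C) \<in> CS \<Longrightarrow> array_indiscernible L U le P e C"
      "\<And>P Q C \<phi> \<sigma> \<tau>. (P, Q, C) \<in> CS \<Longrightarrow> (\<phi>, \<sigma>) \<in> fms_over L P C \<Longrightarrow> (\<phi>, \<tau>) \<in> fms_over L Q C \<Longrightarrow>
         similar le (fv \<phi>) \<sigma> \<tau> \<Longrightarrow> psat U e (\<phi>, \<sigma>) \<longleftrightarrow> psat U val (\<phi>, \<tau>)"
    then show thesis by (rule that)
  qed
  have ind1: "array_indiscernible L U le ?P1 e D" and ind2: "array_indiscernible L U le ?P2 e A"
    using e(3)[of ?P1 ?PS D] e(3)[of ?P2 "outer \<union> mid_slots K V" A] unfolding CS_def by blast+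
  define N where "N i = {x \<in> fv (\<Phi> i). \<exists>p. \<Sigma> i x = Inl p}" for i
  define slot where "slot i x = projl (\<Sigma> i x)" for i x
  have slot: "\<Sigma> i x = Inl (slot i x)" "slot i x \<in> Wi i" if "x \<in> N i" for i x
    using that by (force simp: N_def slot_def Wi_def)+
  define \<nu> where "\<nu> x = \<iota> (int x)" for x
  define un\<nu> where "un\<nu> m = nat (inv \<iota> m)" for m
  have un\<nu>: "un\<nu> (\<nu> x) = x" for x by (simp add: un\<nu>_def \<nu>_def inv_f_f[OF \<iota>])
  define conv :: "'m pos \<Rightarrow> 'm pos" where "conv p = (case p of OL m \<Rightarrow> IL (inv \<iota> m) | OR m \<Rightarrow> IR (inv \<iota> m) | _ \<Rightarrow> Mid)" for p
  have conv: "conv (OL (\<iota> z)) = IL z" "conv (OR (\<iota> z)) = IR z" "conv Mid = Mid" for z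
    by (simp_all add: conv_def inv_f_f[OF \<iota>])
  \<comment> \<open>The coordinate for \<open>x\<close> at position \<open>p\<close> reads the slot
    that \<open>x\<close> stands for, with the centre of \<open>i\<close> moved to \<open>p\<close>.
    If that slot is not the centre of \<open>i\<close>, the coordinate does not depend on
    \<open>p\<close>.\<close>
  define G where "G = (\<lambda>(i, p, y). recenter i (conv p) (slot i (un\<nu> y)))"
  define V' where "V' i = \<nu> ` N i" for i
  define I' where "I' i = (integer_order \<iota>, \<lambda>m y. e (G (i, OL m, y)))" for i
  define J' where "J' i = (integer_order \<iota>, \<lambda>m y. e (G (i, OR m, y)))" for i
  define c' where "c' i y = e (G (i, Mid, y))" for i y
  have val': "array_val I' c' J' p = e (G p)" for p
    by (cases p) (auto simp: array_val_def I'_def J'_def c'_def G_def conv_def split: pos.splits)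
  have G_new: "G (i, p, \<nu> x) = recenter i (conv p) (slot i x)" for i p x by (simp add: G_def un\<nu>)
  \<comment> \<open>A constant slot in a sequence from \<open>K'\<close> lies at an old left or
    right position, since a central constant comes from \<open>S\<close>, which is disjoint from
    \<open>K'\<close>. A constant at the centre of such a sequence would be harmful: it would
    separate the new left positions from the new right ones.\<close>
  have slot_cases: "(\<exists>v. slot i x = (i, Mid, v) \<and> v \<in> V0 i) \<or>
      (slot i x \<in> W \<inter> ?PS \<and> (\<forall>p. recenter i p (slot i x) = slot i x) \<and>
        (\<forall>k\<in>K'. \<forall>p v. slot i x = (k, p, v) \<longrightarrow> p \<in> range OL \<union> range OR))"
    if "i \<in> K'" "x \<in> N i" for i x
  proof -
    obtain k p v where kpv: "slot i x = (k, p, v)" by (cases "slot i x") auto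
    have *: "(k, p, v) \<in> Wi i" using slot(2)[OF that(2)] kpv by simp
    then have **: "(k, p, v) \<in> W" "(k, p, v) \<in> ?PS \<union> mid_slots {i} V"
      using Wi[OF that(1)] that(1) by (auto simp: W_def)
    show ?thesis
    proof (cases "k = i \<and> p = Mid")
      case True
      then show ?thesis using kpv * by (auto simp: V0_def)
    next
      case False
      then have "(k, p, v) \<in> ?PS" using ** by (auto simp: mid_slots_def)
      moreover have "p \<in> range OL \<union> range OR" if "k \<in> K'"
        using that \<open>(k, p, v) \<in> ?PS\<close> K'(1) by (auto simp: outer_slots_def mid_slots_def)
      moreover have "recenter i q (k, p, v) = (k, p, v)" for q using False by (auto simp: recenter_def)
      ultimately show ?thesis using kpv **(1) by auto
    qed
  qed
  have lin': "Linear_order (fst (I' i))" "Linear_order (fst (J' i))" for i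
    by (simp_all add: I'_def J'_def Linear_integer_order[OF \<iota>])
  let ?outer' = "outer_slots K' V' I' J'" and ?mid' = "mid_slots K' V' :: ('i \<times> 'm pos \<times> 'm) set"
  have new_slot: "\<exists>i q x. p = (i, q, \<nu> x) \<and> i \<in> K' \<and> x \<in> N i \<and> q \<in> OL ` range \<iota> \<union> OR ` range \<iota> \<union> {Mid}"
    if "p \<in> ?outer' \<union> ?mid'" for p
    using that by (auto simp: outer_slots_def mid_slots_def V'_def I'_def J'_def Field_integer_order)
  have outer_new: "q \<noteq> Mid" if "(i, q, y) \<in> ?outer'" for i q y
    using that by (auto simp: outer_slots_def)
  have G_outer: "G p \<in> ?P1" if p: "p \<in> ?outer'" for p
  proof -
    obtain i q x where iqx: "p = (i, q, \<nu> x)" "i \<in> K'" "x \<in> N i" "q \<in> OL ` range \<iota> \<union> OR ` range \<iota>"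
      using new_slot[of p] p outer_new by blast
    have "conv q \<in> range IL \<union> range IR" using iqx(4) conv by auto
    then show ?thesis using slot_cases[OF iqx(2,3)] iqx(2) unfolding iqx(1) G_new
      by (auto simp: recenter_def inner_slots_def)
  qed
  have G_all: "G p \<in> ?P2" if p: "p \<in> ?outer' \<union> ?mid'" for p
  proof (cases "p \<in> ?outer'")
    case True
    then show ?thesis using G_outer by blast
  next
    case False
    then have "p \<in> ?mid'" using p by blast
    then obtain i x where iqx: "p = (i, Mid, \<nu> x)" "i \<in> K'" "x \<in> N i" by (auto simp: mid_slots_def V'_def)
    have "slot i x \<in> W" using slot(2)[OF iqx(3)] iqx(2) by (auto simp: W_def)
    moreover have "recenter i Mid p = p" for p :: "'i \<times> 'm pos \<times> 'm" by (auto simp: recenter_def split: prod.splits)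
    ultimately show ?thesis unfolding iqx(1) G_new conv by simp
  qed
  have G_kind: "slot_kind (G p) = slot_kind (G q)" if "slot_kind p = slot_kind q" for p q
    using that by (auto simp: G_def slot_kind_def recenter_def split: prod.splits)
  have conv_le: "le i (conv p) (conv q) \<longleftrightarrow> array_le I' J' i p q"
    if "p \<in> OL ` range \<iota> \<union> OR ` range \<iota> \<union> {Mid}" "q \<in> OL ` range \<iota> \<union> OR ` range \<iota> \<union> {Mid}" for i p q
    using that by (auto simp: array_le_def conv I'_def J'_def in_integer_order[OF \<iota>])
  \<comment> \<open>An old position compares in the same way with all new positions and the centre.
    Hence a comparison with a constant slot does not change when the other slot moves.\<close>
  have conv_outer: "le i (conv p) q \<longleftrightarrow> le i (conv p') q" "le i q (conv p) \<longleftrightarrow> le i q (conv p')"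
    if "q \<in> range OL \<union> range OR" for i p p' q
    using that by (auto simp: array_le_def conv_def split: pos.splits)
  have G_le: "slot_le le (G p) (G q) \<longleftrightarrow> slot_le le (G p') (G q')"
    if in_P: "{p, q, p', q'} \<subseteq> ?outer' \<union> ?mid'" and kinds: "slot_kind p = slot_kind p'" "slot_kind q = slot_kind q'"
      and le: "slot_le (array_le I' J') p q \<longleftrightarrow> slot_le (array_le I' J') p' q'" for p q p' q'
  proof -
    let ?new = "OL ` range \<iota> \<union> OR ` range \<iota> \<union> {Mid}"
    obtain i a x where p: "p = (i, a, \<nu> x)" "i \<in> K'" "x \<in> N i" "a \<in> ?new" using new_slot[of p] in_P by auto
    obtain j b y where q: "q = (j, b, \<nu> y)" "j \<in> K'" "y \<in> N j" "b \<in> ?new" using new_slot[of q] in_P by auto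
    obtain a' where p': "p' = (i, a', \<nu> x)" "a' \<in> ?new"
      using new_slot[of p'] in_P kinds(1) p(1) by (auto simp: slot_kind_def)
    obtain b' where q': "q' = (j, b', \<nu> y)" "b' \<in> ?new"
      using new_slot[of q'] in_P kinds(2) q(1) by (auto simp: slot_kind_def)
    obtain k s v where kv: "slot i x = (k, s, v)" by (cases "slot i x") auto
    obtain l u w where lw: "slot j y = (l, u, w)" by (cases "slot j y") auto
    have rec: "recenter i r (i, Mid, v) = (i, r, v)" for i and r :: "'m pos" and v :: 'm
      by (simp add: recenter_def)
    from slot_cases[OF p(2,3)] slot_cases[OF q(2,3)] show ?thesis
    proof (elim disjE exE conjE)
      fix v w assume "slot i x = (i, Mid, v)" "slot j y = (j, Mid, w)"
      then show ?thesis using le conv_le p(4) q(4) p'(2) q'(2) unfolding p(1) q(1) p'(1) q'(1) G_new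
        by (auto simp: rec slot_le_def)
    next
      fix v assume 1: "slot i x = (i, Mid, v)" and 2: "\<forall>p. recenter j p (slot j y) = slot j y"
        "\<forall>k\<in>K'. \<forall>p v. slot j y = (k, p, v) \<longrightarrow> p \<in> range OL \<union> range OR"
      have "u \<in> range OL \<union> range OR" if "l = i" using 2(2) lw that p(2) by blast
      moreover have "recenter j r (l, u, w) = (l, u, w)" for r using 2(1) unfolding lw by blast
      ultimately show ?thesis using conv_outer(1)[of u i a a'] unfolding p(1) q(1) p'(1) q'(1) G_new 1 rec lw
        by (auto simp: slot_le_def)
    next
      fix w assume 1: "slot j y = (j, Mid, w)" and 2: "\<forall>p. recenter i p (slot i x) = slot i x"
        "\<forall>k\<in>K'. \<forall>p v. slot i x = (k, p, v) \<longrightarrow> p \<in> range OL \<union> range OR"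
      have "s \<in> range OL \<union> range OR" if "k = j" using 2(2) kv that q(2) by blast
      moreover have "recenter i r (k, s, v) = (k, s, v)" for r using 2(1) unfolding kv by blast
      ultimately show ?thesis using conv_outer(2)[of s j b b'] unfolding p(1) q(1) p'(1) q'(1) G_new 1 rec kv
        by (auto simp: slot_le_def)
    next
      assume "\<forall>p. recenter i p (slot i x) = slot i x" "\<forall>p. recenter j p (slot j y) = slot j y"
      then show ?thesis unfolding p(1) q(1) p'(1) q'(1) G_new by simp
    qed
  qed
  have array1: "array_indiscernible L U (array_le I' J') ?outer' (array_val I' c' J') D"
    by (rule array_indiscernible_transfer[OF ind1, where G = G])
      (use G_outer in blast, simp add: val', rule G_kind, assumption, rule G_le, auto)
  have array2: "array_indiscernible L U (array_le I' J') (?outer' \<union> ?mid') (array_val I' c' J') A"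
    by (rule array_indiscernible_transfer[OF ind2, where G = G])
      (use G_all in blast, simp add: val', rule G_kind, assumption, rule G_le, auto)
  have not: "\<not> array_indiscernible L U (array_le I' J') (outer_slots {i} V' I' J' \<union> mid_slots {i} V') (array_val I' c' J') D"
    if i: "i \<in> K'" for i
  proof
    assume ind': "array_indiscernible L U (array_le I' J') (outer_slots {i} V' I' J' \<union> mid_slots {i} V') (array_val I' c' J') D"
    \<comment> \<open>All slots of the distinguishing formula become coordinates of one member, at
      position \<open>p\<close>. Exchanging the centre for a single member of the new sequence
      therefore tests the whole formula, with parameters from \<open>D\<close> only.\<close>
    define \<sigma> where "\<sigma> p x = (case \<Sigma> i x of Inl _ \<Rightarrow> Inl (i, p, \<nu> x) | Inr m \<Rightarrow> Inr m)" for p :: "'m pos" and x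
    have var_cases: "(x \<in> N i \<and> \<Sigma> i x = Inl (slot i x)) \<or> (\<exists>m\<in>D. \<Sigma> i x = Inr m)" if "x \<in> fv (\<Phi> i)" for x
    proof (cases "\<Sigma> i x")
      case (Inl p)
      then have "x \<in> N i" using that unfolding N_def by blast
      then show ?thesis using slot(1) by blast
    next
      case (Inr m)
      then show ?thesis using fms_overD[OF over[OF i] that] by auto
    qed
    have \<sigma>_over: "(\<Phi> i, \<sigma> p) \<in> fms_over L (outer_slots {i} V' I' J' \<union> mid_slots {i} V') D"
      if "p \<in> {Mid, OL (\<iota> 0)}" for p
    proof (rule fms_overI)
      fix x assume "x \<in> fv (\<Phi> i)"
      from var_cases[OF this] that show "\<sigma> p x \<in> (outer_slots {i} V' I' J' \<union> mid_slots {i} V') <+> D"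
        by (auto simp: \<sigma>_def outer_slots_def mid_slots_def V'_def I'_def Field_integer_order)
    qed (rule fms_over_wf[OF over[OF i]])
    \<comment> \<open>On either side all slots share one position, so every comparison is true. The
      integer 0 is an arbitrary choice of a new left position.\<close>
    have "similar (array_le I' J') (fv (\<Phi> i)) (\<sigma> Mid) (\<sigma> (OL (\<iota> 0)))"
      by (rule similarI)
        (auto simp: \<sigma>_def slot_kind_def slot_le_def array_le_def I'_def in_integer_order[OF \<iota>] split: sum.splits)
    then have "psat U (array_val I' c' J') (\<Phi> i, \<sigma> Mid) \<longleftrightarrow> psat U (array_val I' c' J') (\<Phi> i, \<sigma> (OL (\<iota> 0)))"
      by (intro array_indiscernibleD[OF ind'] \<sigma>_over) auto
    moreover have push: "psat U (array_val I' c' J') (\<Phi> i, \<sigma> p) \<longleftrightarrow> psat U e (\<Phi> i, ?re i (conv p) (\<Sigma> i))" for p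
    proof (rule psat_cong)
      fix x assume "x \<in> fv (\<Phi> i)"
      from var_cases[OF this]
      show "case_sum (array_val I' c' J') id (\<sigma> p x) = case_sum e id (?re i (conv p) (\<Sigma> i) x)"
        by (elim disjE bexE conjE) (simp_all add: \<sigma>_def val' G_new)
    qed
    moreover have "psat U e (\<Phi> i, ?re i Mid (\<Sigma> i)) \<longleftrightarrow> psat U val (\<Phi> i, \<Sigma> i)"
    proof (rule psat_cong)
      fix x assume x: "x \<in> fv (\<Phi> i)"
      have "recenter i Mid (slot i x) = slot i x" by (auto simp: recenter_def split: prod.splits)
      moreover have "slot i x \<notin> ?inner" if "x \<in> N i"
        using slot(2)[OF that] Wi[OF i] by (auto simp: inner_slots_def outer_slots_def mid_slots_def)
      ultimately show "case_sum e id (?re i Mid (\<Sigma> i) x) = case_sum val id (\<Sigma> i x)"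
        using var_cases[OF x] e(1)[of "slot i x"] by auto
    qed
    \<comment> \<open>The new position \<open>IL 0\<close> and the old position
      \<open>OL (t i)\<close> both compare with the slots of the formula as the centre does. The
      stretched array therefore inherits at \<open>IL 0\<close> the truth value that differs from
      the one at the centre.\<close>
    moreover have "psat U e (\<Phi> i, ?re i (IL 0) (\<Sigma> i)) \<longleftrightarrow> psat U val (\<Phi> i, ?re i (OL (t i)) (\<Sigma> i))"
    proof (rule e(4)[of ?P1 ?PS D])
      show "(?P1, ?PS, D) \<in> CS" by (simp add: CS_def)
      show "(\<Phi> i, ?re i (OL (t i)) (\<Sigma> i)) \<in> fms_over L ?PS D" by (rule re_over[OF i])
      show "(\<Phi> i, ?re i (IL 0) (\<Sigma> i)) \<in> fms_over L ?P1 D"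
      proof (rule fms_overI)
        fix x assume "x \<in> fv (\<Phi> i)"
        from var_cases[OF this] show "?re i (IL 0) (\<Sigma> i) x \<in> ?P1 <+> D"
        proof (elim disjE conjE bexE)
          assume x: "x \<in> N i" "\<Sigma> i x = Inl (slot i x)"
          have "recenter i (IL 0) (slot i x) \<in> ?P1"
            using slot_cases[OF i x(1)] i by (auto simp: recenter_def inner_slots_def)
          then show ?thesis using x(2) by auto
        qed auto
      qed (rule fms_over_wf[OF over[OF i]])
      have "similar le (fv (\<Phi> i)) (\<Sigma> i) (?re i (IL 0) (\<Sigma> i))"
      proof (rule similar_recenter)
        fix x q v assume x: "x \<in> fv (\<Phi> i)" "\<Sigma> i x = Inl (i, q, v)"
        then have "(i, q, v) \<in> ?PS \<union> mid_slots {i} V" using fms_overD[OF over[OF i] x(1)] by auto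
        then have "q \<in> range OL \<union> range OR \<union> {Mid}" by (auto simp: outer_slots_def mid_slots_def)
        then show "(le i Mid q \<longleftrightarrow> le i (IL 0) (if q = Mid then IL 0 else q)) \<and>
            (le i q Mid \<longleftrightarrow> le i (if q = Mid then IL 0 else q) (IL 0))"
          by (auto simp: array_le_def)
      qed
      then show "similar le (fv (\<Phi> i)) (?re i (IL 0) (\<Sigma> i)) (?re i (OL (t i)) (\<Sigma> i))"
        using similar_trans[OF similar_sym sim[OF i]] by blast
    qed
    ultimately show False
      using differ[OF i] push[of Mid, unfolded conv] push[of "OL (\<iota> 0)", unfolded conv] by blast
  qed
  have in_univ: "e (G p) \<in> univ U" if "p \<in> ?outer' \<union> ?mid'" for p
  proof (cases "G p \<in> ?inner")
    case True
    then show ?thesis using e(2) by blast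
  next
    case False
    then have "G p \<in> outer \<union> mid_slots K V" using G_all[OF that] W_sub by blast
    then show ?thesis using e(1)[OF False] val_univ by simp
  qed
  have finV': "finite (V' i)" for i using finite_fv[of "\<Phi> i"] by (simp add: V'_def N_def)
  have "|range \<iota>| <o \<mu>" using small_image small_countable int_le_nat by blast
  moreover have "is_tseq U (V' i) (I' i)" "is_tseq U (V' i) (J' i)" "c' i ` V' i \<subseteq> univ U" if i: "i \<in> K'" for i
  proof -
    have "(i, p, v) \<in> ?outer' \<union> ?mid'" if "v \<in> V' i" "p \<in> OL ` range \<iota> \<union> OR ` range \<iota> \<union> {Mid}" for p v
      using that i by (auto simp: outer_slots_def mid_slots_def I'_def J'_def Field_integer_order)
    then have "e (G (i, p, v)) \<in> univ U" if "v \<in> V' i" "p \<in> OL ` range \<iota> \<union> OR ` range \<iota> \<union> {Mid}" for p v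
      using that in_univ by blast
    then show "is_tseq U (V' i) (I' i)" "is_tseq U (V' i) (J' i)" "c' i ` V' i \<subseteq> univ U"
      using lin'[of i] by (auto simp: is_tseq_def I'_def J'_def c'_def Field_integer_order)
  qed
  ultimately have "\<forall>i\<in>K'. |V' i| <o \<mu> \<and>
       is_tseq U (V' i) (I' i) \<and> |Field (fst (I' i))| <o \<mu> \<and> without_endpoints (I' i) \<and>
       is_tseq U (V' i) (J' i) \<and> |Field (fst (J' i))| <o \<mu> \<and> without_endpoints (J' i) \<and>
       c' i ` V' i \<subseteq> univ U"
    using small_finite[OF finV']
    by (simp add: I'_def J'_def Field_integer_order endless_integer_order[OF \<iota>])
  moreover have "mutually_indiscernible L U K' V' (\<lambda>i. concat_tseq (I' i) (J' i)) D"
    using mutually_indiscernible_concat_iff[of K' I' J'] lin' array1 by blast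
  moreover have "mutually_indiscernible L U K' V' (\<lambda>i. insert_tseq (I' i) (c' i) (J' i)) A"
    using mutually_indiscernible_insert_iff[of K' I' J'] lin' array2 by blast
  moreover have "\<forall>i\<in>K'. \<not> indiscernible L U (V' i) (insert_tseq (I' i) (c' i) (J' i)) D"
    using indiscernible_insert_iff[of I' _ J'] lin' not by blast
  ultimately show ?thesis by blast
qed

end

section \<open>Subadditivity\<close>

text \<open>Zorn's lemma applies because indiscernibility has finite character: the two
  substitutions in an instance mention finitely many centres, all of which lie in one member of a
  chain.\<close>

lemma (in pattern) maximal_centre:
  obtains S where "S \<subseteq> K" "array_indiscernible L U le (outer \<union> mid_slots S V) val D"
    "\<And>i. i \<in> K - S \<Longrightarrow> \<not> array_indiscernible L U le (outer \<union> mid_slots S V \<union> mid_slots {i} V) val D"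
proof -
  define \<A> where "\<A> = {S. S \<subseteq> K \<and> array_indiscernible L U le (outer \<union> mid_slots S V) val D}"
  have "outer \<union> mid_slots {} V = outer" by (auto simp: mid_slots_def)
  then have "{} \<in> \<A>" using outer_ind by (simp add: \<A>_def)
  then have "\<A> \<noteq> {}" by blast
  moreover have "\<Union>\<C> \<in> \<A>" if ne: "\<C> \<noteq> {}" and chain: "subset.chain \<A> \<C>" for \<C>
  proof -
    have \<C>: "S \<in> \<C> \<Longrightarrow> S \<in> \<A>" for S using chain by (auto simp: subset.chain_def)
    have "array_indiscernible L U le (outer \<union> mid_slots (\<Union>\<C>) V) val D"
      unfolding array_indiscernible_def
    proof (intro allI impI, elim conjE)
      fix \<phi> \<sigma> \<tau>
      assume \<sigma>: "(\<phi>, \<sigma>) \<in> fms_over L (outer \<union> mid_slots (\<Union>\<C>) V) D"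
        and \<tau>: "(\<phi>, \<tau>) \<in> fms_over L (outer \<union> mid_slots (\<Union>\<C>) V) D"
        and sim: "similar le (fv \<phi>) \<sigma> \<tau>"
      define F where "F = fst ` ({p. Inl p \<in> \<sigma> ` fv \<phi>} \<union> {p. Inl p \<in> \<tau> ` fv \<phi>}) \<inter> \<Union>\<C>"
      have "finite F" unfolding F_def using finite_slots[of \<sigma> \<phi>] finite_slots[of \<tau> \<phi>] by simp
      moreover have "F \<subseteq> \<Union>\<C>" unfolding F_def by blast
      ultimately obtain S where S: "S \<in> \<C>" "F \<subseteq> S"
        by (rule finite_subset_Union_chain[OF _ _ ne chain])
      have inS: "(\<phi>, \<rho>) \<in> fms_over L (outer \<union> mid_slots S V) D"
        if \<rho>: "(\<phi>, \<rho>) \<in> fms_over L (outer \<union> mid_slots (\<Union>\<C>) V) D" "\<rho> = \<sigma> \<or> \<rho> = \<tau>" for \<rho>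
      proof (rule fms_overI)
        fix x assume x: "x \<in> fv \<phi>"
        from fms_overD[OF \<rho>(1) this] show "\<rho> x \<in> (outer \<union> mid_slots S V) <+> D"
        proof
          fix p assume p: "p \<in> outer \<union> mid_slots (\<Union>\<C>) V" "\<rho> x = Inl p"
          have "Inl p \<in> \<rho> ` fv \<phi>" using p(2) x by force
          then have "p \<in> {p. Inl p \<in> \<sigma> ` fv \<phi>} \<union> {p. Inl p \<in> \<tau> ` fv \<phi>}" using \<rho>(2) by blast
          then have "fst p \<in> S" if "fst p \<in> \<Union>\<C>" using that S(2) unfolding F_def by blast
          then have "p \<in> outer \<union> mid_slots S V" using p(1) unfolding mid_slots_def by force
          then show ?thesis using p(2) by auto
        qed auto
      qed (rule fms_over_wf[OF \<rho>(1)])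
      have "array_indiscernible L U le (outer \<union> mid_slots S V) val D" using \<C>[OF S(1)] by (simp add: \<A>_def)
      then show "psat U val (\<phi>, \<sigma>) \<longleftrightarrow> psat U val (\<phi>, \<tau>)"
        using array_indiscernibleD[OF _ inS[OF \<sigma>] inS[OF \<tau>] sim] by blast
    qed
    then show ?thesis using \<C> by (auto simp: \<A>_def)
  qed
  ultimately have "\<exists>S\<in>\<A>. \<forall>S'\<in>\<A>. S \<subseteq> S' \<longrightarrow> S' = S" by (rule subset_Zorn_nonempty)
  then obtain S where S: "S \<in> \<A>" "\<And>S'. S' \<in> \<A> \<Longrightarrow> S \<subseteq> S' \<Longrightarrow> S' = S" by blast
  show thesis
  proof
    show "S \<subseteq> K" "array_indiscernible L U le (outer \<union> mid_slots S V) val D" using S(1) by (auto simp: \<A>_def)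
    fix i assume i: "i \<in> K - S"
    have "outer \<union> mid_slots S V \<union> mid_slots {i} V = outer \<union> mid_slots (insert i S) V"
      by (auto simp: mid_slots_def)
    then show "\<not> array_indiscernible L U le (outer \<union> mid_slots S V \<union> mid_slots {i} V) val D"
      using S(1) S(2)[of "insert i S"] i unfolding \<A>_def by auto
  qed
qed

lemma mutually_indiscernible_reindex:
  assumes "inj_on f K" "mutually_indiscernible L M (f ` K) V I C"
  shows "mutually_indiscernible L M K (\<lambda>i. V (f i)) (\<lambda>i. I (f i)) C"
  unfolding mutually_indiscernible_def
proof
  fix i assume i: "i \<in> K"
  have "f ` K - {f i} = f ` (K - {i})" using assms(1) i by (auto simp: inj_on_def)
  then have "(\<Union>j\<in>f ` K - {f i}. tseq_elems (V j) (I j)) = (\<Union>j\<in>K - {i}. tseq_elems (V (f j)) (I (f j)))"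
    by simp
  then show "indiscernible L M (V (f i)) (I (f i)) (C \<union> (\<Union>j\<in>K - {i}. tseq_elems (V (f j)) (I (f j))))"
    using bspec[OF assms(2)[unfolded mutually_indiscernible_def] imageI[OF i]] by simp
qed

text \<open>In the finite case two strict inequalities cost one element each, while the index set
  lost just one. In the infinite case the removed point changes nothing, and an infinite set is not
  a union of two sets of smaller cardinality.\<close>

lemma card_pred_csum_split:
  assumes "S \<subseteq> Field (card_pred (\<kappa>1 +c \<kappa>2))"
  shows "|Field \<kappa>2| \<le>o |S| \<or> |Field \<kappa>1| \<le>o |Field (card_pred (\<kappa>1 +c \<kappa>2)) - S|"
proof (rule ccontr)
  define F where "F = Field (\<kappa>1 +c \<kappa>2)"
  define pt where "pt = (SOME x. x \<in> F)"
  define K where "K = F - {pt}"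
  have K: "Field (card_pred (\<kappa>1 +c \<kappa>2)) = K"
    by (simp add: card_pred_def Field_card_of K_def F_def pt_def)
  have F: "F = Field \<kappa>1 <+> Field \<kappa>2" by (simp add: F_def Field_csum Plus_def)
  assume "\<not> ?thesis"
  then have less: "|S| <o |Field \<kappa>2|" "|K - S| <o |Field \<kappa>1|"
    by (simp_all add: K not_ordLeq_iff_ordLess[OF card_of_Well_order card_of_Well_order])
  have SK: "S \<subseteq> K" using assms K by simp
  show False
  proof (cases "finite F")
    case True
    then have fin: "finite (Field \<kappa>1)" "finite (Field \<kappa>2)" "finite K" "finite S" "finite (K - S)"
      using F SK by (auto simp: finite_Plus_iff K_def intro: finite_subset)
    have "card S < card (Field \<kappa>2)" "card (K - S) < card (Field \<kappa>1)"
      using less fin not_ordLess_ordLeq unfolding card_of_ordLeq[symmetric]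
      by (metis card_of_ordLeq inj_on_iff_card_le not_le)+
    \<comment> \<open>For empty \<open>F\<close> the chosen point would not belong to it, and the
      subtraction of 1 would be wrong; the strict inequalities exclude this case.\<close>
    moreover have "F \<noteq> {}" using calculation F by auto
    then have "pt \<in> F" unfolding pt_def by (simp add: some_in_eq)
    then have "card K = card (Field \<kappa>1) + card (Field \<kappa>2) - 1"
      using True fin by (simp add: K_def F card_Plus)
    moreover have "card K = card S + card (K - S)"
      using fin SK by (metis card_Diff_subset card_mono le_add_diff_inverse)
    ultimately show False by linarith
  next
    case False
    have "|S| <o |F|" "|K - S| <o |F|"
      using less card_of_Plus1 card_of_Plus2 ordLess_ordLeq_trans unfolding F by blast+
    then have "|S \<union> (K - S)| <o |F|" using False by (intro card_of_Un_ordLess_infinite)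
    then have "|K| <o |F|" using SK by (simp add: Un_absorb1)
    moreover have "infinite K" using False by (simp add: K_def)
    then have "|K \<union> {pt}| \<le>o |K|"
      by (intro card_of_Un_le card_of_mono1 card_of_singl_ordLeq) auto
    then have "|F| \<le>o |K|" by (rule card_of_subset_le[rotated]) (auto simp: K_def)
    ultimately show False using not_ordLess_ordLeq by blast
  qed
qed

theorem proposition6p5:
  fixes L :: "('f, 'r) lang"
    and T :: "('f, 'r) fm set"
    and U :: "('f, 'r, 'm) struct"
    and \<mu> :: "'k rel"
    and A :: "'m set"
    and X :: "'x set" and a :: "'x \<Rightarrow> 'm"
    and Y :: "'y set" and b :: "'y \<Rightarrow> 'm"
    and \<kappa>1 :: "'i rel" and \<kappa>2 :: "'j rel"
  assumes "complete_theory L T"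
    and "monster_model L T U \<mu>"
    and "NIP L U"
    and "A \<subseteq> univ U" and "|A| <o \<mu>"
    and "a ` X \<subseteq> univ U" and "|X| <o \<mu>"
    and "b ` Y \<subseteq> univ U" and "|Y| <o \<mu>"
    and "Card_order \<kappa>1" and "Card_order \<kappa>2"
    and "str_tp_less L U \<mu> X a A \<kappa>1"
    and "str_tp_less L U \<mu> Y b (A \<union> a ` X) \<kappa>2"
  shows "str_tp_less L U \<mu> (X <+> Y) (case_sum a b) A (card_pred (\<kappa>1 +c \<kappa>2))"
  unfolding str_tp_less_def str_less_def
proof (rule notI, elim exE conjE)
  let ?K = "Field (card_pred (\<kappa>1 +c \<kappa>2))"
  fix d :: "'x + 'y \<Rightarrow> 'm" and V :: "'i + 'j \<Rightarrow> 'm set" and I J :: "'i + 'j \<Rightarrow> ('m, 'm, 'm) tseq"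
    and c :: "'i + 'j \<Rightarrow> 'm \<Rightarrow> 'm"
  assume d: "realizes U (X <+> Y) d (tp L U (X <+> Y) (case_sum a b) A)"
    and seqs: "\<forall>i\<in>?K. |V i| <o \<mu> \<and>
      is_tseq U (V i) (I i) \<and> |Field (fst (I i))| <o \<mu> \<and> without_endpoints (I i) \<and>
      is_tseq U (V i) (J i) \<and> |Field (fst (J i))| <o \<mu> \<and> without_endpoints (J i) \<and>
      c i ` V i \<subseteq> univ U"
    and concat: "mutually_indiscernible L U ?K V (\<lambda>i. concat_tseq (I i) (J i)) (A \<union> d ` (X <+> Y))"
    and insert: "mutually_indiscernible L U ?K V (\<lambda>i. insert_tseq (I i) (c i) (J i)) A"
    and not: "\<forall>i\<in>?K. \<not> indiscernible L U (V i) (insert_tseq (I i) (c i) (J i)) (A \<union> d ` (X <+> Y))"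
  interpret monster L T U \<mu> by unfold_locales fact
  \<comment> \<open>The tuple \<open>d\<close> realizes the type of \<open>a, b\<close> over
    \<open>A\<close> but need not equal \<open>a, b\<close>, so \<open>A a\<close> is represented by
    \<open>?D1\<close>, with the first part of \<open>d\<close> in place of
    \<open>a\<close>.\<close>
  let ?D1 = "A \<union> (\<lambda>x. d (Inl x)) ` X" and ?D2 = "A \<union> d ` (X <+> Y)"
  have d_univ: "d ` (X <+> Y) \<subseteq> univ U" using d by (simp add: realizes_def)
  have D: "?D1 \<subseteq> ?D2" "?D2 \<subseteq> univ U" "|?D2| <o \<mu>"
    using d_univ \<open>A \<subseteq> univ U\<close> small_Un[OF \<open>|A| <o \<mu>\<close> small_image[OF small_Plus[OF \<open>|X| <o \<mu>\<close> \<open>|Y| <o \<mu>\<close>], of d]]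
    by auto
  have lin: "Linear_order (fst (I i))" "Linear_order (fst (J i))" if "i \<in> ?K" for i
    using seqs that by (auto simp: is_tseq_def)
  let ?le = "array_le I J" and ?val = "array_val I c J"
  have outer2: "array_indiscernible L U ?le (outer_slots ?K V I J) ?val ?D2"
    using mutually_indiscernible_concat_iff[of ?K I J L U V ?D2 c, OF lin] concat by blast
  have full: "array_indiscernible L U ?le (outer_slots ?K V I J \<union> mid_slots ?K V) ?val A"
    using mutually_indiscernible_insert_iff[of ?K I J L U V c A, OF lin] insert by blast
  have not2: "\<not> array_indiscernible L U ?le (outer_slots {i} V I J \<union> mid_slots {i} V) ?val ?D2" if "i \<in> ?K" for i
    using indiscernible_insert_iff[of I i J, OF lin[OF that]] not that by blast
  \<comment> \<open>The same sequences are viewed over two bases. The failures of single sequences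
    are given over \<open>?D2\<close>, while the maximal set \<open>S\<close> and the absorption
    refer to \<open>?D1\<close>.\<close>
  interpret ab: pattern L T U \<mu> ?K V I J c A ?D2
    using seqs D outer2 full by unfold_locales auto
  interpret a: pattern L T U \<mu> ?K V I J c A ?D1
    using seqs D small_subset[OF D(1,3)] array_indiscernible_mono[OF outer2 order_refl D(1)] full
    by unfold_locales auto
  obtain S where S: "S \<subseteq> ?K" "array_indiscernible L U ?le (outer_slots ?K V I J \<union> mid_slots S V) ?val ?D1"
    "\<And>i. i \<in> ?K - S \<Longrightarrow>
       \<not> array_indiscernible L U ?le (outer_slots ?K V I J \<union> mid_slots S V \<union> mid_slots {i} V) ?val ?D1"
    using a.maximal_centre by blast
  from card_pred_csum_split[OF S(1)] show False
  proof
    assume "|Field \<kappa>2| \<le>o |S|"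
    then obtain f where f: "inj_on f (Field \<kappa>2)" "f ` Field \<kappa>2 \<subseteq> S" using card_of_ordLeq by metis
    let ?K' = "f ` Field \<kappa>2"
    have K': "?K' \<subseteq> ?K" using f(2) S(1) by blast
    have same: "psat U (case_sum a b) \<theta>" if "\<theta> \<in> fms_over L (X <+> Y) A" "psat U d \<theta>" for \<theta>
    proof (rule ccontr)
      obtain \<phi> \<sigma> where \<theta>: "\<theta> = (\<phi>, \<sigma>)" by force
      assume "\<not> psat U (case_sum a b) \<theta>"
      then have "(Neg \<phi>, \<sigma>) \<in> tp L U (X <+> Y) (case_sum a b) A"
        using that(1) by (simp add: tp_def \<theta> psat_Neg fms_over_Neg)
      then have "psat U d (Neg \<phi>, \<sigma>)" using d by (auto simp: realizes_def)
      then show False using that(2) by (simp add: \<theta> psat_Neg)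
    qed
    have ab_univ: "case_sum a b ` (X <+> Y) \<subseteq> univ U"
      using \<open>a ` X \<subseteq> univ U\<close> \<open>b ` Y \<subseteq> univ U\<close> by auto
    \<comment> \<open>The second hypothesis concerns a type over \<open>A\<close> and the original
      \<open>a\<close>, so the whole pattern has to be conjugated by an automorphism over
      \<open>A\<close> taking \<open>d\<close> to \<open>a, b\<close>.\<close>
    obtain g where g: "automorphism L U g" "\<And>x. x \<in> A \<Longrightarrow> g x = x"
      "\<And>z. z \<in> X <+> Y \<Longrightarrow> g (d z) = case_sum a b z"
      using same_type_automorphism[OF \<open>A \<subseteq> univ U\<close> \<open>|A| <o \<mu>\<close> small_Plus[OF \<open>|X| <o \<mu>\<close> \<open>|Y| <o \<mu>\<close>]
          d_univ ab_univ same] by blast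
    have gA: "g ` A = A" using g(2) by force
    have "g ` (\<lambda>x. d (Inl x)) ` X = a ` X"
      unfolding image_image using g(3)[OF InlI] by (intro image_cong) simp_all
    then have gD1: "g ` ?D1 = A \<union> a ` X" using gA by (simp add: image_Un)
    have "g ` d ` (X <+> Y) = case_sum a b ` (X <+> Y)"
      unfolding image_image using g(3) by (intro image_cong) simp_all
    also have "\<dots> = a ` X \<union> b ` Y" by (simp add: Plus_def image_Un image_image)
    finally have gD2: "g ` ?D2 = A \<union> a ` X \<union> b ` Y" using gA by (simp add: image_Un Un_assoc)
    define Ig where "Ig i = (fst (I i), \<lambda>t v. g (snd (I i) t v))" for i
    define Jg where "Jg i = (fst (J i), \<lambda>t v. g (snd (J i) t v))" for i
    define cg where "cg i v = g (c i v)" for i v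
    have conj: "array_le Ig Jg = ?le" "array_val Ig cg Jg = (\<lambda>p. g (?val p))"
      "outer_slots N V Ig Jg = outer_slots N V I J" for N
      by (auto simp: fun_eq_iff array_le_def array_val_def outer_slots_def Ig_def Jg_def cg_def split: pos.splits)
    have lin': "Linear_order (fst (Ig i))" "Linear_order (fst (Jg i))" if "i \<in> ?K" for i
      using lin[OF that] by (simp_all add: Ig_def Jg_def)
    have g_univ: "g m \<in> univ U" if "m \<in> univ U" for m
      using g(1) that by (auto simp: automorphism_def bij_betw_def)
    have conjugate: "array_indiscernible L U ?le P (\<lambda>p. g (?val p)) (g ` C) \<longleftrightarrow> array_indiscernible L U ?le P ?val C"
      if "C \<subseteq> ?D2" "P \<subseteq> outer_slots ?K V I J \<union> mid_slots ?K V" for C P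
      using that D(2) ab.val_univ by (intro array_indiscernible_conjugate[OF g(1)]) blast+
    have slots: "outer_slots ?K' V I J \<subseteq> outer_slots ?K V I J" "mid_slots ?K' V \<subseteq> mid_slots S V"
      "mid_slots ?K' V \<subseteq> mid_slots ?K V"
      using K' f(2) by (auto simp: outer_slots_def mid_slots_def)
    have "array_indiscernible L U ?le (outer_slots ?K' V I J) ?val ?D2"
      using array_indiscernible_mono[OF outer2 slots(1)] by blast
    then have "array_indiscernible L U ?le (outer_slots ?K' V I J) (\<lambda>p. g (?val p)) (A \<union> a ` X \<union> b ` Y)"
      using conjugate[of ?D2 "outer_slots ?K' V I J"] slots(1) unfolding gD2 by blast
    then have "mutually_indiscernible L U ?K' V (\<lambda>i. concat_tseq (Ig i) (Jg i)) (A \<union> a ` X \<union> b ` Y)"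
      using mutually_indiscernible_concat_iff[of ?K' Ig Jg L U V "A \<union> a ` X \<union> b ` Y" cg] lin' K'
      unfolding conj by blast
    note concat' = mutually_indiscernible_reindex[OF f(1) this]
    have "array_indiscernible L U ?le (outer_slots ?K' V I J \<union> mid_slots ?K' V) ?val ?D1"
      using array_indiscernible_mono[OF S(2) Un_mono[OF slots(1,2)]] by blast
    then have "array_indiscernible L U ?le (outer_slots ?K' V I J \<union> mid_slots ?K' V) (\<lambda>p. g (?val p)) (A \<union> a ` X)"
      using conjugate[OF D(1) Un_mono[OF slots(1,3)]] unfolding gD1 by blast
    then have "mutually_indiscernible L U ?K' V (\<lambda>i. insert_tseq (Ig i) (cg i) (Jg i)) (A \<union> a ` X)"
      using mutually_indiscernible_insert_iff[of ?K' Ig Jg L U V cg "A \<union> a ` X"] lin' K'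
      unfolding conj by blast
    note insert' = mutually_indiscernible_reindex[OF f(1) this]
    have not': "\<not> indiscernible L U (V i) (insert_tseq (Ig i) (cg i) (Jg i)) (A \<union> a ` X \<union> b ` Y)" if i: "i \<in> ?K'" for i
    proof -
      have iK: "i \<in> ?K" using i K' by blast
      have "outer_slots {i} V I J \<union> mid_slots {i} V \<subseteq> outer_slots ?K V I J \<union> mid_slots ?K V"
        using iK by (auto simp: outer_slots_def mid_slots_def)
      from conjugate[OF order_refl this] show ?thesis
        using not2[OF iK] indiscernible_insert_iff[of Ig i Jg L U V cg, OF lin'[OF iK]] unfolding gD2 conj by blast
    qed
    have seqs': "|V i| <o \<mu> \<and>
        is_tseq U (V i) (Ig i) \<and> |Field (fst (Ig i))| <o \<mu> \<and> without_endpoints (Ig i) \<and>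
        is_tseq U (V i) (Jg i) \<and> |Field (fst (Jg i))| <o \<mu> \<and> without_endpoints (Jg i) \<and>
        cg i ` V i \<subseteq> univ U" if "i \<in> ?K'" for i
    proof -
      have "i \<in> ?K" using that K' by blast
      note seq = bspec[OF seqs this]
      have "is_tseq U (V i) (Ig i)" "is_tseq U (V i) (Jg i)" "cg i ` V i \<subseteq> univ U"
        using seq g_univ unfolding is_tseq_def Ig_def Jg_def cg_def fst_conv snd_conv image_subset_iff
        by blast+
      then show ?thesis using seq by (simp add: without_endpoints_def Ig_def Jg_def)
    qed
    have "realizes U Y b (tp L U Y b (A \<union> a ` X))"
      using \<open>b ` Y \<subseteq> univ U\<close> by (auto simp: realizes_def tp_def)
    then have "\<not> str_tp_less L U \<mu> Y b (A \<union> a ` X) \<kappa>2"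
      unfolding str_tp_less_def str_less_def not_not
      using concat' insert' not' seqs'
      by (intro exI[of _ b] exI[of _ "\<lambda>j. V (f j)"] exI[of _ "\<lambda>j. Ig (f j)"] exI[of _ "\<lambda>j. Jg (f j)"]
          exI[of _ "\<lambda>j. cg (f j)"] conjI ballI) simp_all
    then show False using assms by blast
  next
    assume "|Field \<kappa>1| \<le>o |?K - S|"
    then obtain f where f: "inj_on f (Field \<kappa>1)" "f ` Field \<kappa>1 \<subseteq> ?K - S" using card_of_ordLeq by metis
    let ?K' = "f ` Field \<kappa>1"
    \<comment> \<open>The bound is taken over \<open>?D2\<close>, where each single sequence is
      known to fail; over \<open>?D1\<close> the failure for \<open>i \<notin> S\<close> may need
      members of other sequences.\<close>
    have "|?K| <o \<mu>" using ab.NIP_bound[OF \<open>NIP L U\<close>] not2 by blast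
    then have small: "|?K'| <o \<mu>" using f(2) by (intro small_subset[of ?K' ?K]) auto
    have "\<forall>i\<in>?K'. \<not> array_indiscernible L U ?le (outer_slots ?K V I J \<union> mid_slots S V \<union> mid_slots {i} V) ?val ?D1"
      using S(3) f(2) by blast
    from a.absorbed_pattern[OF S(1) f(2) small S(2) this]
    obtain V' :: "'i + 'j \<Rightarrow> 'm set" and I' J' :: "'i + 'j \<Rightarrow> ('m, 'm, 'm) tseq" and c' :: "'i + 'j \<Rightarrow> 'm \<Rightarrow> 'm" where
      seqs': "\<forall>i\<in>?K'. |V' i| <o \<mu> \<and>
         is_tseq U (V' i) (I' i) \<and> |Field (fst (I' i))| <o \<mu> \<and> without_endpoints (I' i) \<and>
         is_tseq U (V' i) (J' i) \<and> |Field (fst (J' i))| <o \<mu> \<and> without_endpoints (J' i) \<and>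
         c' i ` V' i \<subseteq> univ U"
      and concat': "mutually_indiscernible L U ?K' V' (\<lambda>i. concat_tseq (I' i) (J' i)) ?D1"
      and insert': "mutually_indiscernible L U ?K' V' (\<lambda>i. insert_tseq (I' i) (c' i) (J' i)) A"
      and not': "\<forall>i\<in>?K'. \<not> indiscernible L U (V' i) (insert_tseq (I' i) (c' i) (J' i)) ?D1"
      by (elim exE conjE) (rule that)
    have "realizes U X (\<lambda>x. d (Inl x)) (tp L U X a A)"
      unfolding realizes_def
    proof (intro conjI ballI)
      show "(\<lambda>x. d (Inl x)) ` X \<subseteq> univ U" using D by auto
      fix \<theta> assume "\<theta> \<in> tp L U X a A"
      moreover obtain \<phi> \<sigma> where \<theta>: "\<theta> = (\<phi>, \<sigma>)" by force
      ultimately have \<sigma>: "(\<phi>, \<sigma>) \<in> fms_over L X A" "psat U a (\<phi>, \<sigma>)" by (auto simp: tp_def)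
      let ?\<sigma> = "\<lambda>x. map_sum Inl id (\<sigma> x)"
      have push: "psat U h (\<phi>, ?\<sigma>) \<longleftrightarrow> psat U (\<lambda>x. h (Inl x)) (\<phi>, \<sigma>)" for h :: "'x + 'y \<Rightarrow> 'm"
        by (rule psat_cong) (auto split: sum.splits)
      have "(\<phi>, ?\<sigma>) \<in> fms_over L (X <+> Y) A" by (rule fms_over_map[OF \<sigma>(1)]) auto
      moreover have "psat U (case_sum a b) (\<phi>, ?\<sigma>)" unfolding push using \<sigma>(2) by simp
      ultimately have "psat U d (\<phi>, ?\<sigma>)" using d by (auto simp: realizes_def tp_def)
      then show "psat U (\<lambda>x. d (Inl x)) \<theta>" unfolding push \<theta> .
    qed
    then have "\<not> str_tp_less L U \<mu> X a A \<kappa>1"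
      unfolding str_tp_less_def str_less_def not_not
      using mutually_indiscernible_reindex[OF f(1) concat'] mutually_indiscernible_reindex[OF f(1) insert'] not' seqs'
      by (intro exI[of _ "\<lambda>x. d (Inl x)"] exI[of _ "\<lambda>j. V' (f j)"] exI[of _ "\<lambda>j. I' (f j)"]
          exI[of _ "\<lambda>j. J' (f j)"] exI[of _ "\<lambda>j. c' (f j)"] conjI ballI) simp_all
    then show False using assms by blast
  qed
qed

end
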